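(* Let $d\in\mathbb{N}$, $T>0$, and let $\alpha\in(1/3,1/2)$ and $p\in(1,+\infty]$ be such that $\alpha>1/p$. For every Sobolev path $X\in W^{\alpha}_p([0,T];\mathbb{R}^d)$ there exists a rough path lift $\mathbf{X}=(X,\mathbb{X})\in W^{\alpha}_p([0,T];G^2(\mathbb{R}^d))$ of $X$.
   Context: Convention: $1/p:=0$ if $p=+\infty$. **Sobolev paths.** For $\alpha\in(0,1)$, $W^{\alpha}_p([0,T];\mathbb{R}^d)$ is the space of continuous functions $X:[0,T]\to\mathbb{R}^d$ with $\|X\|_{W^\alpha_p}<+\infty$, where for $p<+\infty$ $$\|X\|_{W^\alpha_p}:=\Big(\iint_{[0,T]^2}\frac{|X_u-X_v|^p}{|v-u|^{\alpha p+1}}\,du\,dv\Big)^{1/p}+\Big(\int_0^T|X_u|^p\,du\Big)^{1/p},$$ and for $p=+\infty$, $\|X\|_{W^\alpha_\infty}:=\sup_{u\neq v}\frac{|X_u-X_v|}{|v-u|^\alpha}+\sup_u|X_u|$ (Hölder regularity). **The group $G^2(\mathbb{R}^d)$.** Let $T^2(\mathbb{R}^d)=\mathbb{R}\oplus\mathbb{R}^d\oplus(\mathbb{R}^d)^{\otimes2}$ with (truncated) tensor multiplication $\otimes$, and let $\pi_i$ be the projection onto the $i$-th level, $i=0,1,2$. For a continuous path $Z:[0,1]\to\mathbb{R}^d$ of finite variation let $$S_2(Z)_{0,1}:=\Big(1,\int_{0<u<1}dZ_u,\int_{0<u_1<u_2<1}dZ_{u_1}\otimes dZ_{u_2}\Big)\in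 T^2(\mathbb{R}^d).$$ $G^2(\mathbb{R}^d):=\{S_2(Z)_{0,1}: Z\text{ continuous of finite variation}\}$ is the step-2 free nilpotent group with respect to $\otimes$. The Carnot–Carathéodory norm $\|g\|_{cc}$ of $g\in G^2(\mathbb{R}^d)$ is the infimum of the lengths (total variations) of continuous finite-variation paths $Z$ with $S_2(Z)_{0,1}=g$, and $d_{cc}(g,h):=\|g^{-1}\otimes h\|_{cc}$. **Sobolev rough paths.** $W^\alpha_p([0,T];G^2(\mathbb{R}^d))$ is the space of continuous paths $\mathbf{X}:[0,T]\to G^2(\mathbb{R}^d)$ with $$\|\mathbf{X}\|_{W^\alpha_p}:=\Big(\iint_{[0,T]^2}\frac{d_{cc}(\mathbf{X}_s,\mathbf{X}_t)^p}{|t-s|^{\alpha p+1}}\,ds\,dt\Big)^{1/p}<+\infty,$$ where for $p=+\infty$ this is read as $\sup_{s\neq t}d_{cc}(\mathbf{X}_s,\mathbf{X}_t)/|t-s|^\alpha$. **Rough path lift.** Write $\mathbf{X}_{s,t}:=\mathbf{X}_s^{-1}\otimes\mathbf{X}_t$. The path $\mathbf{X}$ is a rough path lift of $X$ if its projection onto the path level is $X$, i.e. $\pi_1(\mathbf{X}_{s,t})=X_t-X_s$ for all $s,t\in[0,T]$; $\mathbb{X}$ denotes the second-level component of $\mathbf{X}$. *)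

theory Defs
  imports "HOL-Analysis.Analysis"
begin

section \<open>The truncated tensor algebra of step 2\<close>

type_synonym 'd tensor2 = "real \<times> (real ^ 'd) \<times> (real ^ 'd ^ 'd)"

abbreviation \<pi>\<^sub>0 :: "'d::finite tensor2 \<Rightarrow> real" where
  "\<pi>\<^sub>0 a \<equiv> fst a"

abbreviation \<pi>\<^sub>1 :: "'d::finite tensor2 \<Rightarrow> real ^ 'd" where
  "\<pi>\<^sub>1 a \<equiv> fst (snd a)"

abbreviation \<pi>\<^sub>2 :: "'d::finite tensor2 \<Rightarrow> real ^ 'd ^ 'd" where
  "\<pi>\<^sub>2 a \<equiv> snd (snd a)"

text \<open>The elementary tensor of \<open>x\<close> and \<open>y\<close>; its coordinate at \<open>(i, j)\<close> is \<open>$ i $ j\<close>.\<close>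
definition vec_tensor :: "real ^ 'd::finite \<Rightarrow> real ^ 'd \<Rightarrow> real ^ 'd ^ 'd" where
  "vec_tensor x y = (\<chi> i j. x $ i * y $ j)"

definition tensor_mult :: "'d::finite tensor2 \<Rightarrow> 'd tensor2 \<Rightarrow> 'd tensor2" (infixl \<open>\<otimes>\<^sub>T\<close> 70) where
  "a \<otimes>\<^sub>T b =
     (\<pi>\<^sub>0 a * \<pi>\<^sub>0 b,
      \<pi>\<^sub>0 a *\<^sub>R \<pi>\<^sub>1 b + \<pi>\<^sub>0 b *\<^sub>R \<pi>\<^sub>1 a,
      \<pi>\<^sub>0 a *\<^sub>R \<pi>\<^sub>2 b + vec_tensor (\<pi>\<^sub>1 a) (\<pi>\<^sub>1 b) + \<pi>\<^sub>0 b *\<^sub>R \<pi>\<^sub>2 a)"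

definition tensor_one :: "'d::finite tensor2" where
  "tensor_one = (1, 0, 0)"

definition tensor_inv :: "'d::finite tensor2 \<Rightarrow> 'd tensor2" where
  "tensor_inv a = (THE b. a \<otimes>\<^sub>T b = tensor_one \<and> b \<otimes>\<^sub>T a = tensor_one)"

text \<open>On \<open>{a. \<pi>\<^sub>0 a = 1}\<close>, which contains \<open>G2\<close> below, the inverse exists and is given by
  the Neumann series.\<close>
lemma tensor_inv_eq:
  "tensor_inv (1, x, A) = (1, - x, vec_tensor x x - A)"
  unfolding tensor_inv_def
proof (rule the_equality)
  show "(1, x, A) \<otimes>\<^sub>T (1, - x, vec_tensor x x - A) = tensor_one \<and>
        (1, - x, vec_tensor x x - A) \<otimes>\<^sub>T (1, x, A) = tensor_one"
    by (simp add: tensor_mult_def tensor_one_def vec_tensor_def vec_eq_iff)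
next
  fix b assume "(1, x, A) \<otimes>\<^sub>T b = tensor_one \<and> b \<otimes>\<^sub>T (1, x, A) = tensor_one"
  then have b: "(1, x, A) \<otimes>\<^sub>T b = tensor_one" ..
  obtain b0 b1 b2 where b_eq: "b = (b0, b1, b2)" by (cases b) auto
  from b have *: "b0 = 1" "b1 + b0 *\<^sub>R x = 0" "b2 + vec_tensor x b1 + b0 *\<^sub>R A = 0"
    by (auto simp: b_eq tensor_mult_def tensor_one_def)
  then have "b1 = - x" by (simp add: eq_neg_iff_add_eq_0)
  moreover have "vec_tensor x (- x) = - vec_tensor x x"
    by (simp add: vec_tensor_def vec_eq_iff)
  ultimately have "b2 - vec_tensor x x + A = 0"
    using * by simp
  then have "b2 = vec_tensor x x - A"
    by (metis add.commute add_diff_cancel_left' diff_add_cancel diff_0 minus_diff_eq add_eq_0_iff)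
  with * \<open>b1 = - x\<close> show "b = (1, - x, vec_tensor x x - A)"
    by (simp add: b_eq)
qed


section \<open>Riemann-Stieltjes integral and variation\<close>

text \<open>The limit is taken as the mesh tends to \<open>0\<close>, not along gauges as in the
  Henstock-Kurzweil integral. For an interval \<open>K\<close> of the division, \<open>Inf K\<close> and \<open>Sup K\<close> are
  its endpoints.\<close>
definition has_rs_integral ::
    "(real \<Rightarrow> real) \<Rightarrow> (real \<Rightarrow> real) \<Rightarrow> real \<Rightarrow> real \<Rightarrow> real \<Rightarrow> bool" where
  "has_rs_integral f g a b I \<longleftrightarrow>
     (\<forall>e>0. \<exists>\<delta>>0. \<forall>D. D tagged_division_of {a..b} \<and> (\<forall>(x, K)\<in>D. Sup K - Inf K < \<delta>) \<longrightarrow>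
        \<bar>(\<Sum>(x, K)\<in>D. f x * (g (Sup K) - g (Inf K))) - I\<bar> < e)"

definition rs_integral :: "real \<Rightarrow> real \<Rightarrow> (real \<Rightarrow> real) \<Rightarrow> (real \<Rightarrow> real) \<Rightarrow> real" where
  "rs_integral a b f g = (THE I. has_rs_integral f g a b I)"

definition variation_sum :: "(real \<Rightarrow> 'a::real_normed_vector) \<Rightarrow> real set set \<Rightarrow> real" where
  "variation_sum Z D = (\<Sum>K\<in>D. norm (Z (Sup K) - Z (Inf K)))"

definition finite_variation :: "real \<Rightarrow> real \<Rightarrow> (real \<Rightarrow> 'a::real_normed_vector) \<Rightarrow> bool" where
  "finite_variation a b Z \<longleftrightarrow> bdd_above (variation_sum Z ` {D. D division_of {a..b}})"

definition total_variation :: "real \<Rightarrow> real \<Rightarrow> (real \<Rightarrow> 'a::real_normed_vector) \<Rightarrow> real" where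
  "total_variation a b Z = (SUP D\<in>{D. D division_of {a..b}}. variation_sum Z D)"


section \<open>The step-2 free nilpotent group and its Carnot-Caratheodory distance\<close>

definition cfv_paths :: "(real \<Rightarrow> real ^ 'd::finite) set" where
  "cfv_paths = {Z. continuous_on {0..1} Z \<and> finite_variation 0 1 Z}"

text \<open>The iterated integral over \<open>0 < u1 < u2 < 1\<close> is evaluated with \<open>u1\<close> innermost.\<close>
definition S2 :: "(real \<Rightarrow> real ^ 'd::finite) \<Rightarrow> 'd tensor2" where
  "S2 Z =
     (1,
      \<chi> i. rs_integral 0 1 (\<lambda>u. 1) (\<lambda>u. Z u $ i),
      \<chi> i j. rs_integral 0 1 (\<lambda>u2. rs_integral 0 u2 (\<lambda>u1. 1) (\<lambda>u1. Z u1 $ i)) (\<lambda>u2. Z u2 $ j))"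

definition G2 :: "'d::finite tensor2 set" where
  "G2 = S2 ` cfv_paths"

definition cc_norm :: "'d::finite tensor2 \<Rightarrow> real" where
  "cc_norm g = (INF Z\<in>{Z \<in> cfv_paths. S2 Z = g}. total_variation 0 1 Z)"

definition cc_dist :: "'d::finite tensor2 \<Rightarrow> 'd tensor2 \<Rightarrow> real" where
  "cc_dist g h = cc_norm (tensor_inv g \<otimes>\<^sub>T h)"


section \<open>Sobolev paths and Sobolev rough paths\<close>

text \<open>Used for exponents \<open>r > 0\<close> only.\<close>
definition ennreal_powr :: "ennreal \<Rightarrow> real \<Rightarrow> ennreal" where
  "ennreal_powr x r = (if x = \<infinity> then \<infinity> else ennreal (enn2real x powr r))"

text \<open>In the first case the integrand is \<open>0\<close> on the (Lebesgue null) diagonal, because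
  \<open>x / 0 = 0\<close>.\<close>
definition sobolev_seminorm ::
    "('a \<Rightarrow> 'a \<Rightarrow> real) \<Rightarrow> real \<Rightarrow> ereal \<Rightarrow> real \<Rightarrow> (real \<Rightarrow> 'a) \<Rightarrow> ennreal" where
  "sobolev_seminorm \<rho> \<alpha> p T Y =
     (if p \<noteq> \<infinity> then
        (let q = real_of_ereal p in
         ennreal_powr
           (\<integral>\<^sup>+z\<in>{0..T} \<times> {0..T}.
              ennreal (\<rho> (Y (fst z)) (Y (snd z)) powr q / \<bar>snd z - fst z\<bar> powr (\<alpha> * q + 1)) \<partial>lborel)
           (1 / q))
      else
        (SUP (u, v)\<in>{(u, v). u \<in> {0..T} \<and> v \<in> {0..T} \<and> u \<noteq> v}.
           ennreal (\<rho> (Y u) (Y v) / \<bar>v - u\<bar> powr \<alpha>)))"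

definition lp_norm :: "ereal \<Rightarrow> real \<Rightarrow> (real \<Rightarrow> 'a::real_normed_vector) \<Rightarrow> ennreal" where
  "lp_norm p T X =
     (if p \<noteq> \<infinity> then
        (let q = real_of_ereal p in
         ennreal_powr (\<integral>\<^sup>+u\<in>{0..T}. ennreal (norm (X u) powr q) \<partial>lborel) (1 / q))
      else (SUP u\<in>{0..T}. ennreal (norm (X u))))"

definition sobolev_norm ::
    "real \<Rightarrow> ereal \<Rightarrow> real \<Rightarrow> (real \<Rightarrow> real ^ 'd::finite) \<Rightarrow> ennreal" where
  "sobolev_norm \<alpha> p T X = sobolev_seminorm dist \<alpha> p T X + lp_norm p T X"

text \<open>Paths on \<open>[0,T]\<close> are functions on the whole line, whose values outside \<open>[0,T]\<close> are
  irrelevant.\<close>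
definition sobolev_paths :: "real \<Rightarrow> ereal \<Rightarrow> real \<Rightarrow> (real \<Rightarrow> real ^ 'd::finite) set" where
  "sobolev_paths \<alpha> p T = {X. continuous_on {0..T} X \<and> sobolev_norm \<alpha> p T X < \<infinity>}"

text \<open>\<open>G2\<close> carries the subspace topology of the truncated tensor algebra, which is also the
  topology of \<open>cc_dist\<close>.\<close>
definition sobolev_rough_paths :: "real \<Rightarrow> ereal \<Rightarrow> real \<Rightarrow> (real \<Rightarrow> 'd::finite tensor2) set" where
  "sobolev_rough_paths \<alpha> p T =
     {Y. Y ` {0..T} \<subseteq> G2 \<and> continuous_on {0..T} Y \<and> sobolev_seminorm cc_dist \<alpha> p T Y < \<infinity>}"

definition rough_path_lift ::
    "real \<Rightarrow> (real \<Rightarrow> real ^ 'd::finite) \<Rightarrow> (real \<Rightarrow> 'd tensor2) \<Rightarrow> bool" where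
  "rough_path_lift T X Y \<longleftrightarrow>
     (\<forall>s\<in>{0..T}. \<forall>t\<in>{0..T}. \<pi>\<^sub>1 (tensor_inv (Y s) \<otimes>\<^sub>T Y t) = X t - X s)"

end

theory Submission
  imports Defs
begin

text \<open>
  Below the exponent \<open>1/2\<close> the increments \<open>X s $ i * (X t $ j - X s $ j)\<close> do not determine an
  iterated integral, but they can still be sewn together, non-uniquely and linearly in each factor:
  with \<open>F n\<close> and \<open>G n\<close> the averages of \<open>f\<close> and \<open>g\<close> at scale \<open>2^-n\<close>, the series
  \<open>h = (\<Sum>n. F n * (G (n + 1) - G n))\<close> satisfies \<open>h t - h s - f s * (g t - g s) = O(|t - s|^(2 c))\<close>
  for exponents \<open>c < 1/2\<close>, since the scales above \<open>|t - s|\<close> contribute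
  \<open>|t - s| * (\<Sum>\<epsilon>. \<epsilon>^(2 c - 1))\<close>, a geometric sum dominated by its finest scale.
  Antisymmetrising \<open>h\<close> gives the area of the lift.

  The estimate only uses the oscillation of \<open>X\<close> seen from \<open>s\<close>. For finite \<open>p\<close> this is controlled
  pointwise by the energy \<open>\<integral>\<integral> |X u - X v|^p / |u - v|^(\<alpha>' p + 1)\<close>, weighted by a negative power of
  \<open>max |u - s| |v - s| |t - s|\<close>, with an exponent \<open>\<alpha>'\<close> slightly smaller than \<open>\<alpha>\<close>. Integrating over
  \<open>(s, t)\<close> first, the loss from \<open>\<alpha>\<close> to \<open>\<alpha>'\<close> is exactly restored, so the Sobolev norm of the lift
  is bounded by that of \<open>X\<close>.
\<close>

section \<open>Riemann-Stieltjes integrals and lengths of paths\<close>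

text \<open>In \<open>G2\<close> the symmetric part of the second level is always half the tensor
  square of the first, so only the antisymmetric part, the area, can be chosen. The
  \<open>cc_norm\<close> is at most a multiple of the length of the first level plus the square
  roots of the area entries; hence sewing errors quadratic in the local constant \<open>k\<close> of
  the path become distances linear in \<open>k\<close>. For finite p the obstacle is that a Hoelder
  constant valid on all of [0,T] is in general available only with exponent \<alpha> - 1/p, and an
  estimate through it would lose 1/p of regularity. So \<open>h\<close> is built without reference
  to s and t, while its error is bounded by a \<open>k\<close> that may vary with (s, t). Linearity
  in \<open>k\<close> makes the p-th power of the distance linear in the energy, so Tonelli's
  theorem can exchange the integrals over (s, t) and (u, v). The free exponents are set to
  midpoints: \<alpha>' lies halfway between 1/p and \<alpha>, and the exponent \<open>c\<close> of
  the sewing lies halfway between \<alpha> and 1/2. Both gaps are needed: the first makes the path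
  Hoelder continuous and the kernel integrable at infinity, the second makes the singularity on the
  diagonal s = t integrable.\<close>

lemma tagged_division_realE:
  assumes "D tagged_division_of {a..b::real}" "(x, K) \<in> D"
  obtains u v where "K = {u..v}" "u \<le> v" "Inf K = u" "Sup K = v" "u \<le> x" "x \<le> v" "a \<le> u" "v \<le> b"
proof -
  obtain u v where K: "K = cbox u v" using tagged_division_ofD(4)[OF assms] by blast
  have x: "x \<in> K" "K \<subseteq> {a..b}" using tagged_division_ofD(2,3)[OF assms] by auto
  show thesis using x K by (intro that[of u v]) auto
qed

text \<open>The fine divisions of gauge theory supply one division whose mesh meets both bounds, so
  a single Riemann sum is close to both values.\<close>

lemma rs_integral_unique:
  assumes "a \<le> b" and I: "has_rs_integral f g a b I" and J: "has_rs_integral f g a b J"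
  shows "I = J"
proof (rule ccontr)
  assume "I \<noteq> J"
  then have e: "\<bar>I - J\<bar> / 2 > 0" by simp
  from I[unfolded has_rs_integral_def, rule_format, OF e] obtain d1 where d1: "d1 > 0"
    "\<And>D. D tagged_division_of {a..b} \<and> (\<forall>(x, K)\<in>D. Sup K - Inf K < d1) \<Longrightarrow>
        \<bar>(\<Sum>(x, K)\<in>D. f x * (g (Sup K) - g (Inf K))) - I\<bar> < \<bar>I - J\<bar> / 2" by auto
  from J[unfolded has_rs_integral_def, rule_format, OF e] obtain d2 where d2: "d2 > 0"
    "\<And>D. D tagged_division_of {a..b} \<and> (\<forall>(x, K)\<in>D. Sup K - Inf K < d2) \<Longrightarrow>
        \<bar>(\<Sum>(x, K)\<in>D. f x * (g (Sup K) - g (Inf K))) - J\<bar> < \<bar>I - J\<bar> / 2" by auto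
  \<comment> \<open>An interval inside a ball of radius \<open>d\<close> is shorter than 2 d, hence
    shorter than both mesh bounds.\<close>
  define d where "d = min d1 d2 / 3"
  have d: "d > 0" using d1 d2 by (simp add: d_def)
  have "gauge (\<lambda>x::real. ball x d)" using d by (simp add: gauge_def)
  from fine_division_exists_real[OF this, of a b] obtain D where
    D: "D tagged_division_of {a..b}" "(\<lambda>x. ball x d) fine D" by blast
  have m: "Sup K - Inf K < min d1 d2" if xK: "(x, K) \<in> D" for x K
  proof -
    obtain u v where uv: "K = {u..v}" "u \<le> v" "Inf K = u" "Sup K = v" "u \<le> x" "x \<le> v"
      using tagged_division_realE[OF D(1) xK] by metis
    have "K \<subseteq> ball x d" using D(2) xK by (auto simp: fine_def)
    then have "u \<in> ball x d" "v \<in> ball x d" using uv by (metis atLeastAtMost_iff order_refl subsetD)+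
    then have "v - u < 2 * d" by (auto simp: dist_real_def)
    moreover have "3 * d = min d1 d2" by (simp add: d_def)
    ultimately show ?thesis using uv(3,4) d by linarith
  qed
  have "\<bar>(\<Sum>(x, K)\<in>D. f x * (g (Sup K) - g (Inf K))) - I\<bar> < \<bar>I - J\<bar> / 2"
    using m D(1) by (intro d1(2)) fastforce
  moreover have "\<bar>(\<Sum>(x, K)\<in>D. f x * (g (Sup K) - g (Inf K))) - J\<bar> < \<bar>I - J\<bar> / 2"
    using m D(1) by (intro d2(2)) fastforce
  ultimately show False by (smt (verit, best) field_sum_of_halves)
qed

lemma rs_integral_eqI:
  assumes "a \<le> b" "has_rs_integral f g a b I"
  shows "rs_integral a b f g = I"
  unfolding rs_integral_def using assms rs_integral_unique by blast

lemma has_rs_integral_one: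
  assumes "a \<le> b"
  shows "has_rs_integral (\<lambda>_. 1) g a b (g b - g a)"
  unfolding has_rs_integral_def
proof (intro allI impI)
  fix e :: real assume "e > 0"
  then show "\<exists>\<delta>>0. \<forall>D. D tagged_division_of {a..b} \<and> (\<forall>(x, K)\<in>D. Sup K - Inf K < \<delta>) \<longrightarrow>
      \<bar>(\<Sum>(x, K)\<in>D. 1 * (g (Sup K) - g (Inf K))) - (g b - g a)\<bar> < e"
    using additive_tagged_division_1[OF assms, of _ g] by (intro exI[of _ 1]) auto
qed

text \<open>On an interval of the division the increment of \<open>g\<close> is the integral of
  \<open>g'\<close>, so the error is the integral of \<open>(f x - f y) * g' y\<close> over y, which
  uniform continuity of \<open>f\<close> makes small.\<close>

lemma has_rs_integral_C1:
  fixes f g g' :: "real \<Rightarrow> real"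
  assumes ab: "a \<le> b" and f: "continuous_on {a..b} f" and g': "continuous_on {a..b} g'"
    and g: "\<And>x. x \<in> {a..b} \<Longrightarrow> (g has_vector_derivative g' x) (at x within {a..b})"
  shows "has_rs_integral f g a b (integral {a..b} (\<lambda>x. f x * g' x))"
  unfolding has_rs_integral_def
proof (intro allI impI)
  fix e :: real assume e: "e > 0"
  have "bounded (g' ` {a..b})" using compact_continuous_image[OF g'] compact_imp_bounded by blast
  then obtain M where M: "M > 0" "\<And>x. x \<in> {a..b} \<Longrightarrow> \<bar>g' x\<bar> \<le> M"
    using bounded_pos[of "g' ` {a..b}"] by auto
  \<comment> \<open>With the summand 1 the denominator is positive even for \<open>a = b\<close>,
    and the total error \<open>e' * M * (b - a)\<close> stays strictly below
    \<open>e\<close>.\<close>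
  define e' where "e' = e / (M * (b - a) + 1)"
  have pos: "M * (b - a) + 1 > 0" using M ab by (smt (verit) mult_nonneg_nonneg)
  have e': "e' > 0" using e pos by (simp add: e'_def)
  have "uniformly_continuous_on {a..b} f" using f compact_uniformly_continuous by blast
  then obtain d where d: "d > 0" "\<And>x y. x \<in> {a..b} \<Longrightarrow> y \<in> {a..b} \<Longrightarrow> dist y x < d \<Longrightarrow> dist (f y) (f x) < e'"
    unfolding uniformly_continuous_on_def using e' by metis
  have "\<bar>(\<Sum>(x, K)\<in>D. f x * (g (Sup K) - g (Inf K))) - integral {a..b} (\<lambda>x. f x * g' x)\<bar> < e"
    if D: "D tagged_division_of {a..b}" and mesh: "\<forall>(x, K)\<in>D. Sup K - Inf K < d" for D
  proof -
    have cfg: "continuous_on {a..b} (\<lambda>x. f x * g' x)" using f g' by (intro continuous_intros)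
    have I: "integral {a..b} (\<lambda>x. f x * g' x) = (\<Sum>(x, K)\<in>D. integral K (\<lambda>x. f x * g' x))"
      using integral_combine_tagged_division_topdown[of "\<lambda>x. f x * g' x" a b D]
        integrable_continuous_interval[OF cfg] D by (auto simp: box_real)
    have summand: "\<bar>f x * (g (Sup K) - g (Inf K)) - integral K (\<lambda>x. f x * g' x)\<bar> \<le> e' * M * measure lborel K"
      if xK: "(x, K) \<in> D" for x K
    proof -
      obtain u v where uv: "K = {u..v}" "u \<le> v" "Inf K = u" "Sup K = v" "u \<le> x" "x \<le> v" "a \<le> u" "v \<le> b"
        using tagged_division_realE[OF D xK] by metis
      have sub: "{u..v} \<subseteq> {a..b}" using uv by auto
      have "(g' has_integral (g v - g u)) {u..v}"
        using uv sub by (intro fundamental_theorem_of_calculus has_vector_derivative_within_subset[OF g sub]) auto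
      then have 1: "((\<lambda>y. f x * g' y) has_integral f x * (g v - g u)) {u..v}"
        by (rule has_integral_mult_right)
      have 2: "((\<lambda>y. f y * g' y) has_integral integral {u..v} (\<lambda>y. f y * g' y)) {u..v}"
        using integrable_continuous_interval[OF continuous_on_subset[OF cfg sub]] by (rule integrable_integral)
      have 3: "((\<lambda>y. f x * g' y - f y * g' y) has_integral
          (f x * (g v - g u) - integral {u..v} (\<lambda>y. f y * g' y))) {u..v}"
        by (rule has_integral_diff[OF 1 2])
      have "norm (f x * (g v - g u) - integral {u..v} (\<lambda>y. f y * g' y)) \<le> e' * M * measure lborel {u..v}"
      proof (rule has_integral_bound_real[OF _ finite.emptyI 3])
        show "0 \<le> e' * M" using e' M by simp
        fix y assume "y \<in> {u..v} - {}"
        then have y: "y \<in> {u..v}" by simp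
        have "dist x y < d" using mesh xK uv y by (force simp: dist_real_def)
        then have "\<bar>f x - f y\<bar> \<le> e'" using d(2)[of y x] uv y by (simp add: dist_real_def less_imp_le)
        moreover have "\<bar>g' y\<bar> \<le> M" using M y uv by auto
        ultimately have "\<bar>f x - f y\<bar> * \<bar>g' y\<bar> \<le> e' * M" using e' by (intro mult_mono) auto
        then show "norm (f x * g' y - f y * g' y) \<le> e' * M"
          by (simp add: left_diff_distrib[symmetric] abs_mult)
      qed
      then show ?thesis using uv by simp
    qed
    have fin: "finite D" using D by blast
    have "\<bar>(\<Sum>(x, K)\<in>D. f x * (g (Sup K) - g (Inf K))) - integral {a..b} (\<lambda>x. f x * g' x)\<bar>
      = \<bar>\<Sum>(x, K)\<in>D. f x * (g (Sup K) - g (Inf K)) - integral K (\<lambda>x. f x * g' x)\<bar>"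
      unfolding I by (simp add: sum_subtractf case_prod_unfold)
    also have "\<dots> \<le> (\<Sum>(x, K)\<in>D. e' * M * measure lborel K)"
      using summand by (intro order_trans[OF sum_abs] sum_mono) auto
    also have "\<dots> = e' * M * (b - a)"
      using additive_content_tagged_division[of D a b] D ab
      by (simp add: case_prod_unfold sum_distrib_left[symmetric] box_real)
    also have "\<dots> < e"
      using e' pos e unfolding e'_def by (simp add: field_simps)
    finally show ?thesis .
  qed
  then show "\<exists>\<delta>>0. \<forall>D. D tagged_division_of {a..b} \<and> (\<forall>(x, K)\<in>D. Sup K - Inf K < \<delta>) \<longrightarrow>
      \<bar>(\<Sum>(x, K)\<in>D. f x * (g (Sup K) - g (Inf K))) - integral {a..b} (\<lambda>x. f x * g' x)\<bar> < e"
    using d(1) by blast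
qed

text \<open>The inner integral has integrand 1 and telescopes, so the iterated integral is an
  ordinary one. This evaluates the signature of the smooth test paths that bound
  \<open>cc_norm\<close>.\<close>

lemma S2_C1:
  fixes Z :: "real \<Rightarrow> real ^ 'd::finite"
  assumes Z': "\<And>i. continuous_on {0..1} (\<lambda>u. Z' u $ i)"
    and Z: "\<And>i x. x \<in> {0..1} \<Longrightarrow> ((\<lambda>u. Z u $ i) has_vector_derivative Z' x $ i) (at x within {0..1})"
  shows "S2 Z = (1, Z 1 - Z 0, \<chi> i j. integral {0..1} (\<lambda>u. (Z u $ i - Z 0 $ i) * Z' u $ j))"
proof -
  have one: "rs_integral 0 u (\<lambda>_. 1) (\<lambda>u. Z u $ i) = Z u $ i - Z 0 $ i" if "0 \<le> u" for i u
    using that by (intro rs_integral_eqI has_rs_integral_one)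
  have cZ: "continuous_on {0..1} (\<lambda>u. Z u $ i)" for i
    using Z has_vector_derivative_continuous by (fastforce simp: continuous_on_eq_continuous_within)
  have two: "rs_integral 0 1 (\<lambda>u2. rs_integral 0 u2 (\<lambda>u1. 1) (\<lambda>u1. Z u1 $ i)) (\<lambda>u2. Z u2 $ j)
      = integral {0..1} (\<lambda>u. (Z u $ i - Z 0 $ i) * Z' u $ j)" for i j
  proof (rule rs_integral_eqI)
    let ?F = "\<lambda>u2. rs_integral 0 u2 (\<lambda>u1. 1) (\<lambda>u1. Z u1 $ i)"
    have c: "continuous_on {0..1} ?F"
      by (rule continuous_on_eq[of _ "\<lambda>u. Z u $ i - Z 0 $ i"]) (auto simp: one intro!: continuous_intros cZ)
    have "has_rs_integral ?F (\<lambda>u2. Z u2 $ j) 0 1 (integral {0..1} (\<lambda>u. ?F u * Z' u $ j))"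
      by (rule has_rs_integral_C1) (use c Z' Z in auto)
    moreover have "integral {0..1} (\<lambda>u. ?F u * Z' u $ j) = integral {0..1} (\<lambda>u. (Z u $ i - Z 0 $ i) * Z' u $ j)"
      by (rule integral_cong) (simp add: one)
    ultimately show "has_rs_integral ?F (\<lambda>u2. Z u2 $ j) 0 1 (integral {0..1} (\<lambda>u. (Z u $ i - Z 0 $ i) * Z' u $ j))"
      by simp
  qed simp
  show ?thesis unfolding S2_def two by (simp add: one vec_eq_iff)
qed

lemma lipschitz_variation_sum_le:
  fixes Z :: "real \<Rightarrow> 'a::real_normed_vector"
  assumes ab: "a \<le> b" and L: "\<And>u v. a \<le> u \<Longrightarrow> u \<le> v \<Longrightarrow> v \<le> b \<Longrightarrow> norm (Z v - Z u) \<le> L * (v - u)"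
    and D: "D division_of {a..b}"
  shows "variation_sum Z D \<le> L * (b - a)"
proof -
  have "variation_sum Z D \<le> (\<Sum>K\<in>D. L * measure lborel K)"
    unfolding variation_sum_def
  proof (rule sum_mono)
    fix K assume K: "K \<in> D"
    obtain u v where uv: "K = cbox u v" using division_ofD(4)[OF D K] by blast
    have "K \<noteq> {}" "K \<subseteq> {a..b}" using division_ofD(2,3)[OF D K] by auto
    then show "norm (Z (Sup K) - Z (Inf K)) \<le> L * measure lborel K" using uv L[of u v] by auto
  qed
  also have "\<dots> = L * (b - a)"
    using additive_content_division[of D a b] D ab by (simp add: sum_distrib_left[symmetric] box_real)
  finally show ?thesis .
qed

lemma lipschitz_finite_variation:
  fixes Z :: "real \<Rightarrow> 'a::real_normed_vector"
  assumes "a \<le> b" "\<And>u v. a \<le> u \<Longrightarrow> u \<le> v \<Longrightarrow> v \<le> b \<Longrightarrow> norm (Z v - Z u) \<le> L * (v - u)"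
  shows "finite_variation a b Z" "total_variation a b Z \<le> L * (b - a)"
proof -
  have *: "variation_sum Z D \<le> L * (b - a)" if "D division_of {a..b}" for D
    using lipschitz_variation_sum_le[OF assms(1) _ that] assms(2) by blast
  show "finite_variation a b Z"
    unfolding finite_variation_def using * by (intro bdd_aboveI[of _ "L * (b - a)"]) auto
  have "{a..b} \<noteq> {}" using assms by simp
  then have "{{a..b}} division_of {a..b}" by (metis box_real(2) division_of_self)
  then show "total_variation a b Z \<le> L * (b - a)"
    unfolding total_variation_def using * by (intro cSUP_least) auto
qed

lemma total_variation_nonneg:
  assumes "finite_variation a b Z"
  shows "0 \<le> total_variation a b Z"
proof -
  obtain D where D: "D division_of {a..b::real}" by (metis box_real(2) elementary_interval)
  have "0 \<le> variation_sum Z D" unfolding variation_sum_def by (intro sum_nonneg) auto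
  also have "\<dots> \<le> total_variation a b Z"
    unfolding total_variation_def using D assms
    by (intro cSUP_upper) (auto simp: finite_variation_def)
  finally show ?thesis .
qed

lemma cc_norm_le:
  assumes "Z \<in> cfv_paths"
  shows "cc_norm (S2 Z) \<le> total_variation 0 1 Z"
  unfolding cc_norm_def
  by (rule cINF_lower) (use assms total_variation_nonneg in \<open>auto simp: cfv_paths_def intro!: bdd_belowI[of _ 0]\<close>)

text \<open>Membership in \<open>G2\<close> makes the set of competing paths nonempty; over the
  empty set the infimum of reals carries no information.\<close>

lemma cc_norm_nonneg:
  assumes "g \<in> G2"
  shows "0 \<le> cc_norm g"
  unfolding cc_norm_def
  by (rule cINF_greatest) (use assms total_variation_nonneg in \<open>auto simp: cfv_paths_def G2_def\<close>)


section \<open>Paths with prescribed area\<close>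

text \<open>Integer rather than natural frequencies, because the product formulas below produce
  differences of frequencies.\<close>

lemma has_integral_cos_int:
  "((\<lambda>u. cos (2 * pi * of_int k * u)) has_integral (if k = 0 then 1 else 0)) {0..1::real}"
proof (cases "k = 0")
  case True
  then show ?thesis using has_integral_const_real[of "1::real" 0 1] by simp
next
  case False
  have "((\<lambda>u. cos (2 * pi * of_int k * u)) has_integral
      (sin (2 * pi * of_int k * 1) / (2 * pi * of_int k) - sin (2 * pi * of_int k * 0) / (2 * pi * of_int k))) {0..1::real}"
    using False
    by (intro fundamental_theorem_of_calculus)
       (auto intro!: derivative_eq_intros simp: has_real_derivative_iff_has_vector_derivative[symmetric])
  then show ?thesis using False sin_int_2pin[of k] by (simp add: mult_ac)
qed

lemma has_integral_sin_int:
  "((\<lambda>u. sin (2 * pi * of_int k * u)) has_integral 0) {0..1::real}"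
proof (cases "k = 0")
  case False
  have "((\<lambda>u. sin (2 * pi * of_int k * u)) has_integral
      (- cos (2 * pi * of_int k * 1) / (2 * pi * of_int k) - - cos (2 * pi * of_int k * 0) / (2 * pi * of_int k))) {0..1::real}"
    using False
    by (intro fundamental_theorem_of_calculus)
       (auto intro!: derivative_eq_intros simp: has_real_derivative_iff_has_vector_derivative[symmetric])
  then show ?thesis using False cos_int_2pin[of k] by (simp add: mult_ac)
qed simp

abbreviation cosn :: "nat \<Rightarrow> real \<Rightarrow> real" where "cosn n u \<equiv> cos (2 * pi * real n * u)"
abbreviation sinn :: "nat \<Rightarrow> real \<Rightarrow> real" where "sinn n u \<equiv> sin (2 * pi * real n * u)"

lemma has_integral_cosn:
  assumes "n \<ge> 1" shows "(cosn n has_integral 0) {0..1}"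
  using has_integral_cos_int[of "int n"] assms by simp

lemma has_integral_sinn: "(sinn n has_integral 0) {0..1}"
  using has_integral_sin_int[of "int n"] by simp

lemma has_integral_cosn_cosn:
  assumes "m \<ge> 1" "n \<ge> 1"
  shows "((\<lambda>u. cosn m u * cosn n u) has_integral (if m = n then 1/2 else 0)) {0..1}"
proof -
  have "((\<lambda>u. (1/2) * (cos (2 * pi * of_int (int m - int n) * u) + cos (2 * pi * of_int (int m + int n) * u)))
     has_integral (1/2) * ((if int m - int n = 0 then 1 else 0) + (if int m + int n = 0 then 1 else 0))) {0..1::real}"
    by (intro has_integral_mult_right has_integral_add has_integral_cos_int)
  then show ?thesis using assms by (auto simp: cos_times_cos algebra_simps add_divide_distrib)
qed

lemma has_integral_sinn_sinn:
  assumes "m \<ge> 1" "n \<ge> 1"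
  shows "((\<lambda>u. sinn m u * sinn n u) has_integral (if m = n then 1/2 else 0)) {0..1}"
proof -
  have "((\<lambda>u. (1/2) * (cos (2 * pi * of_int (int m - int n) * u) - cos (2 * pi * of_int (int m + int n) * u)))
     has_integral (1/2) * ((if int m - int n = 0 then 1 else 0) - (if int m + int n = 0 then 1 else 0))) {0..1::real}"
    by (intro has_integral_mult_right has_integral_diff has_integral_cos_int)
  then show ?thesis using assms by (auto simp: sin_times_sin algebra_simps diff_divide_distrib)
qed

lemma has_integral_sinn_cosn:
  shows "((\<lambda>u. sinn m u * cosn n u) has_integral 0) {0..1}"
proof -
  have "((\<lambda>u. (1/2) * (sin (2 * pi * of_int (int m + int n) * u) + sin (2 * pi * of_int (int m - int n) * u)))
     has_integral (1/2) * (0 + 0)) {0..1::real}"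
    by (intro has_integral_mult_right has_integral_add has_integral_sin_int)
  then show ?thesis unfolding sin_times_cos by (simp add: algebra_simps add_divide_distrib)
qed

lemma has_integral_ident_cosn:
  assumes "n \<ge> 1"
  shows "((\<lambda>u. u * cosn n u) has_integral 0) {0..1}"
proof -
  let ?F = "\<lambda>u. u * (sinn n u / (2 * pi * n)) + cosn n u / (2 * pi * n)^2"
  have "((\<lambda>u. u * cosn n u) has_integral (?F 1 - ?F 0)) {0..1}"
    using assms
    by (intro fundamental_theorem_of_calculus)
       (auto intro!: derivative_eq_intros simp: power2_eq_square field_simps has_real_derivative_iff_has_vector_derivative[symmetric])
  then show ?thesis using sin_int_2pin[of "int n"] cos_int_2pin[of "int n"] by (simp add: mult_ac)
qed

text \<open>The only nonzero pairing between a linear path and an oscillation. In the next lemma it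
  produces the term \<open>x * (\<Sum>k\<in>UNIV. \<rho>' k)\<close>, which later has to be
  cancelled.\<close>

lemma has_integral_ident_sinn:
  assumes "n \<ge> 1"
  shows "((\<lambda>u. u * sinn n u) has_integral (- 1 / (2 * pi * n))) {0..1}"
proof -
  let ?F = "\<lambda>u. - u * (cosn n u / (2 * pi * n)) + sinn n u / (2 * pi * n)^2"
  have "((\<lambda>u. u * sinn n u) has_integral (?F 1 - ?F 0)) {0..1}"
    using assms
    by (intro fundamental_theorem_of_calculus)
       (auto intro!: derivative_eq_intros simp: power2_eq_square field_simps has_real_derivative_iff_has_vector_derivative[symmetric])
  then show ?thesis using sin_int_2pin[of "int n"] cos_int_2pin[of "int n"] by (simp add: mult_ac)
qed

text \<open>A second-level entry for two coordinates that are linear plus trigonometric. The last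
  sum is geometric: at frequency \<open>\<kappa> k\<close> the two coordinates run
  \<open>\<kappa> k\<close> times around an ellipse of signed area
  \<open>pi * (\<rho> k * \<sigma>' k - \<sigma> k * \<rho>' k)\<close>. Distinct frequencies do not
  interact, by orthogonality.\<close>

lemma has_integral_trig_area:
  fixes \<kappa> :: "'k::finite \<Rightarrow> nat" and \<rho> \<sigma> \<rho>' \<sigma>' :: "'k \<Rightarrow> real"
  assumes \<kappa>: "inj \<kappa>" "\<And>k. \<kappa> k \<ge> 1"
  shows "((\<lambda>u. (x * u + (\<Sum>k\<in>UNIV. \<rho> k * cosn (\<kappa> k) u + \<sigma> k * sinn (\<kappa> k) u)) *
       (y + (\<Sum>k\<in>UNIV. 2 * pi * \<kappa> k * (\<sigma>' k * cosn (\<kappa> k) u - \<rho>' k * sinn (\<kappa> k) u))))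
     has_integral (x * y / 2 + x * (\<Sum>k\<in>UNIV. \<rho>' k) + pi * (\<Sum>k\<in>UNIV. \<kappa> k * (\<rho> k * \<sigma>' k - \<sigma> k * \<rho>' k)))) {0..1}"
    (is "(?f has_integral ?I) _")
proof -
  have u: "((\<lambda>u. u) has_integral 1/2) {0..1::real}"
    using ident_has_integral[of "0::real" 1] by simp
  have cs: "((\<lambda>u. cosn m u * sinn n u) has_integral 0) {0..1}" for m n
    using has_integral_sinn_cosn[of n m] by (simp add: mult.commute)
  \<comment> \<open>Vanishing terms are kept, so that the value has the very shape that the
    integration rules give for the expanded product.\<close>
  let ?J = "x * y * (1/2)
      + x * (\<Sum>k\<in>UNIV. 2 * pi * \<kappa> k * (\<sigma>' k * 0 - \<rho>' k * (- 1 / (2 * pi * \<kappa> k))))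
      + y * (\<Sum>k\<in>UNIV. \<rho> k * 0 + \<sigma> k * 0)
      + (\<Sum>j\<in>UNIV. \<Sum>k\<in>UNIV. 2 * pi * \<kappa> k *
           (\<rho> j * \<sigma>' k * (if \<kappa> j = \<kappa> k then 1/2 else 0) - \<rho> j * \<rho>' k * 0
            + \<sigma> j * \<sigma>' k * 0 - \<sigma> j * \<rho>' k * (if \<kappa> j = \<kappa> k then 1/2 else 0)))"
  have "((\<lambda>u. x * y * u
      + x * (\<Sum>k\<in>UNIV. 2 * pi * \<kappa> k * (\<sigma>' k * (u * cosn (\<kappa> k) u) - \<rho>' k * (u * sinn (\<kappa> k) u)))
      + y * (\<Sum>k\<in>UNIV. \<rho> k * cosn (\<kappa> k) u + \<sigma> k * sinn (\<kappa> k) u)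
      + (\<Sum>j\<in>UNIV. \<Sum>k\<in>UNIV. 2 * pi * \<kappa> k *
           (\<rho> j * \<sigma>' k * (cosn (\<kappa> j) u * cosn (\<kappa> k) u) - \<rho> j * \<rho>' k * (cosn (\<kappa> j) u * sinn (\<kappa> k) u)
            + \<sigma> j * \<sigma>' k * (sinn (\<kappa> j) u * cosn (\<kappa> k) u) - \<sigma> j * \<rho>' k * (sinn (\<kappa> j) u * sinn (\<kappa> k) u))))
     has_integral ?J) {0..1}"
    by (intro has_integral_add has_integral_mult_right has_integral_sum has_integral_diff u cs
        has_integral_cosn[OF \<kappa>(2)] has_integral_sinn has_integral_cosn_cosn[OF \<kappa>(2) \<kappa>(2)]
        has_integral_sinn_sinn[OF \<kappa>(2) \<kappa>(2)] has_integral_sinn_cosn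
        has_integral_ident_cosn[OF \<kappa>(2)] has_integral_ident_sinn[OF \<kappa>(2)] finite)
  moreover have "(\<lambda>u. x * y * u
      + x * (\<Sum>k\<in>UNIV. 2 * pi * \<kappa> k * (\<sigma>' k * (u * cosn (\<kappa> k) u) - \<rho>' k * (u * sinn (\<kappa> k) u)))
      + y * (\<Sum>k\<in>UNIV. \<rho> k * cosn (\<kappa> k) u + \<sigma> k * sinn (\<kappa> k) u)
      + (\<Sum>j\<in>UNIV. \<Sum>k\<in>UNIV. 2 * pi * \<kappa> k *
           (\<rho> j * \<sigma>' k * (cosn (\<kappa> j) u * cosn (\<kappa> k) u) - \<rho> j * \<rho>' k * (cosn (\<kappa> j) u * sinn (\<kappa> k) u)
            + \<sigma> j * \<sigma>' k * (sinn (\<kappa> j) u * cosn (\<kappa> k) u) - \<sigma> j * \<rho>' k * (sinn (\<kappa> j) u * sinn (\<kappa> k) u)))) = ?f"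
  proof
    fix u
    define A where "A k = \<rho> k * cosn (\<kappa> k) u + \<sigma> k * sinn (\<kappa> k) u" for k
    define D where "D k = 2 * pi * \<kappa> k * (\<sigma>' k * cosn (\<kappa> k) u - \<rho>' k * sinn (\<kappa> k) u)" for k
    have 1: "(\<Sum>k\<in>UNIV. 2 * pi * \<kappa> k * (\<sigma>' k * (u * cosn (\<kappa> k) u) - \<rho>' k * (u * sinn (\<kappa> k) u))) = u * sum D UNIV"
      by (simp add: D_def sum_distrib_left algebra_simps)
    have 2: "(\<Sum>j\<in>UNIV. \<Sum>k\<in>UNIV. 2 * pi * \<kappa> k *
           (\<rho> j * \<sigma>' k * (cosn (\<kappa> j) u * cosn (\<kappa> k) u) - \<rho> j * \<rho>' k * (cosn (\<kappa> j) u * sinn (\<kappa> k) u)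
            + \<sigma> j * \<sigma>' k * (sinn (\<kappa> j) u * cosn (\<kappa> k) u) - \<sigma> j * \<rho>' k * (sinn (\<kappa> j) u * sinn (\<kappa> k) u)))
       = sum A UNIV * sum D UNIV"
      unfolding sum_product by (intro sum.cong refl) (simp add: A_def D_def algebra_simps)
    show "x * y * u
      + x * (\<Sum>k\<in>UNIV. 2 * pi * \<kappa> k * (\<sigma>' k * (u * cosn (\<kappa> k) u) - \<rho>' k * (u * sinn (\<kappa> k) u)))
      + y * (\<Sum>k\<in>UNIV. \<rho> k * cosn (\<kappa> k) u + \<sigma> k * sinn (\<kappa> k) u)
      + (\<Sum>j\<in>UNIV. \<Sum>k\<in>UNIV. 2 * pi * \<kappa> k *
           (\<rho> j * \<sigma>' k * (cosn (\<kappa> j) u * cosn (\<kappa> k) u) - \<rho> j * \<rho>' k * (cosn (\<kappa> j) u * sinn (\<kappa> k) u)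
            + \<sigma> j * \<sigma>' k * (sinn (\<kappa> j) u * cosn (\<kappa> k) u) - \<sigma> j * \<rho>' k * (sinn (\<kappa> j) u * sinn (\<kappa> k) u)))
      = ?f u"
      unfolding 1 2 A_def[symmetric] D_def[symmetric] by (simp add: algebra_simps)
  qed
  moreover have "?J = ?I"
  proof -
    have 1: "2 * pi * \<kappa> k * (\<sigma>' k * 0 - \<rho>' k * (- 1 / (2 * pi * \<kappa> k))) = \<rho>' k" for k
      using \<kappa>(2)[of k] by (simp add: field_simps)
    have 2: "(\<Sum>k\<in>UNIV. 2 * pi * \<kappa> k *
           (\<rho> j * \<sigma>' k * (if \<kappa> j = \<kappa> k then 1/2 else 0) - \<rho> j * \<rho>' k * 0
            + \<sigma> j * \<sigma>' k * 0 - \<sigma> j * \<rho>' k * (if \<kappa> j = \<kappa> k then 1/2 else 0)))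
       = pi * (\<kappa> j * (\<rho> j * \<sigma>' j - \<sigma> j * \<rho>' j))" for j
    proof -
      have "(\<Sum>k\<in>UNIV. 2 * pi * \<kappa> k *
           (\<rho> j * \<sigma>' k * (if \<kappa> j = \<kappa> k then 1/2 else 0) - \<rho> j * \<rho>' k * 0
            + \<sigma> j * \<sigma>' k * 0 - \<sigma> j * \<rho>' k * (if \<kappa> j = \<kappa> k then 1/2 else 0)))
        = (\<Sum>k\<in>UNIV. if j = k then pi * (\<kappa> j * (\<rho> j * \<sigma>' j - \<sigma> j * \<rho>' j)) else 0)"
        using injD[OF \<kappa>(1)] by (intro sum.cong refl) (auto simp: algebra_simps)
      then show ?thesis by simp
    qed
    show ?thesis unfolding 1 2 by (simp add: sum_distrib_left)
  qed
  ultimately show ?thesis by (simp only:)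
qed

text \<open>Every entry of the area gets its own frequency; orthogonality keeps them independent. The
  index \<open>None\<close> carries a further cosine that makes the coefficients of the cosines sum to \<open>0\<close>, so that
  the loops do not interact with the linear part \<open>u \<mapsto> x u\<close>.\<close>
lemma cc_norm_bound:
  obtains C where "C \<ge> 0" and
    "\<And>(x :: real ^ 'd::finite) B. (\<And>i j. B $ j $ i = - B $ i $ j) \<Longrightarrow>
       (1, x, \<chi> i j. x $ i * x $ j / 2 + B $ i $ j) \<in> G2 \<and>
       cc_norm (1, x, \<chi> i j. x $ i * x $ j / 2 + B $ i $ j) \<le> C * (norm x + (\<Sum>i\<in>UNIV. \<Sum>j\<in>UNIV. sqrt \<bar>B $ i $ j\<bar>))"
proof -
  obtain \<kappa>0 :: "('d \<times> 'd) option \<Rightarrow> nat" where \<kappa>0: "inj \<kappa>0"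
    using finite_imp_inj_to_nat_seg[of "UNIV :: ('d \<times> 'd) option set"] by auto
  define \<kappa> where "\<kappa> k = Suc (\<kappa>0 k)" for k
  have \<kappa>: "inj \<kappa>" "\<And>k. \<kappa> k \<ge> 1" using \<kappa>0 by (auto simp: \<kappa>_def inj_def)
  \<comment> \<open>The factor \<open>4 * pi * \<kappa> k\<close> bounds the speed of a loop with
    both amplitudes at most \<open>Q\<close>, and \<open>CARD('d)\<close> comes from bounding the
    norm by the sum of the coordinates.\<close>
  define C where "C = real CARD('d) * (1 + (\<Sum>k\<in>UNIV. 4 * pi * \<kappa> k))"
  have C1: "1 + (\<Sum>k\<in>UNIV. 4 * pi * \<kappa> k) \<ge> 1" by (simp add: sum_nonneg)
  have C: "C \<ge> 0" using C1 by (simp add: C_def)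
  have "(1, x, \<chi> i j. x $ i * x $ j / 2 + B $ i $ j) \<in> G2 \<and>
       cc_norm (1, x, \<chi> i j. x $ i * x $ j / 2 + B $ i $ j) \<le> C * (norm x + (\<Sum>i\<in>UNIV. \<Sum>j\<in>UNIV. sqrt \<bar>B $ i $ j\<bar>))"
    if B: "\<And>i j. B $ j $ i = - B $ i $ j" for x :: "real ^ 'd" and B
  proof -
    define Q where "Q = (\<Sum>i\<in>UNIV. \<Sum>j\<in>UNIV. sqrt \<bar>B $ i $ j\<bar>)"
    \<comment> \<open>Amplitudes \<open>r\<close> in coordinate i and \<open>s\<close> in coordinate
      j give the loop the area \<open>pi * \<kappa> * r * s\<close>, chosen to be half of the entry
      of \<open>B\<close>. The loops for (i, j) and (j, i) add up to the whole entry by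
      antisymmetry. The square root gives the homogeneity of the final bound.\<close>
    define r where "r = (\<lambda>(i, j). sqrt (\<bar>B $ i $ j\<bar> / (2 * pi * \<kappa> (Some (i, j)))))"
    define s where "s = (\<lambda>(i, j). sgn (B $ i $ j) * r (i, j))"
    define \<rho> where "\<rho> m k = (case k of None \<Rightarrow> - (\<Sum>q\<in>UNIV. if fst q = m then r q else 0)
        | Some q \<Rightarrow> if fst q = m then r q else 0)" for m k
    define \<sigma> where "\<sigma> m k = (case k of None \<Rightarrow> 0 | Some q \<Rightarrow> if snd q = m then s q else 0)" for m k
    have \<rho>0: "(\<Sum>k\<in>UNIV. \<rho> m k) = 0" for m
      by (simp add: UNIV_option_conv \<rho>_def sum.reindex)
    have r0: "r q \<ge> 0" for q by (cases q) (simp add: r_def)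
    have rs: "\<kappa> (Some (i, j)) * (r (i, j) * s (i, j)) = B $ i $ j / (2 * pi)" for i j
    proof -
      have "r (i, j) * r (i, j) = \<bar>B $ i $ j\<bar> / (2 * pi * \<kappa> (Some (i, j)))"
        unfolding r_def by simp
      then have "\<kappa> (Some (i, j)) * (r (i, j) * s (i, j)) = (sgn (B $ i $ j) * \<bar>B $ i $ j\<bar>) / (2 * pi)"
        using \<kappa>(2)[of "Some (i, j)"] by (simp add: s_def field_simps)
      then show ?thesis by (simp add: sgn_mult_abs)
    qed
    define Z where "Z u = (\<chi> m. x $ m * u + (\<Sum>k\<in>UNIV. \<rho> m k * cosn (\<kappa> k) u + \<sigma> m k * sinn (\<kappa> k) u))" for u
    define Z' where "Z' u = (\<chi> m. x $ m + (\<Sum>k\<in>UNIV. 2 * pi * \<kappa> k * (\<sigma> m k * cosn (\<kappa> k) u - \<rho> m k * sinn (\<kappa> k) u)))" for u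
    have der: "((\<lambda>u. Z u $ m) has_real_derivative Z' u $ m) (at u within A)" for m u A
      unfolding Z_def Z'_def vec_lambda_beta
      by (auto intro!: derivative_eq_intros sum.cong simp: algebra_simps)
    \<comment> \<open>The cancellation among the cosine coefficients also makes the path start at
      0.\<close>
    have Z0: "Z 0 = 0" by (simp add: Z_def vec_eq_iff \<rho>0)
    have Z1: "Z 1 = x"
      using \<rho>0 sin_int_2pin[of "int _"] cos_int_2pin[of "int _"] by (simp add: Z_def vec_eq_iff mult_ac)
    have area: "integral {0..1} (\<lambda>u. (Z u $ i - Z 0 $ i) * Z' u $ j) = x $ i * x $ j / 2 + B $ i $ j" for i j
    proof -
      have *: "(\<Sum>k\<in>UNIV. \<kappa> k * (\<rho> i k * \<sigma> j k)) = B $ i $ j / (2 * pi)" for i j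
      proof -
        have "(\<Sum>k\<in>UNIV. \<kappa> k * (\<rho> i k * \<sigma> j k)) = (\<Sum>q\<in>UNIV. \<kappa> (Some q) * (\<rho> i (Some q) * \<sigma> j (Some q)))"
          by (simp add: UNIV_option_conv \<sigma>_def sum.reindex)
        also have "\<dots> = (\<Sum>q\<in>UNIV. if q = (i, j) then B $ i $ j / (2 * pi) else 0)"
        proof (intro sum.cong refl)
          fix q show "\<kappa> (Some q) * (\<rho> i (Some q) * \<sigma> j (Some q)) = (if q = (i, j) then B $ i $ j / (2 * pi) else 0)"
            using rs[of i j] by (cases q) (auto simp: \<rho>_def \<sigma>_def)
        qed
        finally have "(\<Sum>k\<in>UNIV. \<kappa> k * (\<rho> i k * \<sigma> j k)) = (\<Sum>q\<in>UNIV. if q = (i, j) then B $ i $ j / (2 * pi) else 0)" .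
        then show ?thesis by simp
      qed
      have "((\<lambda>u. Z u $ i * Z' u $ j) has_integral (x $ i * x $ j / 2 + x $ i * (\<Sum>k\<in>UNIV. \<rho> j k) +
          pi * (\<Sum>k\<in>UNIV. \<kappa> k * (\<rho> i k * \<sigma> j k - \<sigma> i k * \<rho> j k)))) {0..1}"
        unfolding Z_def Z'_def vec_lambda_beta by (rule has_integral_trig_area[OF \<kappa>])
      moreover have "pi * (\<Sum>k\<in>UNIV. \<kappa> k * (\<rho> i k * \<sigma> j k - \<sigma> i k * \<rho> j k)) = B $ i $ j"
      proof -
        have "(\<Sum>k\<in>UNIV. \<kappa> k * (\<rho> i k * \<sigma> j k - \<sigma> i k * \<rho> j k)) = B $ i $ j / (2 * pi) - B $ j $ i / (2 * pi)"
          unfolding *[symmetric] by (simp add: sum_subtractf algebra_simps)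
        then show ?thesis using B[of i j] by (simp add: field_simps)
      qed
      ultimately have "((\<lambda>u. Z u $ i * Z' u $ j) has_integral (x $ i * x $ j / 2 + B $ i $ j)) {0..1}"
        by (simp add: \<rho>0)
      then show ?thesis by (simp add: Z0 integral_unique)
    qed
    have S2: "S2 Z = (1, x, \<chi> i j. x $ i * x $ j / 2 + B $ i $ j)"
    proof -
      have "S2 Z = (1, Z 1 - Z 0, \<chi> i j. integral {0..1} (\<lambda>u. (Z u $ i - Z 0 $ i) * Z' u $ j))"
        using der by (intro S2_C1)
          (auto simp: Z'_def has_real_derivative_iff_has_vector_derivative[symmetric] intro!: continuous_intros)
      then show ?thesis unfolding area by (simp add: Z0 Z1)
    qed
    have rQ: "r q \<le> Q" for q
    proof (cases q)
      case (Pair i j)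
      have "2 * pi * \<kappa> (Some (i, j)) \<ge> 1 * 1"
        using \<kappa>(2)[of "Some (i, j)"] pi_ge_two by (intro mult_mono) auto
      then have "\<bar>B $ i $ j\<bar> / (2 * pi * \<kappa> (Some (i, j))) \<le> \<bar>B $ i $ j\<bar>"
        using divide_left_mono[of 1 "2 * pi * \<kappa> (Some (i, j))" "\<bar>B $ i $ j\<bar>"] by simp
      then have "r q \<le> sqrt \<bar>B $ i $ j\<bar>" by (simp add: r_def Pair)
      also have "\<dots> \<le> (\<Sum>j\<in>UNIV. sqrt \<bar>B $ i $ j\<bar>)" by (intro member_le_sum) auto
      also have "\<dots> \<le> Q" unfolding Q_def
        by (intro member_le_sum[of i UNIV "\<lambda>i. \<Sum>j\<in>UNIV. sqrt \<bar>B $ i $ j\<bar>"]) (auto intro!: sum_nonneg)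
      finally show ?thesis .
    qed
    have Q0: "Q \<ge> 0" by (simp add: Q_def sum_nonneg)
    have \<sigma>Q: "\<bar>\<sigma> m k\<bar> \<le> Q" for m k
    proof -
      have "\<bar>s q\<bar> \<le> Q" for q
        using rQ[of q] r0[of q] Q0 by (cases q) (auto simp: s_def abs_mult abs_sgn_eq)
      then show ?thesis using Q0 by (auto simp: \<sigma>_def split: option.split)
    qed
    \<comment> \<open>The coefficient at \<open>None\<close> is a sum of amplitudes, so a bound on
      each single one is not enough.\<close>
    have rsum: "(\<Sum>q\<in>UNIV. r q) \<le> Q"
    proof -
      have "r (i, j) \<le> sqrt \<bar>B $ i $ j\<bar>" for i j
      proof -
        have "2 * pi * \<kappa> (Some (i, j)) \<ge> 1 * 1"
          using \<kappa>(2)[of "Some (i, j)"] pi_ge_two by (intro mult_mono) auto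
        then have "\<bar>B $ i $ j\<bar> / (2 * pi * \<kappa> (Some (i, j))) \<le> \<bar>B $ i $ j\<bar>"
          using divide_left_mono[of 1 "2 * pi * \<kappa> (Some (i, j))" "\<bar>B $ i $ j\<bar>"] by simp
        then show ?thesis by (simp add: r_def)
      qed
      then have "(\<Sum>q\<in>UNIV. r q) \<le> (\<Sum>q\<in>UNIV. sqrt \<bar>B $ fst q $ snd q\<bar>)"
        by (intro sum_mono) (metis prod.collapse)
      also have "\<dots> = Q"
        unfolding Q_def UNIV_Times_UNIV[symmetric] sum.cartesian_product by (simp add: case_prod_unfold)
      finally show ?thesis .
    qed
    have \<rho>Q: "\<bar>\<rho> m k\<bar> \<le> Q" for m k
    proof (cases k)
      case None
      have "0 \<le> (\<Sum>q\<in>UNIV. if fst q = m then r q else 0)" using r0 by (auto intro!: sum_nonneg)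
      moreover have "(\<Sum>q\<in>UNIV. if fst q = m then r q else 0) \<le> (\<Sum>q\<in>UNIV. r q)"
        using r0 by (intro sum_mono) auto
      ultimately show ?thesis using rsum by (simp add: \<rho>_def None)
    next
      case (Some q)
      then show ?thesis using rQ[of q] r0[of q] Q0 by (simp add: \<rho>_def)
    qed
    have Z'b: "\<bar>Z' u $ m\<bar> \<le> norm x + (\<Sum>k\<in>UNIV. 4 * pi * \<kappa> k) * Q" for u m
    proof -
      have "\<bar>2 * pi * \<kappa> k * (\<sigma> m k * cosn (\<kappa> k) u - \<rho> m k * sinn (\<kappa> k) u)\<bar> \<le> 4 * pi * \<kappa> k * Q" for k
      proof -
        have "\<bar>\<sigma> m k * cosn (\<kappa> k) u\<bar> \<le> Q * 1" "\<bar>\<rho> m k * sinn (\<kappa> k) u\<bar> \<le> Q * 1"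
          unfolding abs_mult by (intro mult_mono \<sigma>Q \<rho>Q Q0; simp)+
        then have "\<bar>\<sigma> m k * cosn (\<kappa> k) u - \<rho> m k * sinn (\<kappa> k) u\<bar> \<le> 2 * Q" by linarith
        then have "2 * pi * \<kappa> k * \<bar>\<sigma> m k * cosn (\<kappa> k) u - \<rho> m k * sinn (\<kappa> k) u\<bar> \<le> 2 * pi * \<kappa> k * (2 * Q)"
          by (intro mult_left_mono) auto
        then show ?thesis
          using abs_mult[of "2 * pi * \<kappa> k" "\<sigma> m k * cosn (\<kappa> k) u - \<rho> m k * sinn (\<kappa> k) u"] by simp
      qed
      then have "\<bar>\<Sum>k\<in>UNIV. 2 * pi * \<kappa> k * (\<sigma> m k * cosn (\<kappa> k) u - \<rho> m k * sinn (\<kappa> k) u)\<bar> \<le> (\<Sum>k\<in>UNIV. 4 * pi * \<kappa> k * Q)"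
        by (intro order_trans[OF sum_abs] sum_mono) auto
      moreover have "\<bar>x $ m\<bar> \<le> norm x" by (rule component_le_norm_cart)
      ultimately show ?thesis by (simp add: Z'_def sum_distrib_right)
    qed
    define L where "L = norm x + (\<Sum>k\<in>UNIV. 4 * pi * \<kappa> k) * Q"
    have lip: "norm (Z v - Z u) \<le> (CARD('d) * L) * (v - u)" if "u \<le> v" for u v
    proof -
      have "\<bar>(Z v - Z u) $ m\<bar> \<le> L * (v - u)" for m
      proof -
        have "norm (Z v $ m - Z u $ m) \<le> L * norm (v - u)"
          using Z'b[of _ m] der[of m]
          by (intro field_differentiable_bound[of UNIV "\<lambda>u. Z u $ m" "\<lambda>u. Z' u $ m"]) (auto simp: L_def)
        then show ?thesis using that by simp
      qed
      then have "(\<Sum>m\<in>UNIV. \<bar>(Z v - Z u) $ m\<bar>) \<le> (\<Sum>m\<in>(UNIV::'d set). L * (v - u))" by (intro sum_mono) auto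
      then show ?thesis using norm_le_l1_cart[of "Z v - Z u"] by simp
    qed
    have cont: "continuous_on {0..1} Z"
      unfolding Z_def by (intro continuous_intros)
    have "Z \<in> cfv_paths"
      using cont lipschitz_finite_variation(1)[of 0 1 Z "CARD('d) * L"] lip by (simp add: cfv_paths_def)
    then have "cc_norm (S2 Z) \<le> CARD('d) * L * (1 - 0)"
      using cc_norm_le[of Z] lipschitz_finite_variation(2)[of 0 1 Z "CARD('d) * L"] lip by fastforce
    also have "\<dots> \<le> C * (norm x + Q)"
    proof -
      have "L \<le> (1 + (\<Sum>k\<in>UNIV. 4 * pi * \<kappa> k)) * (norm x + Q)"
        using Q0 by (simp add: L_def algebra_simps sum_nonneg)
      then show ?thesis unfolding C_def by (simp add: mult.assoc mult_left_mono)
    qed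
    finally have "cc_norm (S2 Z) \<le> C * (norm x + Q)" .
    moreover have "S2 Z \<in> G2" using \<open>Z \<in> cfv_paths\<close> by (simp add: G2_def)
    ultimately show ?thesis unfolding S2 Q_def by simp
  qed
  with C show thesis using that by blast
qed


section \<open>Sewing\<close>

text \<open>The average of \<open>f\<close> over the image of \<open>{a..b}\<close> under the contraction by \<open>2^-n\<close> towards \<open>u\<close>.
  It never leaves \<open>{a..b}\<close>, and at \<open>n = 0\<close> it is constant in \<open>u\<close>.\<close>
definition scale_avg :: "real \<Rightarrow> real \<Rightarrow> (real \<Rightarrow> real) \<Rightarrow> nat \<Rightarrow> real \<Rightarrow> real" where
  "scale_avg a b f n u =
     integral {(1 - (1/2)^n) * u + (1/2)^n * a .. (1 - (1/2)^n) * u + (1/2)^n * b} f / ((1/2)^n * (b - a))"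

lemma scale_interval:
  fixes a b u v :: real
  assumes "u \<in> {a..b}" and e: "0 \<le> e" "e \<le> 1"
    and "v \<in> {(1 - e) * u + e * a .. (1 - e) * u + e * b}"
  shows "v \<in> {a..b}" "\<bar>v - u\<bar> \<le> e * (b - a)"
proof -
  have "(1 - e) * a + e * a \<le> (1 - e) * u + e * a" "(1 - e) * u + e * b \<le> (1 - e) * b + e * b"
    using assms by (auto intro!: mult_left_mono)
  then show "v \<in> {a..b}" using assms by (simp add: algebra_simps)
  have "e * a \<le> e * u" "e * u \<le> e * b" using assms by (auto intro!: mult_left_mono)
  then show "\<bar>v - u\<bar> \<le> e * (b - a)" using assms unfolding abs_le_iff by (simp add: algebra_simps)
qed

text \<open>An average deviates from \<open>c\<close> no more than the values averaged. The
  reference value is free: 0 gives uniform bounds, the value at \<open>u\<close> gives convergence,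
  and the value at a distant base point \<open>s\<close> gives the sewing estimate.\<close>

lemma scale_avg_bound:
  fixes f :: "real \<Rightarrow> real"
  assumes ab: "a < b" and f: "continuous_on {a..b} f" and u: "u \<in> {a..b}"
    and M: "\<And>v. v \<in> {a..b} \<Longrightarrow> \<bar>v - u\<bar> \<le> (1/2)^n * (b - a) \<Longrightarrow> \<bar>f v - c\<bar> \<le> M"
  shows "\<bar>scale_avg a b f n u - c\<bar> \<le> M"
proof -
  define e :: real where "e = (1/2)^n"
  have e: "0 < e" "e \<le> 1" by (auto simp: e_def power_le_one)
  define p q where "p = (1 - e) * u + e * a" and "q = (1 - e) * u + e * b"
  have pq: "q - p = e * (b - a)" by (simp add: p_def q_def algebra_simps)
  have len: "e * (b - a) > 0" using e ab by simp
  have sub: "v \<in> {a..b}" "\<bar>v - u\<bar> \<le> e * (b - a)" if "v \<in> {p..q}" for v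
    using scale_interval[OF u _ e(2), of v] that e by (auto simp: p_def q_def)
  have "continuous_on {p..q} f" using f sub by (metis continuous_on_subset subsetI)
  then have "(f has_integral integral {p..q} f) {p..q}"
    by (intro integrable_integral integrable_continuous_interval)
  moreover have "((\<lambda>_. c) has_integral c * (q - p)) {p..q}"
    using has_integral_const_real[of c p q] pq len by (simp add: mult.commute)
  ultimately have I: "((\<lambda>v. f v - c) has_integral (integral {p..q} f - c * (q - p))) {p..q}"
    by (rule has_integral_diff)
  have "\<bar>f u - c\<bar> \<le> M" using M[of u] u ab by simp
  then have M0: "M \<ge> 0" by linarith
  have "norm (integral {p..q} f - c * (q - p)) \<le> M * measure lborel {p..q}"
    by (rule has_integral_bound_real[OF M0 finite.emptyI I]) (use sub M in \<open>auto simp: e_def\<close>)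
  then have "\<bar>integral {p..q} f - c * (e * (b - a))\<bar> \<le> M * (e * (b - a))"
    using pq len by simp
  moreover have "scale_avg a b f n u - c = (integral {p..q} f - c * (e * (b - a))) / (e * (b - a))"
    using len e ab by (simp add: scale_avg_def e_def[symmetric] p_def q_def diff_divide_distrib)
  ultimately show ?thesis using len by (simp add: abs_divide pos_divide_le_eq)
qed

text \<open>The endpoints of the averaging interval move with speed \<open>1 - (1/2)^n\<close> in
  \<open>u\<close>, so differentiation leaves the difference of the two endpoint values. It vanishes
  for \<open>n = 0\<close>.\<close>

definition scale_avg_deriv :: "real \<Rightarrow> real \<Rightarrow> (real \<Rightarrow> real) \<Rightarrow> nat \<Rightarrow> real \<Rightarrow> real" where
  "scale_avg_deriv a b f n u =
     (1 - (1/2)^n) * (f ((1 - (1/2)^n) * u + (1/2)^n * b) - f ((1 - (1/2)^n) * u + (1/2)^n * a)) / ((1/2)^n * (b - a))"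

lemma scale_avg_has_derivative:
  fixes f :: "real \<Rightarrow> real"
  assumes ab: "a < b" and f: "continuous_on {a..b} f" and u: "u \<in> {a..b}"
  shows "(scale_avg a b f n has_real_derivative scale_avg_deriv a b f n u) (at u within {a..b})"
proof -
  define e :: real where "e = (1/2)^n"
  have e: "0 < e" "e \<le> 1" by (auto simp: e_def power_le_one)
  define F where "F x = integral {a..x} f" for x
  have F: "(F has_real_derivative f x) (at x within {a..b})" if "x \<in> {a..b}" for x
    unfolding F_def using integral_has_real_derivative[OF f that] .
  have mem: "(1 - e) * v + e * w \<in> {a..b}" if "v \<in> {a..b}" "w \<in> {a..b}" for v w
  proof -
    have "e * a \<le> e * w" "e * w \<le> e * b" using that e by (auto intro!: mult_left_mono)
    then show ?thesis using that e scale_interval(1)[of v a b e "(1 - e) * v + e * w"] by simp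
  qed
  have chain: "((\<lambda>v. F ((1 - e) * v + e * w)) has_real_derivative f ((1 - e) * u + e * w) * (1 - e)) (at u within {a..b})"
    if w: "w \<in> {a..b}" for w
  proof -
    have "(F \<circ> (\<lambda>v. (1 - e) * v + e * w) has_real_derivative f ((1 - e) * u + e * w) * (1 - e)) (at u within {a..b})"
    proof (rule DERIV_image_chain)
      show "(F has_real_derivative f ((1 - e) * u + e * w)) (at ((1 - e) * u + e * w) within (\<lambda>v. (1 - e) * v + e * w) ` {a..b})"
        by (rule has_field_derivative_subset[OF F[OF mem[OF u w]]]) (use mem w in auto)
    qed (auto intro!: derivative_eq_intros)
    then show ?thesis by (simp add: o_def)
  qed
  have D: "((\<lambda>v. (F ((1 - e) * v + e * b) - F ((1 - e) * v + e * a)) / (e * (b - a)))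
     has_real_derivative scale_avg_deriv a b f n u) (at u within {a..b})"
    using DERIV_cdivide[OF DERIV_diff[OF chain[of b] chain[of a]], of "e * (b - a)"] ab
    by (simp add: scale_avg_deriv_def e_def[symmetric] right_diff_distrib mult.commute)
  have "(F ((1 - e) * v + e * b) - F ((1 - e) * v + e * a)) / (e * (b - a)) = scale_avg a b f n v"
    if v: "v \<in> {a..b}" for v
  proof -
    have 1: "(1 - e) * v + e * b \<in> {a..b}" "(1 - e) * v + e * a \<in> {a..b}" using mem v ab by auto
    have le: "(1 - e) * v + e * a \<le> (1 - e) * v + e * b" using e ab by simp
    have "f integrable_on {a..(1 - e) * v + e * b}"
      using continuous_on_subset[OF f] 1 by (intro integrable_continuous_interval) auto
    then have "F ((1 - e) * v + e * a) + integral {(1 - e) * v + e * a..(1 - e) * v + e * b} f = F ((1 - e) * v + e * b)"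
      unfolding F_def using 1 le by (intro Henstock_Kurzweil_Integration.integral_combine) auto
    then show ?thesis by (simp add: scale_avg_def e_def[symmetric] algebra_simps)
  qed
  then show ?thesis by (intro has_field_derivative_transform_within[OF D zero_less_one u]) auto
qed

text \<open>The difference of endpoint values does not change when \<open>c\<close> is subtracted
  from \<open>f\<close>; dividing by the length of the interval costs one power of the
  scale.\<close>

lemma scale_avg_deriv_bound:
  fixes f :: "real \<Rightarrow> real"
  assumes ab: "a < b" and u: "u \<in> {a..b}"
    and M: "\<And>v. v \<in> {a..b} \<Longrightarrow> \<bar>v - u\<bar> \<le> (1/2)^n * (b - a) \<Longrightarrow> \<bar>f v - c\<bar> \<le> M"
  shows "\<bar>scale_avg_deriv a b f n u\<bar> \<le> 2 * M / ((1/2)^n * (b - a))"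
proof -
  define e :: real where "e = (1/2)^n"
  have e: "0 < e" "e \<le> 1" by (auto simp: e_def power_le_one)
  define p q where "p = (1 - e) * u + e * a" and "q = (1 - e) * u + e * b"
  have "p \<le> q" using e ab by (simp add: p_def q_def)
  then have "v \<in> {a..b}" "\<bar>v - u\<bar> \<le> e * (b - a)" if "v \<in> {p, q}" for v
    using scale_interval[OF u _ e(2), of v] that e by (auto simp: p_def q_def)
  then have "\<bar>f p - c\<bar> \<le> M" "\<bar>f q - c\<bar> \<le> M" using M by (auto simp: e_def)
  then have *: "\<bar>f q - f p\<bar> \<le> 2 * M" by linarith
  have "(1 - e) * \<bar>f q - f p\<bar> \<le> 1 * (2 * M)" using e * by (intro mult_mono) auto
  then have "\<bar>(1 - e) * (f q - f p)\<bar> \<le> 2 * M" using e by (simp add: abs_mult)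
  then show ?thesis
    using e ab by (simp add: scale_avg_deriv_def e_def[symmetric] p_def q_def abs_divide divide_right_mono abs_mult)
qed

lemma scale_avg_deriv_0 [simp]: "scale_avg_deriv a b f 0 u = 0"
  by (simp add: scale_avg_deriv_def)

lemma halving_index:
  fixes \<tau> T :: real
  assumes "0 < \<tau>" "\<tau> \<le> T"
  obtains N where "(1/2)^Suc N * T \<le> \<tau>" "\<tau> \<le> (1/2)^N * T"
proof -
  obtain n where n: "(1/2)^n < \<tau> / T" using real_arch_pow_inv[of "\<tau> / T" "1/2"] assms by auto
  have "(1/2::real)^Suc n \<le> (1/2)^n" by (intro power_decreasing) auto
  then have ex: "(1/2)^Suc n * T \<le> \<tau>" using n assms by (simp add: field_simps)
  define N where "N = (LEAST n. (1/2)^Suc n * T \<le> \<tau>)"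
  have N: "(1/2)^Suc N * T \<le> \<tau>" unfolding N_def using ex by (rule LeastI)
  have "\<tau> \<le> (1/2)^N * T"
  proof (cases N)
    case 0 then show ?thesis using assms by simp
  next
    case (Suc m)
    then have "\<not> (1/2)^Suc m * T \<le> \<tau>" unfolding N_def using not_less_Least by (metis lessI)
    then show ?thesis using Suc by simp
  qed
  with N that show thesis by blast
qed

lemma powr_half_power: "(T::real) \<ge> 0 \<Longrightarrow> ((1/2)^n * T) powr r = T powr r * ((1/2) powr r) ^ n"
  by (simp add: powr_mult powr_powr powr_realpow[symmetric] mult.commute)

lemma scale_avg_holder:
  fixes g :: "real \<Rightarrow> real"
  assumes T: "T > 0" and g: "continuous_on {0..T} g" and \<gamma>: "\<gamma> > 0"
    and holder: "\<And>x y. x \<in> {0..T} \<Longrightarrow> y \<in> {0..T} \<Longrightarrow> \<bar>g x - g y\<bar> \<le> L * \<bar>x - y\<bar> powr \<gamma>" and L: "L \<ge> 0"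
    and u: "u \<in> {0..T}"
  shows "\<bar>scale_avg 0 T g n u - g u\<bar> \<le> L * T powr \<gamma> * ((1/2) powr \<gamma>) ^ n"
proof (rule scale_avg_bound[OF T g u])
  fix v assume v: "v \<in> {0..T}" "\<bar>v - u\<bar> \<le> (1/2)^n * (T - 0)"
  have "\<bar>g v - g u\<bar> \<le> L * \<bar>v - u\<bar> powr \<gamma>" using holder v u by blast
  also have "\<dots> \<le> L * ((1/2)^n * T) powr \<gamma>" using v L \<gamma> by (intro mult_left_mono powr_mono2) auto
  finally show "\<bar>g v - g u\<bar> \<le> L * T powr \<gamma> * ((1/2) powr \<gamma>) ^ n"
    using T by (simp add: powr_half_power mult.assoc)
qed

lemma scale_avg_continuous:
  fixes f :: "real \<Rightarrow> real"
  assumes "a < b" "continuous_on {a..b} f"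
  shows "continuous_on {a..b} (scale_avg a b f n)"
  using scale_avg_has_derivative[OF assms] DERIV_continuous_on by blast

lemma half_powr_less_1: "r > 0 \<Longrightarrow> (1/2::real) powr r < 1"
  using powr_less_mono2[of r "1/2" 1] by simp

text \<open>The hypothesis on \<open>f\<close> and \<open>g\<close> is a Hoelder condition of exponent \<open>a + b\<close> as seen from \<open>s\<close> at
  scales above \<open>|t - s|\<close>, and of the weaker exponent \<open>a\<close> at small scales; neither \<open>h\<close> nor \<open>C\<close>
  depends on \<open>s\<close>, \<open>t\<close> or \<open>k\<close>.\<close>
lemma sewing:
  fixes f g :: "real \<Rightarrow> real"
  assumes T: "T > 0" and f: "continuous_on {0..T} f" and g: "continuous_on {0..T} g"
    and \<gamma>: "\<gamma> > 0" and L: "L \<ge> 0"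
    and holder: "\<And>x y. x \<in> {0..T} \<Longrightarrow> y \<in> {0..T} \<Longrightarrow> \<bar>g x - g y\<bar> \<le> L * \<bar>x - y\<bar> powr \<gamma>"
    and a: "a > 0" and b: "b \<ge> 0" and ab: "2 * (a + b) < 1"
  obtains h C where "continuous_on {0..T} h" "C \<ge> 0"
    "\<And>s t k. s \<in> {0..T} \<Longrightarrow> t \<in> {0..T} \<Longrightarrow> s \<noteq> t \<Longrightarrow> k \<ge> 0 \<Longrightarrow>
       (\<And>x y. x \<in> {0..T} \<Longrightarrow> y \<in> {0..T} \<Longrightarrow>
          \<bar>f x - f y\<bar> \<le> k * \<bar>x - y\<bar> powr a * max (max \<bar>x - s\<bar> \<bar>y - s\<bar>) \<bar>t - s\<bar> powr b) \<Longrightarrow>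
       (\<And>x y. x \<in> {0..T} \<Longrightarrow> y \<in> {0..T} \<Longrightarrow>
          \<bar>g x - g y\<bar> \<le> k * \<bar>x - y\<bar> powr a * max (max \<bar>x - s\<bar> \<bar>y - s\<bar>) \<bar>t - s\<bar> powr b) \<Longrightarrow>
       \<bar>h t - h s - f s * (g t - g s)\<bar> \<le> C * k\<^sup>2 * \<bar>t - s\<bar> powr (2 * (a + b))"
proof -
  define F where "F = scale_avg 0 T f"
  define G where "G = scale_avg 0 T g"
  define F' where "F' = scale_avg_deriv 0 T f"
  define G' where "G' = scale_avg_deriv 0 T g"
  define h where "h t = (\<Sum>n. F n t * (G (Suc n) t - G n t))" for t
  define c where "c = a + b"
  define \<delta> where "\<delta> = 1 - 2 * c"
  have \<delta>: "\<delta> > 0" and c: "c > 0" "2 * c < 1" using a b ab by (auto simp: \<delta>_def c_def)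
  \<comment> \<open>The first summand collects the coarse scales; the second is twice the bound for
    the fine scales, which occur once at \<open>t\<close> and once at \<open>s\<close>.\<close>
  define C where "C = 20 / (2 powr \<delta> - 1) + 12 / (1 - (1/2) powr a)"
  have r1: "2 powr \<delta> > 1" using \<delta> by simp
  have C: "C \<ge> 0" using r1 half_powr_less_1[OF a] by (auto simp: C_def intro!: add_nonneg_nonneg)
  note bound = scale_avg_bound[OF T f, folded F_def] scale_avg_bound[OF T g, folded G_def]

  \<comment> \<open>Qualitative part: \<open>B\<close>, \<open>L\<close> and \<open>\<gamma>\<close>
    only secure uniform convergence of the series, hence its continuity. They do not enter
    \<open>C\<close>.\<close>
  have "bounded (f ` {0..T})" using compact_continuous_image[OF f] compact_imp_bounded by blast
  then obtain B where B: "B > 0" "\<And>x. x \<in> {0..T} \<Longrightarrow> \<bar>f x\<bar> \<le> B"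
    using bounded_pos[of "f ` {0..T}"] by auto
  have FB: "\<bar>F n u\<bar> \<le> B" if "u \<in> {0..T}" for n u
    using bound(1)[OF that, of n 0 B] B by simp
  have Gg: "\<bar>G n u - g u\<bar> \<le> L * T powr \<gamma> * ((1/2) powr \<gamma>) ^ n" if "u \<in> {0..T}" for n u
    unfolding G_def by (rule scale_avg_holder[OF T g \<gamma> _ L that]) (rule holder)
  have G_lim: "(\<lambda>n. G n u) \<longlonglongrightarrow> g u" if u: "u \<in> {0..T}" for u
  proof -
    have "(\<lambda>n. L * T powr \<gamma> * ((1/2) powr \<gamma>) ^ n) \<longlonglongrightarrow> L * T powr \<gamma> * 0"
      by (intro tendsto_mult_left LIMSEQ_realpow_zero half_powr_less_1 \<gamma>) auto
    then have "(\<lambda>n. G n u - g u) \<longlonglongrightarrow> 0"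
      by (intro Lim_null_comparison[of "\<lambda>n. G n u - g u"])
         (auto intro!: always_eventually Gg u)
    then show ?thesis by (simp add: LIM_zero_iff)
  qed
  define M where "M n = B * (2 * (L * T powr \<gamma>)) * ((1/2) powr \<gamma>) ^ n" for n
  have M: "summable M" unfolding M_def
    using half_powr_less_1[OF \<gamma>] by (intro summable_mult summable_geometric) auto
  have dG: "\<bar>G (Suc n) u - G n u\<bar> \<le> 2 * (L * T powr \<gamma>) * ((1/2) powr \<gamma>) ^ n" if u: "u \<in> {0..T}" for n u
  proof -
    have "((1/2::real) powr \<gamma>) ^ Suc n \<le> ((1/2) powr \<gamma>) ^ n"
      using half_powr_less_1[OF \<gamma>] by (intro power_decreasing) auto
    then have "L * T powr \<gamma> * ((1/2) powr \<gamma>) ^ Suc n \<le> L * T powr \<gamma> * ((1/2) powr \<gamma>) ^ n"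
      using L by (intro mult_left_mono) auto
    then show ?thesis
      using Gg[OF u, of n] Gg[OF u, of "Suc n"] by linarith
  qed
  have term_le: "\<bar>F n u * (G (Suc n) u - G n u)\<bar> \<le> M n" if u: "u \<in> {0..T}" for n u
    unfolding abs_mult M_def mult.assoc
    using FB[OF u, of n] dG[OF u, of n] B by (intro mult_mono) (auto simp: mult.assoc)
  have summ: "summable (\<lambda>n. F n u * (G (Suc n) u - G n u))" if "u \<in> {0..T}" for u
    by (rule summable_comparison_test'[OF M, of 0]) (use term_le[OF that] in auto)
  have cont: "continuous_on {0..T} h"
  proof -
    have U: "uniform_limit {0..T} (\<lambda>n u. \<Sum>i<n. F i u * (G (Suc i) u - G i u)) h sequentially"
      unfolding h_def by (rule Weierstrass_m_test[OF _ M]) (use term_le in auto)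
    have E: "\<forall>\<^sub>F n in sequentially. continuous_on {0..T} (\<lambda>u. \<Sum>i<n. F i u * (G (Suc i) u - G i u))"
      unfolding F_def G_def
      by (intro always_eventually allI continuous_intros scale_avg_continuous T f g)
    show ?thesis by (rule uniform_limit_theorem[OF E U]) simp
  qed

  have main: "\<bar>h t - h s - f s * (g t - g s)\<bar> \<le> C * k\<^sup>2 * \<bar>t - s\<bar> powr (2 * (a + b))"
    if s: "s \<in> {0..T}" and t: "t \<in> {0..T}" and st: "s \<noteq> t" and k: "k \<ge> 0"
      and fk: "\<And>x y. x \<in> {0..T} \<Longrightarrow> y \<in> {0..T} \<Longrightarrow>
          \<bar>f x - f y\<bar> \<le> k * \<bar>x - y\<bar> powr a * max (max \<bar>x - s\<bar> \<bar>y - s\<bar>) \<bar>t - s\<bar> powr b"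
      and gk: "\<And>x y. x \<in> {0..T} \<Longrightarrow> y \<in> {0..T} \<Longrightarrow>
          \<bar>g x - g y\<bar> \<le> k * \<bar>x - y\<bar> powr a * max (max \<bar>x - s\<bar> \<bar>y - s\<bar>) \<bar>t - s\<bar> powr b" for s t k
  proof -
    define \<tau> where "\<tau> = \<bar>t - s\<bar>"
    have \<tau>: "0 < \<tau>" "\<tau> \<le> T" using s t st by (auto simp: \<tau>_def)
    define \<epsilon> where "\<epsilon> n = (1/2)^n * T" for n
    have \<epsilon>0: "\<epsilon> n > 0" for n using T by (simp add: \<epsilon>_def)
    have \<epsilon>Suc: "\<epsilon> (Suc n) = \<epsilon> n / 2" for n by (simp add: \<epsilon>_def)
    have \<epsilon>_mono: "\<epsilon> n \<le> \<epsilon> m" if "m \<le> n" for m n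
      unfolding \<epsilon>_def using T that by (intro mult_right_mono power_decreasing) auto
    obtain N where N: "\<epsilon> N \<le> 2 * \<tau>" "\<tau> \<le> \<epsilon> N"
      using halving_index[OF \<tau>] unfolding \<epsilon>_def by (metis \<epsilon>Suc \<epsilon>_def mult.commute pos_divide_le_eq zero_less_numeral)
    \<comment> \<open>Relative to the base point, the distance and the maximum are both at most
      \<open>\<tau> + \<epsilon> n\<close>, so the exponents \<open>a\<close> and \<open>b\<close>
      merge into \<open>c\<close>. In \<open>near'\<close> the distance is only
      \<open>\<epsilon> n\<close>, and the exponents stay separate.\<close>
    have near: "\<bar>\<phi> v - \<phi> s\<bar> \<le> k * (\<tau> + \<epsilon> n) powr c"
      if \<phi>: "\<And>x y. x \<in> {0..T} \<Longrightarrow> y \<in> {0..T} \<Longrightarrow>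
          \<bar>\<phi> x - \<phi> y\<bar> \<le> k * \<bar>x - y\<bar> powr a * max (max \<bar>x - s\<bar> \<bar>y - s\<bar>) \<tau> powr b"
        and u: "\<bar>u - s\<bar> \<le> \<tau>" and v: "v \<in> {0..T}" "\<bar>v - u\<bar> \<le> \<epsilon> n" for \<phi> :: "real \<Rightarrow> real" and u v n
    proof -
      have vs: "\<bar>v - s\<bar> \<le> \<tau> + \<epsilon> n" using u v by linarith
      have "\<bar>\<phi> v - \<phi> s\<bar> \<le> k * \<bar>v - s\<bar> powr a * max (max \<bar>v - s\<bar> \<bar>s - s\<bar>) \<tau> powr b"
        by (rule \<phi>[OF v(1) s])
      also have "\<dots> \<le> k * (\<tau> + \<epsilon> n) powr a * (\<tau> + \<epsilon> n) powr b"
        using vs k a b \<tau> \<epsilon>0[of n] by (intro mult_mono powr_mono2) auto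
      finally show ?thesis by (simp add: c_def powr_add mult.assoc)
    qed
    have near': "\<bar>\<phi> v - \<phi> u\<bar> \<le> k * \<epsilon> n powr a * (\<tau> + \<epsilon> n) powr b"
      if \<phi>: "\<And>x y. x \<in> {0..T} \<Longrightarrow> y \<in> {0..T} \<Longrightarrow>
          \<bar>\<phi> x - \<phi> y\<bar> \<le> k * \<bar>x - y\<bar> powr a * max (max \<bar>x - s\<bar> \<bar>y - s\<bar>) \<tau> powr b"
        and u: "u \<in> {0..T}" "\<bar>u - s\<bar> \<le> \<tau>" and v: "v \<in> {0..T}" "\<bar>v - u\<bar> \<le> \<epsilon> n" for \<phi> :: "real \<Rightarrow> real" and u v n
    proof -
      have vs: "\<bar>v - s\<bar> \<le> \<tau> + \<epsilon> n" using u v by linarith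
      have "\<bar>\<phi> v - \<phi> u\<bar> \<le> k * \<bar>v - u\<bar> powr a * max (max \<bar>v - s\<bar> \<bar>u - s\<bar>) \<tau> powr b"
        by (rule \<phi>[OF v(1) u(1)])
      also have "\<dots> \<le> k * \<epsilon> n powr a * (\<tau> + \<epsilon> n) powr b"
        using vs u v k a b \<tau> \<epsilon>0[of n] by (intro mult_mono powr_mono2) auto
      finally show ?thesis .
    qed
    have nf: "\<bar>f v - f s\<bar> \<le> k * (\<tau> + \<epsilon> n) powr c" if "\<bar>u - s\<bar> \<le> \<tau>" "v \<in> {0..T}" "\<bar>v - u\<bar> \<le> \<epsilon> n" for u v n
      by (rule near[OF _ that]) (rule fk[folded \<tau>_def])
    have ng: "\<bar>g v - g s\<bar> \<le> k * (\<tau> + \<epsilon> n) powr c" if "\<bar>u - s\<bar> \<le> \<tau>" "v \<in> {0..T}" "\<bar>v - u\<bar> \<le> \<epsilon> n" for u v n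
      by (rule near[OF _ that]) (rule gk[folded \<tau>_def])
    have ng': "\<bar>g v - g u\<bar> \<le> k * \<epsilon> n powr a * (\<tau> + \<epsilon> n) powr b"
      if "u \<in> {0..T}" "\<bar>u - s\<bar> \<le> \<tau>" "v \<in> {0..T}" "\<bar>v - u\<bar> \<le> \<epsilon> n" for u v n
      by (rule near'[OF _ that]) (rule gk[folded \<tau>_def])
    have Fs: "\<bar>F n u - f s\<bar> \<le> k * (\<tau> + \<epsilon> n) powr c" if "u \<in> {0..T}" "\<bar>u - s\<bar> \<le> \<tau>" for n u
      using that by (intro bound(1) nf) (auto simp: \<epsilon>_def)
    have Gs: "\<bar>G n u - g s\<bar> \<le> k * (\<tau> + \<epsilon> n) powr c" if "u \<in> {0..T}" "\<bar>u - s\<bar> \<le> \<tau>" for n u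
      using that by (intro bound(2) ng) (auto simp: \<epsilon>_def)
    have Gu: "\<bar>G n u - g u\<bar> \<le> k * \<epsilon> n powr a * (\<tau> + \<epsilon> n) powr b" if "u \<in> {0..T}" "\<bar>u - s\<bar> \<le> \<tau>" for n u
      using that by (intro bound(2) ng') (auto simp: \<epsilon>_def)
    have F's: "\<bar>F' n u\<bar> \<le> 2 * (k * (\<tau> + \<epsilon> n) powr c) / \<epsilon> n" if "u \<in> {0..T}" "\<bar>u - s\<bar> \<le> \<tau>" for n u
      using scale_avg_deriv_bound[OF T that(1), of n f "f s" "k * (\<tau> + \<epsilon> n) powr c"] nf[OF that(2)]
      by (auto simp: F'_def \<epsilon>_def)
    have G's: "\<bar>G' n u\<bar> \<le> 2 * (k * (\<tau> + \<epsilon> n) powr c) / \<epsilon> n" if "u \<in> {0..T}" "\<bar>u - s\<bar> \<le> \<tau>" for n u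
      using scale_avg_deriv_bound[OF T that(1), of n g "g s" "k * (\<tau> + \<epsilon> n) powr c"] ng[OF that(2)]
      by (auto simp: G'_def \<epsilon>_def)

    \<comment> \<open>Subtracting \<open>f s * G N u\<close> replaces each \<open>F n u\<close> in
      the derivative by \<open>F n u - f s\<close>, which is small as seen from
      \<open>s\<close>.\<close>
    define \<psi> where "\<psi> u = (\<Sum>n<N. F n u * (G (Suc n) u - G n u)) - f s * G N u" for u
    define \<psi>' where "\<psi>' u = (\<Sum>n<N. F' n u * (G (Suc n) u - G n u) + (F n u - f s) * (G' (Suc n) u - G' n u))" for u
    \<comment> \<open>The lower end of the telescoping sum vanishes because the average at scale 0
      is constant.\<close>
    have tel: "(\<Sum>n<N. G' (Suc n) u - G' n u) = G' N u" for u
      using sum_lessThan_telescope[of "\<lambda>n. G' n u" N] by (simp add: G'_def)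
    have d\<psi>: "(\<psi> has_real_derivative \<psi>' u) (at u within {0..T})" if u: "u \<in> {0..T}" for u
    proof -
      have "(\<psi> has_real_derivative (\<Sum>n<N. F' n u * (G (Suc n) u - G n u) + (G' (Suc n) u - G' n u) * F n u) - f s * G' N u)
          (at u within {0..T})"
        unfolding \<psi>_def F_def G_def F'_def G'_def
        by (intro DERIV_diff DERIV_sum DERIV_mult DERIV_cmult scale_avg_has_derivative T f g u)
      also have "(\<Sum>n<N. F' n u * (G (Suc n) u - G n u) + (G' (Suc n) u - G' n u) * F n u) - f s * G' N u = \<psi>' u"
        unfolding tel[symmetric] \<psi>'_def by (simp add: sum_distrib_left sum.distrib[symmetric] sum_subtractf[symmetric] algebra_simps)
      finally show ?thesis .
    qed
    have \<psi>'_bound: "\<bar>\<psi>' u\<bar> \<le> 20 / (2 powr \<delta> - 1) * k\<^sup>2 * \<tau> powr (- \<delta>)" if u: "u \<in> {0..T}" "\<bar>u - s\<bar> \<le> \<tau>" for u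
    proof -
      \<comment> \<open>The product rule gives \<open>4 * K\<^sup>2 / \<epsilon> n\<close> from the
        first product and \<open>6 * K\<^sup>2 / \<epsilon> n\<close> from the second, whose finer
        scale is half as long. The factor \<open>2 powr (2 * c) \<le> 2\<close> in
        \<open>K\<^sup>2\<close> turns 10 into 20.\<close>
      have summand: "\<bar>F' n u * (G (Suc n) u - G n u) + (F n u - f s) * (G' (Suc n) u - G' n u)\<bar>
          \<le> 20 * k\<^sup>2 * \<epsilon> n powr (- \<delta>)" if n: "n < N" for n
      proof -
        define K where "K = k * (2 * \<epsilon> n) powr c"
        have K: "K \<ge> 0" using k by (simp add: K_def)
        have "\<tau> \<le> \<epsilon> n" "\<tau> \<le> \<epsilon> (Suc n)" using N \<epsilon>_mono[of n N] \<epsilon>_mono[of "Suc n" N] n by auto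
        then have K1: "k * (\<tau> + \<epsilon> n) powr c \<le> K" "k * (\<tau> + \<epsilon> (Suc n)) powr c \<le> K"
          unfolding K_def using k c \<epsilon>0[of n] \<tau> by (auto simp: \<epsilon>Suc intro!: mult_left_mono powr_mono2)
        have "\<bar>F' n u\<bar> \<le> 2 * K / \<epsilon> n" "\<bar>G' n u\<bar> \<le> 2 * K / \<epsilon> n"
          using F's[OF u, of n] G's[OF u, of n] K1(1) \<epsilon>0[of n]
          by (meson divide_right_mono less_imp_le mult_left_mono order_trans zero_le_numeral)+
        moreover have "\<bar>G' (Suc n) u\<bar> \<le> 2 * K / \<epsilon> (Suc n)"
          using G's[OF u, of "Suc n"] K1(2) \<epsilon>0[of "Suc n"]
          by (meson divide_right_mono less_imp_le mult_left_mono order_trans zero_le_numeral)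
        moreover have "\<bar>F n u - f s\<bar> \<le> K" "\<bar>G n u - g s\<bar> \<le> K" "\<bar>G (Suc n) u - g s\<bar> \<le> K"
          using Fs[OF u, of n] Gs[OF u, of n] Gs[OF u, of "Suc n"] K1 by linarith+
        ultimately have "\<bar>F' n u\<bar> * \<bar>G (Suc n) u - G n u\<bar> \<le> (2 * K / \<epsilon> n) * (2 * K)"
            "\<bar>F n u - f s\<bar> * \<bar>G' (Suc n) u - G' n u\<bar> \<le> K * (2 * K / \<epsilon> (Suc n) + 2 * K / \<epsilon> n)"
          using K \<epsilon>0[of n] by (intro mult_mono; force)+
        then have "\<bar>F' n u * (G (Suc n) u - G n u) + (F n u - f s) * (G' (Suc n) u - G' n u)\<bar>
           \<le> (2 * K / \<epsilon> n) * (2 * K) + K * (2 * K / \<epsilon> (Suc n) + 2 * K / \<epsilon> n)"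
          by (intro order_trans[OF abs_triangle_ineq] add_mono) (auto simp: abs_mult)
        also have "\<dots> = 10 * K\<^sup>2 / \<epsilon> n" by (simp add: \<epsilon>Suc power2_eq_square field_simps)
        also have "\<dots> = 10 * k\<^sup>2 * (2 powr (2 * c)) * \<epsilon> n powr (- \<delta>)"
        proof -
          have "((2 * \<epsilon> n) powr c)\<^sup>2 = 2 powr (2 * c) * \<epsilon> n powr (2 * c)"
            using \<epsilon>0[of n] powr_mult[of 2 "\<epsilon> n" "2 * c"] by (simp add: power2_eq_square powr_add[symmetric])
          moreover have "\<epsilon> n powr (- \<delta>) = \<epsilon> n powr (2 * c) / \<epsilon> n"
            using \<epsilon>0[of n] by (simp add: \<delta>_def powr_diff)
          ultimately show ?thesis by (simp add: K_def power_mult_distrib)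
        qed
        also have "\<dots> \<le> 10 * k\<^sup>2 * 2 * \<epsilon> n powr (- \<delta>)"
          using powr_mono[of "2 * c" 1 2] c by (intro mult_right_mono mult_left_mono) auto
        finally show ?thesis by simp
      qed
      have geo: "(\<Sum>n<N. \<epsilon> n powr (- \<delta>)) \<le> \<tau> powr (- \<delta>) / (2 powr \<delta> - 1)"
      proof -
        have e: "\<epsilon> n powr (- \<delta>) = T powr (- \<delta>) * (2 powr \<delta>) ^ n" for n
        proof -
          have "(1/2::real) powr (- \<delta>) = 2 powr \<delta>" by (simp add: powr_divide powr_minus)
          then show ?thesis unfolding \<epsilon>_def using powr_half_power[of T n "- \<delta>"] T by simp
        qed
        have "(\<Sum>n<N. \<epsilon> n powr (- \<delta>)) = T powr (- \<delta>) * (((2 powr \<delta>) ^ N - 1) / (2 powr \<delta> - 1))"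
          unfolding e sum_distrib_left[symmetric] using r1 \<delta> by (subst geometric_sum) auto
        also have "\<dots> \<le> T powr (- \<delta>) * ((2 powr \<delta>) ^ N / (2 powr \<delta> - 1))"
          using r1 \<delta> by (intro mult_left_mono divide_right_mono) (auto simp: ge_one_powr_ge_zero)
        also have "\<dots> = \<epsilon> N powr (- \<delta>) / (2 powr \<delta> - 1)" by (simp add: e)
        also have "\<dots> \<le> \<tau> powr (- \<delta>) / (2 powr \<delta> - 1)"
          using r1 \<tau> N \<delta> by (intro divide_right_mono powr_mono2') (auto simp: ge_one_powr_ge_zero)
        finally show ?thesis .
      qed
      have "\<bar>\<psi>' u\<bar> \<le> (\<Sum>n<N. 20 * k\<^sup>2 * \<epsilon> n powr (- \<delta>))"
        unfolding \<psi>'_def using summand by (intro order_trans[OF sum_abs] sum_mono) auto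
      also have "\<dots> \<le> 20 * k\<^sup>2 * (\<tau> powr (- \<delta>) / (2 powr \<delta> - 1))"
        unfolding sum_distrib_left[symmetric] using geo by (intro mult_left_mono) auto
      finally show ?thesis by (simp add: field_simps)
    qed
    have \<psi>_diff: "\<bar>\<psi> t - \<psi> s\<bar> \<le> 20 / (2 powr \<delta> - 1) * k\<^sup>2 * \<tau> powr (2 * c)"
    proof -
      \<comment> \<open>A convex set that joins \<open>s\<close> to \<open>t\<close> and on which
        the derivative bound is available.\<close>
      define S where "S = {0..T} \<inter> cball s \<tau>"
      have S: "u \<in> {0..T}" "\<bar>u - s\<bar> \<le> \<tau>" if "u \<in> S" for u
        using that by (auto simp: S_def dist_real_def)
      have "norm (\<psi> t - \<psi> s) \<le> 20 / (2 powr \<delta> - 1) * k\<^sup>2 * \<tau> powr (- \<delta>) * norm (t - s)"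
      proof (rule field_differentiable_bound[of S \<psi> \<psi>'])
        show "convex S" by (simp add: S_def convex_Int)
        show "(\<psi> has_real_derivative \<psi>' u) (at u within S)" if "u \<in> S" for u
          using has_field_derivative_subset[OF d\<psi>[OF S(1)[OF that]]] by (simp add: S_def)
        show "norm (\<psi>' u) \<le> 20 / (2 powr \<delta> - 1) * k\<^sup>2 * \<tau> powr (- \<delta>)" if "u \<in> S" for u
          using \<psi>'_bound[OF S[OF that]] by simp
        show "t \<in> S" "s \<in> S" using s t \<tau> by (auto simp: S_def \<tau>_def dist_real_def)
      qed
      also have "\<dots> = 20 / (2 powr \<delta> - 1) * k\<^sup>2 * (\<tau> powr (- \<delta>) * \<tau> powr 1)"
        using \<tau> by (simp add: \<tau>_def)
      also have "\<tau> powr (- \<delta>) * \<tau> powr 1 = \<tau> powr (2 * c)"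
        unfolding powr_add[symmetric] by (simp add: \<delta>_def)
      finally show ?thesis by simp
    qed

    \<comment> \<open>The series beyond scale \<open>N\<close>, with \<open>f s\<close> removed from
      the first factor; the removed part telescopes to \<open>f s * (g u - G N u)\<close>. Unlike at
      coarse scales nothing is differentiated here: the tails at \<open>t\<close> and at
      \<open>s\<close> are small separately.\<close>
    define tl where "tl u n = (F (n + N) u - f s) * (G (Suc (n + N)) u - G (n + N) u)" for u n
    have tail: "\<bar>\<Sum>n. tl u n\<bar> \<le> 6 / (1 - (1/2) powr a) * k\<^sup>2 * \<tau> powr (2 * c)" if u: "u \<in> {0..T}" "\<bar>u - s\<bar> \<le> \<tau>" for u
    proof -
      define q where "q = (1/2::real) powr a"
      have q: "0 < q" "q < 1" using half_powr_less_1[OF a] by (auto simp: q_def)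
      \<comment> \<open>At these scales \<open>\<tau> + \<epsilon> n \<le> 3 * \<tau>\<close>. Only
        the power \<open>a\<close> of the scale is left for the geometric decay; the other powers
        are carried by \<open>\<tau>\<close>. The final 6 is 2 times
        \<open>3 powr (2 * c) \<le> 3\<close>.\<close>
      define K where "K = k * (3 * \<tau>) powr c * (2 * k * (3 * \<tau>) powr b) * \<epsilon> N powr a"
      have K0: "K \<ge> 0" using k by (simp add: K_def)
      have bd: "\<bar>tl u n\<bar> \<le> K * q ^ n" for n
      proof -
        have le: "\<epsilon> (n + N) \<le> 2 * \<tau>" "\<epsilon> (Suc (n + N)) \<le> \<epsilon> (n + N)"
          using N \<epsilon>_mono[of N "n + N"] \<epsilon>_mono[of "n + N" "Suc (n + N)"] by auto
        have 1: "\<bar>F (n + N) u - f s\<bar> \<le> k * (3 * \<tau>) powr c"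
          using le k c \<tau> \<epsilon>0[of "n + N"]
          by (intro order_trans[OF Fs[OF u]] mult_left_mono powr_mono2) auto
        have *: "\<bar>G m u - g u\<bar> \<le> k * \<epsilon> (n + N) powr a * (3 * \<tau>) powr b" if "\<epsilon> m \<le> \<epsilon> (n + N)" for m
          using le k a b \<tau> \<epsilon>0[of m] \<epsilon>0[of "n + N"] that
          by (intro order_trans[OF Gu[OF u]] mult_mono mult_left_mono powr_mono2) auto
        have 2: "\<bar>G (Suc (n + N)) u - G (n + N) u\<bar> \<le> 2 * k * (3 * \<tau>) powr b * \<epsilon> (n + N) powr a"
          using *[OF le(2)] *[OF order_refl] by (simp add: mult_ac)
        have 3: "\<epsilon> (n + N) powr a = \<epsilon> N powr a * q ^ n"
          unfolding \<epsilon>_def q_def powr_half_power[OF less_imp_le[OF T]] by (simp add: power_add)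
        have "\<bar>tl u n\<bar> \<le> (k * (3 * \<tau>) powr c) * (2 * k * (3 * \<tau>) powr b * \<epsilon> (n + N) powr a)"
          unfolding tl_def abs_mult using 1 2 k by (intro mult_mono) auto
        then show ?thesis by (simp add: K_def 3 mult.assoc)
      qed
      have sg: "summable (\<lambda>n. K * q ^ n)" using q by (intro summable_mult summable_geometric) auto
      have "norm (\<Sum>n. tl u n) \<le> (\<Sum>n. K * q ^ n)"
        by (rule norm_suminf_le[OF _ sg]) (use bd in auto)
      also have "\<dots> = K / (1 - q)" using q by (simp add: suminf_mult suminf_geometric summable_geometric)
      also have "\<dots> \<le> 6 * k\<^sup>2 * \<tau> powr (2 * c) / (1 - q)"
      proof (rule divide_right_mono)
        have "K \<le> k * (3 * \<tau>) powr c * (2 * k * (3 * \<tau>) powr b) * (3 * \<tau>) powr a"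
          unfolding K_def using N \<tau> \<epsilon>0[of N] a k by (intro mult_left_mono powr_mono2) auto
        also have "\<dots> = 2 * k\<^sup>2 * (3 * \<tau>) powr (2 * c)"
        proof -
          have "(3 * \<tau>) powr (2 * c) = (3 * \<tau>) powr c * ((3 * \<tau>) powr b * (3 * \<tau>) powr a)"
            unfolding powr_add[symmetric] by (simp add: c_def add.commute)
          then show ?thesis by (simp add: power2_eq_square)
        qed
        also have "\<dots> = 2 * k\<^sup>2 * (3 powr (2 * c)) * \<tau> powr (2 * c)" using \<tau> by (simp add: powr_mult)
        also have "\<dots> \<le> 2 * k\<^sup>2 * 3 * \<tau> powr (2 * c)"
          using powr_mono[of "2 * c" 1 3] c by (intro mult_right_mono mult_left_mono) auto
        finally show "K \<le> 6 * k\<^sup>2 * \<tau> powr (2 * c)" by simp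
      qed (use q in auto)
      finally show ?thesis by (simp add: q_def)
    qed
    have h_split: "h u - (\<Sum>n<N. F n u * (G (Suc n) u - G n u)) = (\<Sum>n. tl u n) + f s * (g u - G N u)" if u: "u \<in> {0..T}" for u
    proof -
      have "h u = (\<Sum>n. F (n + N) u * (G (Suc (n + N)) u - G (n + N) u)) + (\<Sum>n<N. F n u * (G (Suc n) u - G n u))"
        unfolding h_def by (rule suminf_split_initial_segment[OF summ[OF u]])
      moreover have "(\<lambda>n. G (Suc (n + N)) u - G (n + N) u) sums (g u - G N u)"
        using telescope_sums[OF LIMSEQ_ignore_initial_segment[OF G_lim[OF u], of N]] by simp
      then have s1: "(\<lambda>n. f s * (G (Suc (n + N)) u - G (n + N) u)) sums (f s * (g u - G N u))"
        by (rule sums_mult)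
      have s2: "(\<lambda>n. F (n + N) u * (G (Suc (n + N)) u - G (n + N) u)) sums
          (\<Sum>n. F (n + N) u * (G (Suc (n + N)) u - G (n + N) u))"
        using summable_ignore_initial_segment[OF summ[OF u], of N] by (rule summable_sums)
      have "tl u sums ((\<Sum>n. F (n + N) u * (G (Suc (n + N)) u - G (n + N) u)) - f s * (g u - G N u))"
        using sums_diff[OF s2 s1] by (simp add: tl_def[abs_def] left_diff_distrib)
      then have "(\<Sum>n. tl u n) = (\<Sum>n. F (n + N) u * (G (Suc (n + N)) u - G (n + N) u)) - f s * (g u - G N u)"
        by (simp add: sums_iff)
      ultimately show ?thesis by simp
    qed
    \<comment> \<open>By \<open>h_split\<close>, \<open>h u\<close> is \<open>\<psi> u\<close> plus
      the tail plus \<open>f s * g u\<close>: the terms with \<open>G N\<close> cancel.\<close>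
    have "h t - h s - f s * (g t - g s) = (\<psi> t - \<psi> s) + (\<Sum>n. tl t n) - (\<Sum>n. tl s n)"
      using h_split[OF t] h_split[OF s] by (simp add: \<psi>_def algebra_simps)
    then have "\<bar>h t - h s - f s * (g t - g s)\<bar> \<le> \<bar>\<psi> t - \<psi> s\<bar> + \<bar>\<Sum>n. tl t n\<bar> + \<bar>\<Sum>n. tl s n\<bar>"
      by linarith
    also have "\<dots> \<le> 20 / (2 powr \<delta> - 1) * k\<^sup>2 * \<tau> powr (2 * c) + 6 / (1 - (1/2) powr a) * k\<^sup>2 * \<tau> powr (2 * c)
       + 6 / (1 - (1/2) powr a) * k\<^sup>2 * \<tau> powr (2 * c)"
      using \<tau> s t by (intro add_mono \<psi>_diff tail) (auto simp: \<tau>_def)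
    also have "\<dots> = C * k\<^sup>2 * \<tau> powr (2 * c)" by (simp add: C_def algebra_simps add_divide_distrib)
    finally show ?thesis by (simp add: \<tau>_def c_def)
  qed
  show thesis by (rule that[OF cont C main])
qed


section \<open>Pointwise control by energies\<close>

text \<open>The difference of the averages is the average of \<open>f x - f y\<close> over the
  rectangle. The threshold \<open>c\<close> is left to the caller, who picks it so that both terms
  of the bound have the same order.\<close>

lemma average_diff_le:
  fixes f :: "real \<Rightarrow> real"
  assumes f: "continuous_on S f" and S: "{p..p'} \<subseteq> S" "{r..r'} \<subseteq> S"
    and pp: "p < p'" and rr: "r < r'" and c: "c > 0" and q: "q > 1"
    and D: "D \<ge> 0" "(\<integral>\<^sup>+z. indicator ({p..p'} \<times> {r..r'}) z * ennreal (\<bar>f (fst z) - f (snd z)\<bar> powr q) \<partial>lborel) \<le> ennreal D"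
  shows "\<bar>integral {p..p'} f / (p' - p) - integral {r..r'} f / (r' - r)\<bar> \<le> c + c powr (1 - q) * D / ((p' - p) * (r' - r))"
proof -
  have f1: "continuous_on {p..p'} f" and f2: "continuous_on {r..r'} f"
    using f S by (auto intro: continuous_on_subset)
  define Q where "Q = cbox (p, r) (p', r')"
  have Q: "Q = {p..p'} \<times> {r..r'}" by (simp add: Q_def cbox_Pair_eq box_real)
  define g where "g z = f (fst z) - f (snd z)" for z
  have g: "continuous_on Q g"
    unfolding Q g_def
    by (intro continuous_intros continuous_on_compose2[OF f1] continuous_on_compose2[OF f2]) auto
  have "continuous_on Q (\<lambda>z. \<bar>g z\<bar> powr q)"
    using q by (intro continuous_on_powr' g continuous_intros) auto
  then have gq: "(\<lambda>z. \<bar>g z\<bar> powr q) integrable_on Q"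
    unfolding Q_def by (rule integrable_continuous)
  have gi: "g integrable_on Q" using g unfolding Q_def by (rule integrable_continuous)
  have vol: "integral Q (\<lambda>_. c) = c * ((p' - p) * (r' - r))"
    using pp rr by (simp add: Q_def content_Pair mult_ac)
  have I1: "f integrable_on {p..p'}" "f integrable_on {r..r'}"
    using f1 f2 by (auto intro: integrable_continuous_interval)
  have "integral Q g = integral (cbox p p') (\<lambda>x. integral (cbox r r') (\<lambda>y. g (x, y)))"
    unfolding Q_def by (rule integral_prod_continuous) (use g in \<open>simp add: Q_def\<close>)
  also have "\<dots> = integral {p..p'} (\<lambda>x. (r' - r) * f x - integral {r..r'} f)"
  proof -
    have "integral {r..r'} (\<lambda>y. f x - f y) = (r' - r) * f x - integral {r..r'} f" for x
      using rr I1(2) by (subst Henstock_Kurzweil_Integration.integral_diff) auto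
    then show ?thesis by (simp add: g_def box_real)
  qed
  also have "\<dots> = (r' - r) * integral {p..p'} f - (p' - p) * integral {r..r'} f"
    using pp I1 by (subst Henstock_Kurzweil_Integration.integral_diff) (auto intro!: integrable_on_mult_right)
  finally have Ig: "integral Q g = (r' - r) * integral {p..p'} f - (p' - p) * integral {r..r'} f" .
  \<comment> \<open>replaces Jensen's inequality\<close>
  have bound: "\<bar>g z\<bar> \<le> c + c powr (1 - q) * \<bar>g z\<bar> powr q" for z
  proof (cases "\<bar>g z\<bar> \<le> c")
    case True then show ?thesis by (simp add: add_increasing2)
  next
    case False
    have "\<bar>g z\<bar> = \<bar>g z\<bar> powr (1 - q) * \<bar>g z\<bar> powr q"
      unfolding powr_add[symmetric] using False c by simp
    also have "\<dots> \<le> c powr (1 - q) * \<bar>g z\<bar> powr q"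
      using False c q by (intro mult_right_mono powr_mono2') auto
    finally show ?thesis using c by linarith
  qed
  have ID: "integral Q (\<lambda>z. \<bar>g z\<bar> powr q) \<le> D"
  proof -
    have "ennreal (integral Q (\<lambda>z. \<bar>g z\<bar> powr q)) = (\<integral>\<^sup>+z. ennreal (indicator Q z * \<bar>g z\<bar> powr q) \<partial>lborel)"
      by (rule nn_integral_has_integral_lebesgue[symmetric, OF _ integrable_integral[OF gq]]) simp
    also have "\<dots> = (\<integral>\<^sup>+z. indicator ({p..p'} \<times> {r..r'}) z * ennreal (\<bar>f (fst z) - f (snd z)\<bar> powr q) \<partial>lborel)"
      by (intro nn_integral_cong) (auto simp: Q g_def indicator_def)
    finally show ?thesis using D by (metis ennreal_le_iff)
  qed
  have "norm (integral Q g) \<le> integral Q (\<lambda>z. c + c powr (1 - q) * \<bar>g z\<bar> powr q)"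
    using gi gq bound
    by (intro integral_norm_bound_integral integrable_add integrable_on_mult_right)
       (auto simp: Q_def)
  also have "\<dots> = c * ((p' - p) * (r' - r)) + c powr (1 - q) * integral Q (\<lambda>z. \<bar>g z\<bar> powr q)"
    unfolding vol[symmetric] using gq
    by (subst Henstock_Kurzweil_Integration.integral_add) (auto simp: Q_def intro!: integrable_on_mult_right)
  also have "\<dots> \<le> c * ((p' - p) * (r' - r)) + c powr (1 - q) * D"
    using ID by (intro add_left_mono mult_left_mono) auto
  finally have *: "\<bar>integral Q g\<bar> \<le> c * ((p' - p) * (r' - r)) + c powr (1 - q) * D" by simp
  have "integral {p..p'} f / (p' - p) - integral {r..r'} f / (r' - r) = integral Q g / ((p' - p) * (r' - r))"
    using pp rr unfolding Ig by (simp add: field_simps)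
  then have "\<bar>integral {p..p'} f / (p' - p) - integral {r..r'} f / (r' - r)\<bar> = \<bar>integral Q g\<bar> / ((p' - p) * (r' - r))"
    using pp rr by (simp add: abs_divide abs_mult)
  also have "\<dots> \<le> (c * ((p' - p) * (r' - r)) + c powr (1 - q) * D) / ((p' - p) * (r' - r))"
    using pp rr * by (intro divide_right_mono) auto
  also have "\<dots> = c + c powr (1 - q) * D / ((p' - p) * (r' - r))"
    using pp rr by (simp add: add_divide_distrib)
  finally show ?thesis .
qed

lemma scale_avg_tendsto:
  fixes f :: "real \<Rightarrow> real"
  assumes ab: "a < b" and f: "continuous_on {a..b} f" and u: "u \<in> {a..b}"
  shows "(\<lambda>n. scale_avg a b f n u) \<longlonglongrightarrow> f u"
proof (rule LIMSEQ_I)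
  fix e :: real assume e: "e > 0"
  obtain d where d: "d > 0" "\<And>v. v \<in> {a..b} \<Longrightarrow> dist v u < d \<Longrightarrow> dist (f v) (f u) < e / 2"
    using f u e unfolding continuous_on_iff by (metis half_gt_zero)
  obtain N where N: "(1/2::real)^N < d / (b - a)"
    using real_arch_pow_inv[of "d / (b - a)" "1/2"] d ab by auto
  have "norm (scale_avg a b f n u - f u) < e" if n: "n \<ge> N" for n
  proof -
    have "(1/2::real)^n \<le> (1/2)^N" using n by (intro power_decreasing) auto
    then have "(1/2)^n < d / (b - a)" using N by linarith
    then have "(1/2)^n * (b - a) < d" using ab by (simp add: pos_less_divide_eq)
    then have "\<bar>scale_avg a b f n u - f u\<bar> \<le> e / 2"
      using d(2) by (intro scale_avg_bound[OF ab f u]) (force simp: dist_real_def less_imp_le)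
    then show ?thesis using e by simp
  qed
  then show "\<exists>N. \<forall>n\<ge>N. norm (scale_avg a b f n u - f u) < e" by blast
qed

text \<open>A Morrey-type embedding by chaining: averages at consecutive scales around
  \<open>u\<close> differ by an amount of order \<open>l powr \<sigma>\<close>, where
  \<open>l\<close> is the length of the larger interval, and these amounts form a geometric series.
  The 2 in the exponent \<open>\<sigma> * q + 2\<close> pays for dividing by the area of a rectangle
  of side about \<open>l\<close>.\<close>

lemma energy_holder_pos:
  fixes f :: "real \<Rightarrow> real" and w :: "real \<times> real \<Rightarrow> ennreal"
  assumes ab: "a < b" and f: "continuous_on {a..b} f" and q: "q > 1" and \<sigma>: "\<sigma> > 0" and W: "W > 0"
    and [measurable]: "w \<in> borel_measurable borel"
    and w: "\<And>v z. v \<in> {a..b} \<Longrightarrow> z \<in> {a..b} \<Longrightarrow>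
       ennreal (\<bar>f v - f z\<bar> powr q) \<le> ennreal (\<bar>v - z\<bar> powr (\<sigma> * q + 2)) * w (v, z)"
    and wW: "(\<integral>\<^sup>+z. indicator ({a..b} \<times> {a..b}) z * w z \<partial>lborel) \<le> ennreal W"
  shows "\<bar>f a - f b\<bar> \<le> 6 / (1 - (1/2) powr \<sigma>) * (b - a) powr \<sigma> * W powr (1 / q)"
proof -
  define A where "A = scale_avg a b f"
  define K where "K = 3 * (b - a) powr \<sigma> * W powr (1 / q)"
  define \<theta> where "\<theta> = (1/2::real) powr \<sigma>"
  have \<theta>: "0 < \<theta>" "\<theta> < 1" using half_powr_less_1[OF \<sigma>] by (auto simp: \<theta>_def)
  have K: "K \<ge> 0" by (simp add: K_def)
  have step: "\<bar>A (Suc n) u - A n u\<bar> \<le> K * \<theta> ^ n" if u: "u \<in> {a..b}" for n u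
  proof -
    define e :: real where "e = (1/2)^n"
    have e: "0 < e" "e \<le> 1" by (auto simp: e_def power_le_one)
    define p p' r r' where "p = (1 - e/2) * u + e/2 * a" and "p' = (1 - e/2) * u + e/2 * b"
      and "r = (1 - e) * u + e * a" and "r' = (1 - e) * u + e * b"
    define l where "l = e * (b - a)"
    have l: "l > 0" using e ab by (simp add: l_def)
    have len: "p' - p = l / 2" "r' - r = l" unfolding p_def p'_def r_def r'_def l_def by (simp_all add: algebra_simps)
    have lt: "p < p'" "r < r'" using len l by linarith+
    have ea: "e * a \<le> e * u" "e * u \<le> e * b" using u e by (auto intro!: mult_left_mono)
    have "r \<le> p" "p' \<le> r'" using ea unfolding p_def p'_def r_def r'_def by (simp_all add: algebra_simps)
    then have sub: "{p..p'} \<subseteq> {r..r'}" by auto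
    have sub': "{r..r'} \<subseteq> {a..b}"
    proof
      fix v assume "v \<in> {r..r'}"
      then show "v \<in> {a..b}"
        unfolding r_def r'_def using e by (intro scale_interval(1)[OF u _ e(2)]) auto
    qed
    \<comment> \<open>Chosen with \<open>c powr q = l powr (\<sigma> * q) * W\<close>. The rectangle
      has area \<open>l\<^sup>2 / 2\<close>, so the second term of \<open>average_diff_le\<close> is
      exactly \<open>2 * c\<close>.\<close>
    define c where "c = l powr \<sigma> * W powr (1 / q)"
    have c: "c > 0" using l W by (simp add: c_def)
    define D where "D = l powr (\<sigma> * q + 2) * W"
    have "(\<integral>\<^sup>+z. indicator ({p..p'} \<times> {r..r'}) z * ennreal (\<bar>f (fst z) - f (snd z)\<bar> powr q) \<partial>lborel)
       \<le> (\<integral>\<^sup>+z. ennreal (l powr (\<sigma> * q + 2)) * (indicator ({a..b} \<times> {a..b}) z * w z) \<partial>lborel)"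
    proof (rule nn_integral_mono)
      fix z :: "real \<times> real"
      show "indicator ({p..p'} \<times> {r..r'}) z * ennreal (\<bar>f (fst z) - f (snd z)\<bar> powr q)
        \<le> ennreal (l powr (\<sigma> * q + 2)) * (indicator ({a..b} \<times> {a..b}) z * w z)"
      proof (cases "z \<in> {p..p'} \<times> {r..r'}")
        case True
        then obtain x y where z: "z = (x, y)" "x \<in> {r..r'}" "y \<in> {r..r'}" using sub by (cases z) auto
        have xy: "x \<in> {a..b}" "y \<in> {a..b}" using z sub' by auto
        have "\<bar>x - y\<bar> \<le> l" using z len by auto
        then have "\<bar>x - y\<bar> powr (\<sigma> * q + 2) \<le> l powr (\<sigma> * q + 2)"
          using \<sigma> q by (intro powr_mono2) auto
        then have "ennreal (\<bar>x - y\<bar> powr (\<sigma> * q + 2)) * w (x, y) \<le> ennreal (l powr (\<sigma> * q + 2)) * w (x, y)"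
          by (intro mult_right_mono ennreal_leI) auto
        then show ?thesis using w[OF xy] True xy by (auto simp: z)
      qed simp
    qed
    also have "\<dots> = ennreal (l powr (\<sigma> * q + 2)) * (\<integral>\<^sup>+z. indicator ({a..b} \<times> {a..b}) z * w z \<partial>lborel)"
      by (rule nn_integral_cmult) (auto intro!: borel_measurable_times_ennreal borel_measurable_indicator borel_closed closed_Times)
    also have "\<dots> \<le> ennreal D"
      unfolding D_def using W by (simp add: ennreal_mult mult_left_mono wW)
    finally have D: "(\<integral>\<^sup>+z. indicator ({p..p'} \<times> {r..r'}) z * ennreal (\<bar>f (fst z) - f (snd z)\<bar> powr q) \<partial>lborel) \<le> ennreal D" .
    have D0: "D \<ge> 0" using W by (simp add: D_def)
    have "\<bar>integral {p..p'} f / (p' - p) - integral {r..r'} f / (r' - r)\<bar> \<le> c + c powr (1 - q) * D / ((p' - p) * (r' - r))"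
      by (rule average_diff_le[OF f _ sub' lt c q D0 D]) (use sub sub' in auto)
    also have "c powr (1 - q) * D / ((p' - p) * (r' - r)) = 2 * c"
    proof -
      have "c powr (1 - q) = c / c powr q" using c by (simp add: powr_diff)
      moreover have "c powr q = l powr (\<sigma> * q) * W"
        using l W q by (simp add: c_def powr_mult powr_powr)
      moreover have "D = l powr (\<sigma> * q) * l\<^sup>2 * W"
        using l by (simp add: D_def powr_add)
      moreover have "l powr (\<sigma> * q) > 0" using l by simp
      ultimately have "c powr (1 - q) * D / ((p' - p) * (r' - r))
          = c / (l powr (\<sigma> * q) * W) * (l powr (\<sigma> * q) * l\<^sup>2 * W) / (l / 2 * l)"
        by (simp only: len)
      also have "\<dots> = 2 * c" using l W by (simp add: power2_eq_square)
      finally show ?thesis .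
    qed
    finally have "\<bar>integral {p..p'} f / (p' - p) - integral {r..r'} f / (r' - r)\<bar> \<le> 3 * c" by simp
    moreover have "A n u = integral {r..r'} f / (r' - r)"
      unfolding len unfolding A_def scale_avg_def e_def[symmetric] r_def r'_def l_def ..
    moreover have "A (Suc n) u = integral {p..p'} f / (p' - p)"
    proof -
      have "(1/2::real) ^ Suc n = e / 2" by (simp add: e_def)
      then show ?thesis unfolding len unfolding A_def scale_avg_def p_def p'_def l_def by simp
    qed
    moreover have "3 * c = K * \<theta> ^ n"
      unfolding c_def K_def \<theta>_def l_def e_def using ab by (subst powr_half_power) auto
    ultimately show ?thesis by simp
  qed
  have lim: "\<bar>f u - A 0 u\<bar> \<le> K / (1 - \<theta>)" if u: "u \<in> {a..b}" for u
  proof -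
    have "(\<lambda>n. A (Suc n) u - A n u) sums (f u - A 0 u)"
      unfolding A_def by (rule telescope_sums[OF scale_avg_tendsto[OF ab f u]])
    then have "f u - A 0 u = (\<Sum>n. A (Suc n) u - A n u)" by (simp add: sums_iff)
    also have "norm \<dots> \<le> (\<Sum>n. K * \<theta> ^ n)"
      using \<theta> step[OF u] by (intro norm_suminf_le summable_mult summable_geometric) auto
    also have "\<dots> = K / (1 - \<theta>)" using \<theta> by (simp add: suminf_mult suminf_geometric summable_geometric)
    finally show ?thesis by simp
  qed
  \<comment> \<open>At scale 0 both averages run over the whole interval, which links the two
    endpoints.\<close>
  have "A 0 a = A 0 b" by (simp add: A_def scale_avg_def)
  then have "\<bar>f a - f b\<bar> \<le> 2 * (K / (1 - \<theta>))" using lim[of a] lim[of b] ab by auto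
  also have "\<dots> = 6 / (1 - (1/2) powr \<sigma>) * (b - a) powr \<sigma> * W powr (1 / q)"
    by (simp add: K_def \<theta>_def)
  finally show ?thesis .
qed

text \<open>Adds the case of zero energy, where the balancing threshold would be 0; there the
  positive case is applied to an arbitrarily small energy.\<close>

lemma energy_holder:
  fixes f :: "real \<Rightarrow> real" and w :: "real \<times> real \<Rightarrow> ennreal"
  assumes ab: "a < b" and f: "continuous_on {a..b} f" and q: "q > 1" and \<sigma>: "\<sigma> > 0" and W: "W \<ge> 0"
    and wm: "w \<in> borel_measurable borel"
    and w: "\<And>v z. v \<in> {a..b} \<Longrightarrow> z \<in> {a..b} \<Longrightarrow>
       ennreal (\<bar>f v - f z\<bar> powr q) \<le> ennreal (\<bar>v - z\<bar> powr (\<sigma> * q + 2)) * w (v, z)"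
    and wW: "(\<integral>\<^sup>+z. indicator ({a..b} \<times> {a..b}) z * w z \<partial>lborel) \<le> ennreal W"
  shows "\<bar>f a - f b\<bar> \<le> 6 / (1 - (1/2) powr \<sigma>) * (b - a) powr \<sigma> * W powr (1 / q)"
proof (cases "W = 0")
  case False
  then have "W > 0" using W by simp
  then show ?thesis by (rule energy_holder_pos[OF ab f q \<sigma> _ wm w wW])
next
  case True
  define K where "K = 6 / (1 - (1/2) powr \<sigma>) * (b - a) powr \<sigma>"
  have K: "K > 0" using half_powr_less_1[OF \<sigma>] ab by (simp add: K_def)
  have "\<bar>f a - f b\<bar> = 0"
  proof (rule ccontr)
    assume "\<bar>f a - f b\<bar> \<noteq> 0"
    \<comment> \<open>Makes the bound \<open>K * d\<close> equal to half of the quantity to be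
      bounded.\<close>
    define d where "d = \<bar>f a - f b\<bar> / (2 * K)"
    have d: "d > 0" using \<open>\<bar>f a - f b\<bar> \<noteq> 0\<close> K by (simp add: d_def)
    have "(\<integral>\<^sup>+z. indicator ({a..b} \<times> {a..b}) z * w z \<partial>lborel) \<le> ennreal (d powr q)"
      using wW True by (simp add: order_trans[OF _ zero_le])
    then have "\<bar>f a - f b\<bar> \<le> K * (d powr q) powr (1 / q)"
      unfolding K_def using d by (intro energy_holder_pos[OF ab f q \<sigma> _ wm w]) auto
    also have "\<dots> = \<bar>f a - f b\<bar> / 2" using d q K by (simp add: powr_powr) (simp add: d_def)
    finally show False using \<open>\<bar>f a - f b\<bar> \<noteq> 0\<close> by simp
  qed
  then show ?thesis using True q by simp
qed


section \<open>Integration of weighted energies\<close>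

lemma nn_integral_abs_shift_le:
  fixes h :: "real \<Rightarrow> ennreal"
  assumes [measurable]: "h \<in> borel_measurable borel"
  shows "(\<integral>\<^sup>+t. h \<bar>t - s\<bar> \<partial>lborel) \<le> 2 * (\<integral>\<^sup>+t. h t * indicator {0..} t \<partial>lborel)"
proof -
  have "(\<integral>\<^sup>+t. h \<bar>t - s\<bar> \<partial>lborel) = (\<integral>\<^sup>+t. h \<bar>t\<bar> \<partial>lborel)"
    using nn_integral_real_affine[of "\<lambda>t. h \<bar>t - s\<bar>" 1 s] by simp
  also have "\<dots> \<le> (\<integral>\<^sup>+t. h t * indicator {0..} t + h (- t) * indicator {0..} (- t) \<partial>lborel)"
    by (intro nn_integral_mono) (auto simp: indicator_def abs_if)
  also have "\<dots> = (\<integral>\<^sup>+t. h t * indicator {0..} t \<partial>lborel) + (\<integral>\<^sup>+t. h (- t) * indicator {0..} (- t) \<partial>lborel)"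
    by (rule nn_integral_add) measurable
  also have "(\<integral>\<^sup>+t. h (- t) * indicator {0..} (- t) \<partial>lborel) = (\<integral>\<^sup>+t. h t * indicator {0..} t \<partial>lborel)"
    using nn_integral_real_affine[of "\<lambda>t. h t * indicator {0..} t" "-1" 0] by simp
  finally show ?thesis by (simp add: mult_2)
qed

text \<open>Split at \<open>\<rho>\<close>: below it the maximum is constant and the integral gives
  the term with \<open>1 / \<mu>\<close>; above it the integrand is
  \<open>\<tau> powr (- l - 1)\<close> and gives the term with \<open>1 / l\<close>.\<close>

lemma nn_integral_powr_max_half_line:
  fixes \<mu> l \<rho> :: real
  assumes "\<mu> > 0" "l > 0" "\<rho> > 0"
  shows "(\<integral>\<^sup>+\<tau>. ennreal (\<tau> powr (\<mu> - 1) * max \<rho> \<tau> powr (- (\<mu> + l))) * indicator {0..} \<tau> \<partial>lborel)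
     \<le> ennreal ((1 / \<mu> + 1 / l) * \<rho> powr (- l))"
proof -
  have 1: "((\<lambda>\<tau>. \<rho> powr (- (\<mu> + l)) * \<tau> powr (\<mu> - 1)) has_integral \<rho> powr (- (\<mu> + l)) * (\<rho> powr \<mu> / \<mu>)) {0..\<rho>}"
    using has_integral_powr_from_0[of "\<mu> - 1" \<rho>] assms by (intro has_integral_mult_right) simp
  have 2: "((\<lambda>\<tau>. \<tau> powr (- l - 1)) has_integral \<rho> powr (- l) / l) {\<rho>..}"
    using has_integral_powr_to_inf[of "- l - 1" \<rho>] assms by simp
  have "(\<integral>\<^sup>+\<tau>. ennreal (\<tau> powr (\<mu> - 1) * max \<rho> \<tau> powr (- (\<mu> + l))) * indicator {0..} \<tau> \<partial>lborel)
    \<le> (\<integral>\<^sup>+\<tau>. ennreal (\<rho> powr (- (\<mu> + l)) * \<tau> powr (\<mu> - 1)) * indicator {0..\<rho>} \<tau>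
           + ennreal (\<tau> powr (- l - 1)) * indicator {\<rho>..} \<tau> \<partial>lborel)"
  proof (rule nn_integral_mono)
    fix \<tau> :: real
    show "ennreal (\<tau> powr (\<mu> - 1) * max \<rho> \<tau> powr (- (\<mu> + l))) * indicator {0..} \<tau>
      \<le> ennreal (\<rho> powr (- (\<mu> + l)) * \<tau> powr (\<mu> - 1)) * indicator {0..\<rho>} \<tau>
           + ennreal (\<tau> powr (- l - 1)) * indicator {\<rho>..} \<tau>"
    proof (cases "\<tau> \<le> \<rho>")
      case True
      then show ?thesis by (cases "0 \<le> \<tau>") (simp_all add: max_absorb1 mult.commute)
    next
      case False
      then have "\<tau> powr (\<mu> - 1) * \<tau> powr (- (\<mu> + l)) = \<tau> powr (- l - 1)"
      proof -
        have "\<mu> - 1 + - (\<mu> + l) = - l - 1" by simp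
        then show ?thesis by (simp only: powr_add[symmetric])
      qed
      then show ?thesis using False assms by (auto simp: indicator_def max_def)
    qed
  qed
  also have "\<dots> = (\<integral>\<^sup>+\<tau>. ennreal (\<rho> powr (- (\<mu> + l)) * \<tau> powr (\<mu> - 1)) * indicator {0..\<rho>} \<tau> \<partial>lborel)
       + (\<integral>\<^sup>+\<tau>. ennreal (\<tau> powr (- l - 1)) * indicator {\<rho>..} \<tau> \<partial>lborel)"
    by (rule nn_integral_add) measurable
  also have "\<dots> = ennreal (\<rho> powr (- (\<mu> + l)) * (\<rho> powr \<mu> / \<mu>)) + ennreal (\<rho> powr (- l) / l)"
    using nn_integral_has_integral_lebesgue'[OF _ 1] nn_integral_has_integral_lebesgue'[OF _ 2] by simp
  also have "\<dots> = ennreal ((1 / \<mu> + 1 / l) * \<rho> powr (- l))"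
  proof -
    have "\<rho> powr (- (\<mu> + l)) * \<rho> powr \<mu> = \<rho> powr (- l)" unfolding powr_add[symmetric] by simp
    then have "\<rho> powr (- (\<mu> + l)) * (\<rho> powr \<mu> / \<mu>) = \<rho> powr (- l) / \<mu>" by simp
    then have "ennreal (\<rho> powr (- (\<mu> + l)) * (\<rho> powr \<mu> / \<mu>)) + ennreal (\<rho> powr (- l) / l)
        = ennreal (\<rho> powr (- l) / \<mu> + \<rho> powr (- l) / l)"
      using assms by (simp only:) (intro ennreal_plus[symmetric]; simp)
    also have "\<rho> powr (- l) / \<mu> + \<rho> powr (- l) / l = (1 / \<mu> + 1 / l) * \<rho> powr (- l)"
      by (simp add: distrib_right)
    finally show ?thesis .
  qed
  finally show ?thesis .
qed

lemma nn_integral_powr_max_le: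
  fixes \<mu> l \<rho> :: real
  assumes "\<mu> > 0" "l > 0" "\<rho> > 0"
  shows "(\<integral>\<^sup>+t. ennreal (\<bar>t - s\<bar> powr (\<mu> - 1) * max \<rho> \<bar>t - s\<bar> powr (- (\<mu> + l))) \<partial>lborel)
     \<le> ennreal (2 * (1 / \<mu> + 1 / l) * \<rho> powr (- l))"
proof -
  have "(\<integral>\<^sup>+t. ennreal (\<bar>t - s\<bar> powr (\<mu> - 1) * max \<rho> \<bar>t - s\<bar> powr (- (\<mu> + l))) \<partial>lborel)
    \<le> 2 * ennreal ((1 / \<mu> + 1 / l) * \<rho> powr (- l))"
    by (rule order_trans[OF nn_integral_abs_shift_le mult_left_mono[OF nn_integral_powr_max_half_line[OF assms]]]) auto
  also have "\<dots> = ennreal (2 * (1 / \<mu> + 1 / l) * \<rho> powr (- l))"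
    unfolding mult.assoc[of 2] using ennreal_mult'[of 2 "(1 / \<mu> + 1 / l) * \<rho> powr (- l)"]
    by (simp only: ennreal_numeral zero_le_numeral)
  finally show ?thesis .
qed

text \<open>The exponent \<open>- \<nu>\<close> is forced by scaling, as two integrations add 2 to
  \<open>(\<mu> - 1) - (\<mu> + \<nu> + 1)\<close>. The estimate for powers of a maximum is used
  twice: in \<open>t\<close> with decay \<open>\<nu> + 1\<close>, then in \<open>s\<close> with
  \<mu> = 1 and decay \<open>\<nu>\<close>.\<close>

lemma energy_kernel_le:
  fixes \<mu> \<nu> u v :: real
  assumes \<mu>: "\<mu> > 0" and \<nu>: "\<nu> > 0" and uv: "u \<noteq> v"
  shows "(\<integral>\<^sup>+s. \<integral>\<^sup>+t. ennreal (\<bar>t - s\<bar> powr (\<mu> - 1) * max (max \<bar>u - s\<bar> \<bar>v - s\<bar>) \<bar>t - s\<bar> powr (- (\<mu> + \<nu> + 1))) \<partial>lborel \<partial>lborel)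
     \<le> ennreal (4 * (1 / \<mu> + 1 / (\<nu> + 1)) * (1 + 1 / \<nu>) * 2 powr \<nu> * \<bar>u - v\<bar> powr (- \<nu>))"
proof -
  \<comment> \<open>No \<open>s\<close> is closer than half of \<open>\<bar>u - v\<bar>\<close> to
    both \<open>u\<close> and \<open>v\<close>.\<close>
  define \<delta> where "\<delta> = \<bar>u - v\<bar> / 2"
  have \<delta>: "\<delta> > 0" using uv by (simp add: \<delta>_def)
  define c where "c = 2 * (1 / \<mu> + 1 / (\<nu> + 1))"
  have c: "c \<ge> 0" using \<mu> \<nu> by (simp add: c_def)
  have "(\<integral>\<^sup>+s. \<integral>\<^sup>+t. ennreal (\<bar>t - s\<bar> powr (\<mu> - 1) * max (max \<bar>u - s\<bar> \<bar>v - s\<bar>) \<bar>t - s\<bar> powr (- (\<mu> + \<nu> + 1))) \<partial>lborel \<partial>lborel)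
    \<le> (\<integral>\<^sup>+s. ennreal c * ennreal (\<bar>s - u\<bar> powr (1 - 1) * max \<delta> \<bar>s - u\<bar> powr (- (1 + \<nu>))) \<partial>lborel)"
  proof (rule nn_integral_mono_AE)
    \<comment> \<open>The factor with exponent \<open>1 - 1\<close> fits the integrand to the
      previous lemma. It is 1 except at \<open>s = u\<close>, where
      \<open>0 powr 0 = 0\<close>.\<close>
    have "AE s in lborel. s \<noteq> u" by (rule AE_lborel_singleton)
    then show "AE s in lborel. (\<integral>\<^sup>+t. ennreal (\<bar>t - s\<bar> powr (\<mu> - 1) * max (max \<bar>u - s\<bar> \<bar>v - s\<bar>) \<bar>t - s\<bar> powr (- (\<mu> + \<nu> + 1))) \<partial>lborel)
      \<le> ennreal c * ennreal (\<bar>s - u\<bar> powr (1 - 1) * max \<delta> \<bar>s - u\<bar> powr (- (1 + \<nu>)))"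
    proof (rule AE_mp, intro AE_I2 impI)
      fix s assume s: "s \<noteq> u"
      define \<rho> where "\<rho> = max \<bar>u - s\<bar> \<bar>v - s\<bar>"
      have le: "max \<delta> \<bar>s - u\<bar> \<le> \<rho>"
      proof -
        have "\<bar>u - v\<bar> \<le> \<bar>u - s\<bar> + \<bar>v - s\<bar>" by linarith
        moreover have "\<bar>u - s\<bar> \<le> \<rho>" "\<bar>v - s\<bar> \<le> \<rho>" by (simp_all add: \<rho>_def)
        ultimately show ?thesis by (simp add: \<delta>_def abs_minus_commute[of s u])
      qed
      have \<rho>: "\<rho> > 0" using le \<delta> by linarith
      have "(\<integral>\<^sup>+t. ennreal (\<bar>t - s\<bar> powr (\<mu> - 1) * max \<rho> \<bar>t - s\<bar> powr (- (\<mu> + \<nu> + 1))) \<partial>lborel)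
         \<le> ennreal (c * \<rho> powr (- (1 + \<nu>)))"
      proof -
        have e: "\<mu> + \<nu> + 1 = \<mu> + (\<nu> + 1)" "1 + \<nu> = \<nu> + 1" by simp_all
        have "\<nu> + 1 > 0" using \<nu> by simp
        then show ?thesis unfolding e c_def by (rule nn_integral_powr_max_le[OF \<mu> _ \<rho>])
      qed
      also have "\<dots> \<le> ennreal (c * max \<delta> \<bar>s - u\<bar> powr (- (1 + \<nu>)))"
        using le \<delta> \<nu> c by (intro ennreal_leI mult_left_mono powr_mono2') auto
      finally show "(\<integral>\<^sup>+t. ennreal (\<bar>t - s\<bar> powr (\<mu> - 1) * max (max \<bar>u - s\<bar> \<bar>v - s\<bar>) \<bar>t - s\<bar> powr (- (\<mu> + \<nu> + 1))) \<partial>lborel)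
      \<le> ennreal c * ennreal (\<bar>s - u\<bar> powr (1 - 1) * max \<delta> \<bar>s - u\<bar> powr (- (1 + \<nu>)))"
        unfolding \<rho>_def ennreal_mult'[OF c] using s by simp
    qed
  qed
  also have "\<dots> = ennreal c * (\<integral>\<^sup>+s. ennreal (\<bar>s - u\<bar> powr (1 - 1) * max \<delta> \<bar>s - u\<bar> powr (- (1 + \<nu>))) \<partial>lborel)"
    by (rule nn_integral_cmult) measurable
  also have "\<dots> \<le> ennreal c * ennreal (2 * (1 / 1 + 1 / \<nu>) * \<delta> powr (- \<nu>))"
    by (rule mult_left_mono[OF nn_integral_powr_max_le[OF zero_less_one \<nu> \<delta>]]) simp
  also have "\<dots> = ennreal (c * (2 * (1 / 1 + 1 / \<nu>) * \<delta> powr (- \<nu>)))"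
    by (rule ennreal_mult'[OF c, symmetric])
  also have "c * (2 * (1 / 1 + 1 / \<nu>) * \<delta> powr (- \<nu>))
     = 4 * (1 / \<mu> + 1 / (\<nu> + 1)) * (1 + 1 / \<nu>) * 2 powr \<nu> * \<bar>u - v\<bar> powr (- \<nu>)"
  proof -
    have \<delta>\<nu>: "\<delta> powr (- \<nu>) = 2 powr \<nu> * \<bar>u - v\<bar> powr (- \<nu>)"
      by (simp add: \<delta>_def powr_divide powr_minus_divide)
    have "2 * P * (2 * (1 / 1 + Q) * (D * E)) = 4 * P * (1 + Q) * D * E" for P Q D E :: real
      unfolding div_by_1 by algebra
    then show ?thesis unfolding c_def \<delta>\<nu> .
  qed
  finally show ?thesis .
qed

text \<open>Here \<open>x\<close> is the pair (s, t) and \<open>z\<close> the pair (u, v). The value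
  may be infinite; where it is, the pointwise estimate below becomes trivial.\<close>

definition energy_max :: "(real \<times> real \<Rightarrow> ennreal) \<Rightarrow> real \<Rightarrow> real \<times> real \<Rightarrow> ennreal" where
  "energy_max w \<theta> x = (\<integral>\<^sup>+z. w z *
     ennreal (max (max \<bar>fst z - fst x\<bar> \<bar>snd z - fst x\<bar>) \<bar>snd x - fst x\<bar> powr (- \<theta>)) \<partial>lborel)"

lemma borel_measurable_energy_kernel:
  "(\<lambda>x :: (real \<times> real) \<times> (real \<times> real).
      max (max \<bar>fst (snd x) - fst (fst x)\<bar> \<bar>snd (snd x) - fst (fst x)\<bar>) \<bar>snd (fst x) - fst (fst x)\<bar> powr r)
    \<in> borel_measurable borel"
  by (intro powr_real_measurable borel_measurable_continuous_onI continuous_intros)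

lemma borel_measurable_energy_integrand:
  fixes w :: "real \<times> real \<Rightarrow> ennreal"
  assumes "w \<in> borel_measurable borel"
  shows "(\<lambda>x :: (real \<times> real) \<times> (real \<times> real). w (snd x) *
      ennreal (max (max \<bar>fst (snd x) - fst (fst x)\<bar> \<bar>snd (snd x) - fst (fst x)\<bar>) \<bar>snd (fst x) - fst (fst x)\<bar> powr r))
    \<in> borel_measurable borel"
proof (rule borel_measurable_times_ennreal)
  have "(snd :: (real \<times> real) \<times> (real \<times> real) \<Rightarrow> _) \<in> borel_measurable borel"
    by (intro borel_measurable_continuous_onI continuous_intros)
  then show "(\<lambda>x :: (real \<times> real) \<times> (real \<times> real). w (snd x)) \<in> borel_measurable borel"
    by (rule measurable_compose) (rule assms)
qed (intro measurable_compose[OF borel_measurable_energy_kernel] measurable_ennreal)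

lemma borel_measurable_slice:
  assumes "f \<in> borel_measurable (borel :: ('a::second_countable_topology \<times> 'b::second_countable_topology) measure)"
  shows "(\<lambda>z. f (x, z)) \<in> borel_measurable borel" "(\<lambda>z. f (z, y)) \<in> borel_measurable borel"
  by (rule measurable_compose[OF _ assms], intro borel_measurable_continuous_onI continuous_intros)+

lemma borel_measurable_energy_max:
  assumes w: "w \<in> borel_measurable borel"
  shows "energy_max w \<theta> \<in> borel_measurable borel"
proof -
  have "(\<lambda>(x, z). w z * ennreal (max (max \<bar>fst z - fst x\<bar> \<bar>snd z - fst x\<bar>) \<bar>snd x - fst x\<bar> powr (- \<theta>)))
      \<in> borel_measurable (lborel \<Otimes>\<^sub>M lborel)"
    using borel_measurable_energy_integrand[OF w, of "- \<theta>"]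
    by (simp add: lborel_prod case_prod_unfold)
  then have "(\<lambda>x. \<integral>\<^sup>+z. w z * ennreal (max (max \<bar>fst z - fst x\<bar> \<bar>snd z - fst x\<bar>) \<bar>snd x - fst x\<bar> powr (- \<theta>)) \<partial>lborel)
     \<in> borel_measurable (lborel :: (real \<times> real) measure)"
    by (rule lborel.borel_measurable_nn_integral)
  then show ?thesis by (simp add: energy_max_def[abs_def])
qed

lemma energy_max_integral_le:
  fixes w :: "real \<times> real \<Rightarrow> ennreal"
  assumes \<mu>: "\<mu> > 0" and \<nu>: "\<nu> > 0" and w: "w \<in> borel_measurable borel" and diag: "\<And>u. w (u, u) = 0"
  shows "(\<integral>\<^sup>+x. ennreal (\<bar>snd x - fst x\<bar> powr (\<mu> - 1)) * energy_max w (\<mu> + \<nu> + 1) x \<partial>lborel)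
     \<le> ennreal (4 * (1 / \<mu> + 1 / (\<nu> + 1)) * (1 + 1 / \<nu>) * 2 powr \<nu>)
        * (\<integral>\<^sup>+z. w z * ennreal (\<bar>fst z - snd z\<bar> powr (- \<nu>)) \<partial>lborel)"
proof -
  define c where "c = 4 * (1 / \<mu> + 1 / (\<nu> + 1)) * (1 + 1 / \<nu>) * 2 powr \<nu>"
  have c: "c \<ge> 0" using \<mu> \<nu> by (simp add: c_def)
  define k where "k x z = \<bar>snd x - fst x\<bar> powr (\<mu> - 1) *
      max (max \<bar>fst z - fst x\<bar> \<bar>snd z - fst x\<bar>) \<bar>snd x - fst x\<bar> powr (- (\<mu> + \<nu> + 1))" for x z :: "real \<times> real"
  note m = borel_measurable_energy_integrand[OF w, of "- (\<mu> + \<nu> + 1)"]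
  have dm: "(\<lambda>x :: real \<times> real. ennreal (\<bar>snd x - fst x\<bar> powr r)) \<in> borel_measurable borel" for r
    by (intro measurable_compose[OF _ measurable_ennreal] powr_real_measurable borel_measurable_continuous_onI continuous_intros)
  have km: "(\<lambda>x. ennreal (k (fst x) (snd x))) \<in> borel_measurable borel"
    unfolding k_def
    by (intro measurable_compose[OF _ measurable_ennreal] borel_measurable_times borel_measurable_energy_kernel
         powr_real_measurable borel_measurable_continuous_onI continuous_intros)
  have wkm: "(\<lambda>x. w (snd x) * ennreal (k (fst x) (snd x))) \<in> borel_measurable borel"
    by (intro borel_measurable_times_ennreal km measurable_compose[OF _ w] borel_measurable_continuous_onI continuous_intros)
  have "(\<integral>\<^sup>+x. ennreal (\<bar>snd x - fst x\<bar> powr (\<mu> - 1)) * energy_max w (\<mu> + \<nu> + 1) x \<partial>lborel)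
     = (\<integral>\<^sup>+x. \<integral>\<^sup>+z. w z * ennreal (k x z) \<partial>lborel \<partial>lborel)"
  proof (rule nn_integral_cong)
    fix x :: "real \<times> real"
    have "ennreal (\<bar>snd x - fst x\<bar> powr (\<mu> - 1)) * energy_max w (\<mu> + \<nu> + 1) x
      = (\<integral>\<^sup>+z. ennreal (\<bar>snd x - fst x\<bar> powr (\<mu> - 1)) * (w z * ennreal (max (max \<bar>fst z - fst x\<bar> \<bar>snd z - fst x\<bar>) \<bar>snd x - fst x\<bar> powr (- (\<mu> + \<nu> + 1)))) \<partial>lborel)"
      unfolding energy_max_def using borel_measurable_slice(1)[OF m, of x] by (intro nn_integral_cmult[symmetric]) simp
    also have "\<dots> = (\<integral>\<^sup>+z. w z * ennreal (k x z) \<partial>lborel)"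
      by (intro nn_integral_cong) (simp add: k_def ennreal_mult mult_ac)
    finally show "ennreal (\<bar>snd x - fst x\<bar> powr (\<mu> - 1)) * energy_max w (\<mu> + \<nu> + 1) x = (\<integral>\<^sup>+z. w z * ennreal (k x z) \<partial>lborel)" .
  qed
  also have "\<dots> = (\<integral>\<^sup>+z. \<integral>\<^sup>+x. w z * ennreal (k x z) \<partial>lborel \<partial>lborel)"
  proof (rule lborel_pair.Fubini'[symmetric])
    show "(\<lambda>(x, z). w z * ennreal (k x z)) \<in> borel_measurable (lborel \<Otimes>\<^sub>M lborel)"
      using wkm by (simp add: lborel_prod case_prod_unfold)
  qed
  also have "\<dots> \<le> (\<integral>\<^sup>+z. ennreal c * (w z * ennreal (\<bar>fst z - snd z\<bar> powr (- \<nu>))) \<partial>lborel)"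
  proof (rule nn_integral_mono)
    fix z :: "real \<times> real"
    obtain u v where z: "z = (u, v)" by (cases z)
    show "(\<integral>\<^sup>+x. w z * ennreal (k x z) \<partial>lborel) \<le> ennreal c * (w z * ennreal (\<bar>fst z - snd z\<bar> powr (- \<nu>)))"
    proof (cases "u = v")
      case True
      then show ?thesis by (simp add: z diag)
    next
      case False
      have kz: "(\<lambda>x. ennreal (k x z)) \<in> borel_measurable borel"
        using borel_measurable_slice(2)[OF km, of z] by simp
      have "(\<integral>\<^sup>+x. ennreal (k x z) \<partial>lborel) = (\<integral>\<^sup>+s. \<integral>\<^sup>+t. ennreal (k (s, t) z) \<partial>lborel \<partial>lborel)"
        using lborel.nn_integral_fst[of "\<lambda>x. ennreal (k x z)" lborel] kz by (simp add: lborel_prod)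
      also have "\<dots> \<le> ennreal (c * \<bar>u - v\<bar> powr (- \<nu>))"
        using energy_kernel_le[OF \<mu> \<nu> False] by (simp add: k_def c_def z)
      finally have "(\<integral>\<^sup>+x. ennreal (k x z) \<partial>lborel) \<le> ennreal (c * \<bar>u - v\<bar> powr (- \<nu>))" .
      then have "w z * (\<integral>\<^sup>+x. ennreal (k x z) \<partial>lborel) \<le> w z * (ennreal c * ennreal (\<bar>u - v\<bar> powr (- \<nu>)))"
        using c by (intro mult_left_mono) (auto simp: ennreal_mult)
      moreover have "(\<integral>\<^sup>+x. w z * ennreal (k x z) \<partial>lborel) = w z * (\<integral>\<^sup>+x. ennreal (k x z) \<partial>lborel)"
        using kz by (intro nn_integral_cmult) simp
      ultimately show ?thesis by (simp add: z mult_ac)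
    qed
  qed
  also have "\<dots> = ennreal c * (\<integral>\<^sup>+z. w z * ennreal (\<bar>fst z - snd z\<bar> powr (- \<nu>)) \<partial>lborel)"
  proof (rule nn_integral_cmult)
    have "(\<lambda>z :: real \<times> real. ennreal (\<bar>fst z - snd z\<bar> powr (- \<nu>))) \<in> borel_measurable borel"
      using dm[of "- \<nu>"] by (simp add: abs_minus_commute)
    then show "(\<lambda>z. w z * ennreal (\<bar>fst z - snd z\<bar> powr (- \<nu>))) \<in> borel_measurable lborel"
      using w by simp
  qed
  finally show ?thesis by (simp add: c_def)
qed


section \<open>Lifts\<close>

text \<open>The lift takes its area from the antisymmetric part of \<open>H\<close>, and the rest of
  the second level is the tensor square of \<open>X\<close> halved. Errors are measured as
  \<open>M\<^sup>2\<close> because \<open>cc_norm\<close> sees the square root of the area.\<close>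

lemma rough_lift_from_areas:
  fixes X :: "real \<Rightarrow> real ^ 'd::finite" and H :: "'d \<Rightarrow> 'd \<Rightarrow> real \<Rightarrow> real"
  assumes T: "T > 0" and X: "continuous_on {0..T} X" and H: "\<And>i j. continuous_on {0..T} (H i j)"
  obtains Y C where "Y ` {0..T} \<subseteq> G2" "continuous_on {0..T} Y" "rough_path_lift T X Y" "C \<ge> 0"
    "\<And>s t M. s \<in> {0..T} \<Longrightarrow> t \<in> {0..T} \<Longrightarrow> M \<ge> 0 \<Longrightarrow>
       (\<And>i j. \<bar>H i j t - H i j s - X s $ i * (X t $ j - X s $ j)\<bar> \<le> M\<^sup>2) \<Longrightarrow>
       0 \<le> cc_dist (Y s) (Y t) \<and> cc_dist (Y s) (Y t) \<le> C * (dist (X s) (X t) + M)"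
proof -
  obtain C0 where C0: "C0 \<ge> 0" and cc:
    "\<And>(x :: real ^ 'd) B. (\<And>i j. B $ j $ i = - B $ i $ j) \<Longrightarrow>
       (1, x, \<chi> i j. x $ i * x $ j / 2 + B $ i $ j) \<in> G2 \<and>
       cc_norm (1, x, \<chi> i j. x $ i * x $ j / 2 + B $ i $ j) \<le> C0 * (norm x + (\<Sum>i\<in>UNIV. \<Sum>j\<in>UNIV. sqrt \<bar>B $ i $ j\<bar>))"
    using cc_norm_bound by blast
  define A :: "real \<Rightarrow> real ^ 'd ^ 'd" where "A t = (\<chi> i j. X t $ i * X t $ j / 2 + (H i j t - H j i t) / 2)" for t
  define Y :: "real \<Rightarrow> 'd tensor2" where "Y t = (1, X t, A t)" for t
  define N where "N = real CARD('d) * real CARD('d)"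
  \<comment> \<open>The area of the increment is exactly the antisymmetrised sewing error; this is
    what makes a bound for the error sufficient.\<close>
  define B where "B s t = (\<chi> i j. ((H i j t - H i j s - X s $ i * (X t $ j - X s $ j))
      - (H j i t - H j i s - X s $ j * (X t $ i - X s $ i))) / 2)" for s t :: real
  have inc: "tensor_inv (Y s) \<otimes>\<^sub>T Y t = (1, X t - X s, \<chi> i j. (X t - X s) $ i * (X t - X s) $ j / 2 + B s t $ i $ j)" for s t
  proof -
    have "A t + vec_tensor (- X s) (X t) + (vec_tensor (X s) (X s) - A s)
        = (\<chi> i j. (X t - X s) $ i * (X t - X s) $ j / 2 + B s t $ i $ j)"
    proof (intro vec_eq_iff[THEN iffD2] allI)
      fix i j
      show "(A t + vec_tensor (- X s) (X t) + (vec_tensor (X s) (X s) - A s)) $ i $ j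
        = (\<chi> i j. (X t - X s) $ i * (X t - X s) $ j / 2 + B s t $ i $ j) $ i $ j"
        by (simp add: A_def B_def vec_tensor_def) (simp add: algebra_simps add_divide_distrib diff_divide_distrib)
    qed
    then show ?thesis by (simp add: Y_def tensor_inv_eq tensor_mult_def)
  qed
  show thesis
  proof (rule that[of Y "C0 * (1 + N)"])
    show "Y ` {0..T} \<subseteq> G2"
    proof
      fix y assume "y \<in> Y ` {0..T}"
      then obtain t where t: "y = Y t" by blast
      have "Y t = (1, X t, \<chi> i j. X t $ i * X t $ j / 2 + (\<chi> i j. (H i j t - H j i t) / 2) $ i $ j)"
        by (simp add: Y_def A_def)
      then show "y \<in> G2" unfolding t using cc[of "\<chi> i j. (H i j t - H j i t) / 2" "X t"]
        by (simp add: field_simps)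
    qed
    show "continuous_on {0..T} Y"
      unfolding Y_def A_def by (intro continuous_intros X H) auto
    show "rough_path_lift T X Y"
      by (simp add: rough_path_lift_def inc)
    show "C0 * (1 + N) \<ge> 0" using C0 by (simp add: N_def)
    fix s t M assume s: "s \<in> {0..T}" and t: "t \<in> {0..T}" and M: "M \<ge> 0"
      and bd: "\<And>i j. \<bar>H i j t - H i j s - X s $ i * (X t $ j - X s $ j)\<bar> \<le> M\<^sup>2"
    have anti: "B s t $ j $ i = - B s t $ i $ j" for i j by (simp add: B_def field_simps)
    have "sqrt \<bar>B s t $ i $ j\<bar> \<le> M" for i j
    proof -
      have "\<bar>B s t $ i $ j\<bar> \<le> M\<^sup>2"
      proof -
        have "\<bar>(x - y) / 2\<bar> \<le> m" if "\<bar>x\<bar> \<le> m" "\<bar>y\<bar> \<le> m" for x y m :: real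
        proof -
          have "\<bar>x - y\<bar> \<le> 2 * m" using that by linarith
          then show ?thesis by simp
        qed
        then show ?thesis unfolding B_def vec_lambda_beta using bd by blast
      qed
      then have "sqrt \<bar>B s t $ i $ j\<bar> \<le> sqrt (M\<^sup>2)" by (rule real_sqrt_le_mono)
      then show ?thesis using M by simp
    qed
    then have "(\<Sum>i\<in>(UNIV::'d set). \<Sum>j\<in>(UNIV::'d set). sqrt \<bar>B s t $ i $ j\<bar>) \<le> (\<Sum>i\<in>(UNIV::'d set). \<Sum>j\<in>(UNIV::'d set). M)"
      by (intro sum_mono)
    then have sum: "(\<Sum>i\<in>UNIV. \<Sum>j\<in>UNIV. sqrt \<bar>B s t $ i $ j\<bar>) \<le> N * M"
      by (simp add: N_def mult.assoc)
    have G: "tensor_inv (Y s) \<otimes>\<^sub>T Y t \<in> G2" unfolding inc using cc[OF anti] by blast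
    have "cc_dist (Y s) (Y t) \<le> C0 * (norm (X t - X s) + (\<Sum>i\<in>UNIV. \<Sum>j\<in>UNIV. sqrt \<bar>B s t $ i $ j\<bar>))"
      unfolding cc_dist_def inc using cc[OF anti] by blast
    also have "\<dots> \<le> C0 * (1 * norm (X t - X s) + N * M)" using C0 sum by (intro mult_left_mono) auto
    also have "\<dots> \<le> C0 * ((1 + N) * (dist (X s) (X t) + M))"
    proof (rule mult_left_mono[OF _ C0])
      have "0 \<le> N * dist (X s) (X t) + M" using M by (simp add: N_def)
      then show "1 * norm (X t - X s) + N * M \<le> (1 + N) * (dist (X s) (X t) + M)"
        by (simp add: dist_norm norm_minus_commute algebra_simps)
    qed
    finally show "0 \<le> cc_dist (Y s) (Y t) \<and> cc_dist (Y s) (Y t) \<le> C0 * (1 + N) * (dist (X s) (X t) + M)"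
      using cc_norm_nonneg[OF G] by (simp add: cc_dist_def mult.assoc)
  qed
qed

text \<open>Each pair of coordinates is sewn separately. The error is quadratic in \<open>k\<close>,
  so the square root in the distance restores linearity in \<open>k\<close> and turns the exponent
  \<open>2 * (a + b)\<close> into \<open>a + b\<close>.\<close>

lemma rough_lift_exists:
  fixes X :: "real \<Rightarrow> real ^ 'd::finite"
  assumes T: "T > 0" and X: "continuous_on {0..T} X"
    and \<gamma>: "\<gamma> > 0" and L: "L \<ge> 0"
    and holder: "\<And>i x y. x \<in> {0..T} \<Longrightarrow> y \<in> {0..T} \<Longrightarrow> \<bar>X x $ i - X y $ i\<bar> \<le> L * \<bar>x - y\<bar> powr \<gamma>"
    and a: "a > 0" and b: "b \<ge> 0" and ab: "2 * (a + b) < 1"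
  obtains Y C where "Y ` {0..T} \<subseteq> G2" "continuous_on {0..T} Y" "rough_path_lift T X Y" "C \<ge> 0"
    "\<And>s t k. s \<in> {0..T} \<Longrightarrow> t \<in> {0..T} \<Longrightarrow> s \<noteq> t \<Longrightarrow> k \<ge> 0 \<Longrightarrow>
       (\<And>i x y. x \<in> {0..T} \<Longrightarrow> y \<in> {0..T} \<Longrightarrow>
          \<bar>X x $ i - X y $ i\<bar> \<le> k * \<bar>x - y\<bar> powr a * max (max \<bar>x - s\<bar> \<bar>y - s\<bar>) \<bar>t - s\<bar> powr b) \<Longrightarrow>
       0 \<le> cc_dist (Y s) (Y t) \<and> cc_dist (Y s) (Y t) \<le> C * (dist (X s) (X t) + k * \<bar>t - s\<bar> powr (a + b))"
proof -
  have cX: "continuous_on {0..T} (\<lambda>t. X t $ i)" for i using X by (intro continuous_intros)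
  \<comment> \<open>An object-level predicate, so that \<open>h\<close> and \<open>C\<close> can be
    chosen as functions of (i, j).\<close>
  define P where "P i j h C \<longleftrightarrow> continuous_on {0..T} h \<and> C \<ge> 0 \<and>
    (\<forall>s t k. s \<in> {0..T} \<longrightarrow> t \<in> {0..T} \<longrightarrow> s \<noteq> t \<longrightarrow> k \<ge> 0 \<longrightarrow>
       (\<forall>i x y. x \<in> {0..T} \<longrightarrow> y \<in> {0..T} \<longrightarrow>
          \<bar>X x $ i - X y $ i\<bar> \<le> k * \<bar>x - y\<bar> powr a * max (max \<bar>x - s\<bar> \<bar>y - s\<bar>) \<bar>t - s\<bar> powr b) \<longrightarrow>
       \<bar>h t - h s - X s $ i * (X t $ j - X s $ j)\<bar> \<le> C * k\<^sup>2 * \<bar>t - s\<bar> powr (2 * (a + b)))" for i j h C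
  have "\<exists>h C. P i j h C" for i j
  proof (rule sewing[OF T cX[of i] cX[of j] \<gamma> L _ a b ab])
    show "\<bar>X x $ j - X y $ j\<bar> \<le> L * \<bar>x - y\<bar> powr \<gamma>" if "x \<in> {0..T}" "y \<in> {0..T}" for x y
      by (rule holder[OF that])
    fix h C
    assume h: "continuous_on {0..T} h" "C \<ge> 0" and *:
      "\<And>s t k. s \<in> {0..T} \<Longrightarrow> t \<in> {0..T} \<Longrightarrow> s \<noteq> t \<Longrightarrow> k \<ge> 0 \<Longrightarrow>
       (\<And>x y. x \<in> {0..T} \<Longrightarrow> y \<in> {0..T} \<Longrightarrow>
          \<bar>X x $ i - X y $ i\<bar> \<le> k * \<bar>x - y\<bar> powr a * max (max \<bar>x - s\<bar> \<bar>y - s\<bar>) \<bar>t - s\<bar> powr b) \<Longrightarrow>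
       (\<And>x y. x \<in> {0..T} \<Longrightarrow> y \<in> {0..T} \<Longrightarrow>
          \<bar>X x $ j - X y $ j\<bar> \<le> k * \<bar>x - y\<bar> powr a * max (max \<bar>x - s\<bar> \<bar>y - s\<bar>) \<bar>t - s\<bar> powr b) \<Longrightarrow>
       \<bar>h t - h s - X s $ i * (X t $ j - X s $ j)\<bar> \<le> C * k\<^sup>2 * \<bar>t - s\<bar> powr (2 * (a + b))"
    show ?thesis
      unfolding P_def
    proof (intro exI[of _ h] exI[of _ C] conjI h allI impI)
      fix s t k assume "s \<in> {0..T}" "t \<in> {0..T}" "s \<noteq> t" "k \<ge> 0"
        "\<forall>i x y. x \<in> {0..T} \<longrightarrow> y \<in> {0..T} \<longrightarrow>
          \<bar>X x $ i - X y $ i\<bar> \<le> k * \<bar>x - y\<bar> powr a * max (max \<bar>x - s\<bar> \<bar>y - s\<bar>) \<bar>t - s\<bar> powr b"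
      then show "\<bar>h t - h s - X s $ i * (X t $ j - X s $ j)\<bar> \<le> C * k\<^sup>2 * \<bar>t - s\<bar> powr (2 * (a + b))"
        by (intro *) blast+
    qed
  qed
  then obtain H C where P: "\<And>i j. P i j (H i j) (C i j)" by metis
  have H: "continuous_on {0..T} (H i j)" and C: "C i j \<ge> 0" for i j using P[of i j] by (simp_all add: P_def)
  define C' where "C' = (\<Sum>i\<in>UNIV. \<Sum>j\<in>UNIV. C i j)"
  have CC': "C i j \<le> C'" for i j
  proof -
    have "C i j \<le> (\<Sum>j\<in>UNIV. C i j)" using C by (intro member_le_sum) auto
    also have "\<dots> \<le> C'" unfolding C'_def
      using C by (intro member_le_sum[of i UNIV "\<lambda>i. \<Sum>j\<in>UNIV. C i j"]) (auto intro!: sum_nonneg)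
    finally show ?thesis .
  qed
  have C'0: "C' \<ge> 0" using C by (simp add: C'_def sum_nonneg)
  show thesis
  proof (rule rough_lift_from_areas[OF T X H])
    fix Y D assume Y: "Y ` {0..T} \<subseteq> G2" "continuous_on {0..T} Y" "rough_path_lift T X Y" and D: "D \<ge> 0" and
    dist: "\<And>s t M. s \<in> {0..T} \<Longrightarrow> t \<in> {0..T} \<Longrightarrow> M \<ge> 0 \<Longrightarrow>
       (\<And>i j. \<bar>H i j t - H i j s - X s $ i * (X t $ j - X s $ j)\<bar> \<le> M\<^sup>2) \<Longrightarrow>
       0 \<le> cc_dist (Y s) (Y t) \<and> cc_dist (Y s) (Y t) \<le> D * (dist (X s) (X t) + M)"
  show thesis
  proof (rule that[OF Y, of "D * (1 + sqrt C')"])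
    show "0 \<le> D * (1 + sqrt C')" using D C'0 by simp
    fix s t k assume s: "s \<in> {0..T}" and t: "t \<in> {0..T}" and st: "s \<noteq> t" and k: "k \<ge> 0"
      and k': "\<And>i x y. x \<in> {0..T} \<Longrightarrow> y \<in> {0..T} \<Longrightarrow>
          \<bar>X x $ i - X y $ i\<bar> \<le> k * \<bar>x - y\<bar> powr a * max (max \<bar>x - s\<bar> \<bar>y - s\<bar>) \<bar>t - s\<bar> powr b"
    define Q where "Q = k * \<bar>t - s\<bar> powr (a + b)"
    have Q: "Q \<ge> 0" using k by (simp add: Q_def)
    have sq: "(sqrt C' * Q)\<^sup>2 = C' * k\<^sup>2 * \<bar>t - s\<bar> powr (2 * (a + b))"
    proof -
      have "(\<bar>t - s\<bar> powr (a + b))\<^sup>2 = \<bar>t - s\<bar> powr (2 * (a + b))"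
        unfolding power2_eq_square powr_add[symmetric] by (simp add: algebra_simps)
      then show ?thesis using C'0 by (simp add: Q_def power_mult_distrib mult.assoc)
    qed
    have "\<bar>H i j t - H i j s - X s $ i * (X t $ j - X s $ j)\<bar> \<le> (sqrt C' * Q)\<^sup>2" for i j
    proof -
      have "\<bar>H i j t - H i j s - X s $ i * (X t $ j - X s $ j)\<bar> \<le> C i j * k\<^sup>2 * \<bar>t - s\<bar> powr (2 * (a + b))"
        using P[of i j, unfolded P_def, THEN conjunct2, THEN conjunct2, rule_format, OF s t st k] k' by blast
      also have "\<dots> \<le> C' * k\<^sup>2 * \<bar>t - s\<bar> powr (2 * (a + b))"
        by (intro mult_right_mono CC') auto
      finally show ?thesis unfolding sq .
    qed
    then have *: "0 \<le> cc_dist (Y s) (Y t) \<and> cc_dist (Y s) (Y t) \<le> D * (dist (X s) (X t) + sqrt C' * Q)"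
      using Q C'0 by (intro dist[OF s t]) auto
    have "dist (X s) (X t) + sqrt C' * Q \<le> (1 + sqrt C') * (dist (X s) (X t) + Q)"
      using Q C'0 by (simp add: algebra_simps)
    then have "D * (dist (X s) (X t) + sqrt C' * Q) \<le> D * ((1 + sqrt C') * (dist (X s) (X t) + Q))"
      using D by (rule mult_left_mono)
    then show "0 \<le> cc_dist (Y s) (Y t) \<and> cc_dist (Y s) (Y t) \<le> D * (1 + sqrt C') * (dist (X s) (X t) + k * \<bar>t - s\<bar> powr (a + b))"
      using * by (simp add: Q_def mult.assoc)
  qed
  qed
qed


section \<open>Sobolev regularity\<close>

text \<open>The integrand of the seminorm, extended by 0 to the plane. The exponent \<open>r\<close>
  of the denominator is free, so that the original energy and the weaker one of order \<alpha>' are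
  both instances.\<close>

definition sobolev_density :: "real \<Rightarrow> (real \<Rightarrow> 'a::metric_space) \<Rightarrow> real \<Rightarrow> real \<Rightarrow> real \<times> real \<Rightarrow> ennreal" where
  "sobolev_density T X q r z = indicator ({0..T} \<times> {0..T}) z *
     ennreal (dist (X (fst z)) (X (snd z)) powr q / \<bar>snd z - fst z\<bar> powr r)"

lemma borel_measurable_sobolev_density:
  fixes X :: "real \<Rightarrow> 'a::metric_space"
  assumes T: "T > 0" and X: "continuous_on {0..T} X"
  shows "sobolev_density T X q r \<in> borel_measurable borel"
proof -
  \<comment> \<open>\<open>X\<close> is arbitrary outside [0,T]. Clamping the time makes the path
    continuous on the line without changing the density.\<close>
  define c where "c t = max 0 (min T t)" for t
  have c: "continuous_on UNIV c" unfolding c_def by (intro continuous_intros)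
  have Xc: "continuous_on UNIV (\<lambda>t. X (c t))"
    by (rule continuous_on_compose2[OF X c]) (use T in \<open>auto simp: c_def\<close>)
  have Xcz: "continuous_on UNIV (\<lambda>z :: real \<times> real. X (c (fst z)))" "continuous_on UNIV (\<lambda>z :: real \<times> real. X (c (snd z)))"
    by (auto intro!: continuous_on_compose2[OF Xc] continuous_intros)
  have eq: "sobolev_density T X q r = (\<lambda>z. indicator ({0..T} \<times> {0..T}) z *
     ennreal (dist (X (c (fst z))) (X (c (snd z))) powr q / \<bar>snd z - fst z\<bar> powr r))"
    by (auto simp: sobolev_density_def fun_eq_iff indicator_def c_def)
  have 1: "(\<lambda>z. dist (X (c (fst z))) (X (c (snd z))) powr q) \<in> borel_measurable borel"
    by (intro powr_real_measurable borel_measurable_continuous_onI continuous_intros Xcz)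
  have 2: "(\<lambda>z :: real \<times> real. \<bar>snd z - fst z\<bar> powr r) \<in> borel_measurable borel"
    by (intro powr_real_measurable borel_measurable_continuous_onI continuous_intros)
  have 3: "indicator ({0..T} \<times> {0..T}) \<in> borel_measurable (borel :: (real \<times> real) measure)"
    by (intro borel_measurable_indicator borel_closed closed_Times) auto
  show ?thesis unfolding eq
    by (intro borel_measurable_times_ennreal 3 measurable_compose[OF _ measurable_ennreal] borel_measurable_divide 1 2)
qed

lemma sobolev_density_diag [simp]: "sobolev_density T X q r (u, u) = 0"
  by (simp add: sobolev_density_def)

lemma sobolev_density_times_powr:
  "sobolev_density T X q r z * ennreal (\<bar>fst z - snd z\<bar> powr (- \<nu>)) = sobolev_density T X q (r + \<nu>) z"
proof -
  have "dist (X (fst z)) (X (snd z)) powr q / \<bar>snd z - fst z\<bar> powr r * \<bar>fst z - snd z\<bar> powr (- \<nu>)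
      = dist (X (fst z)) (X (snd z)) powr q / \<bar>snd z - fst z\<bar> powr (r + \<nu>)"
    by (simp add: powr_add powr_minus abs_minus_commute divide_inverse mult.assoc)
  then show ?thesis by (simp add: sobolev_density_def mult.assoc ennreal_mult[symmetric])
qed

lemma sobolev_density_holder:
  fixes X :: "real \<Rightarrow> real ^ 'd::finite"
  assumes T: "T > 0" and X: "continuous_on {0..T} X" and q: "q > 1" and \<sigma>: "\<sigma> > 0"
    and xy: "x \<in> {0..T}" "y \<in> {0..T}" "x < y" and W: "W \<ge> 0"
    and le: "(\<integral>\<^sup>+z. indicator ({x..y} \<times> {x..y}) z * sobolev_density T X q (\<sigma> * q + 2) z \<partial>lborel) \<le> ennreal W"
  shows "\<bar>X x $ i - X y $ i\<bar> \<le> 6 / (1 - (1/2) powr \<sigma>) * (y - x) powr \<sigma> * W powr (1 / q)"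
proof (rule energy_holder[OF xy(3) _ q \<sigma> W borel_measurable_sobolev_density[OF T X] _ le])
  have "continuous_on {x..y} X" using X xy by (auto intro: continuous_on_subset)
  then show "continuous_on {x..y} (\<lambda>t. X t $ i)" by (intro continuous_intros)
  fix v z assume vz: "v \<in> {x..y}" "z \<in> {x..y}"
  have "\<bar>X v $ i - X z $ i\<bar> \<le> dist (X v) (X z)"
    using component_le_norm_cart[of "X v - X z" i] by (simp add: dist_norm)
  then have 1: "\<bar>X v $ i - X z $ i\<bar> powr q \<le> dist (X v) (X z) powr q"
    using q by (intro powr_mono2) auto
  show "ennreal (\<bar>X v $ i - X z $ i\<bar> powr q) \<le> ennreal (\<bar>v - z\<bar> powr (\<sigma> * q + 2)) * sobolev_density T X q (\<sigma> * q + 2) (v, z)"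
  proof (cases "v = z")
    case False
    have "(v, z) \<in> {0..T} \<times> {0..T}" using vz xy by auto
    then have "ennreal (\<bar>v - z\<bar> powr (\<sigma> * q + 2)) * sobolev_density T X q (\<sigma> * q + 2) (v, z) = ennreal (dist (X v) (X z) powr q)"
      using False by (simp add: sobolev_density_def ennreal_mult[symmetric] abs_minus_commute)
    then show ?thesis using 1 by (simp add: ennreal_leI)
  qed simp
qed

text \<open>With \<open>R\<close> the maximum in the conclusion, the weight in
  \<open>energy_max\<close> is at least \<open>R powr (- \<theta>)\<close> on the square over the
  interval between \<open>x\<close> and \<open>y\<close>. So the local energy is at most
  \<open>R powr \<theta> * \<Phi>\<close>, and its q-th root yields the hypothesis of
  \<open>sewing\<close> with exponents \<open>\<sigma>\<close> and
  \<open>\<theta> / q\<close>.\<close>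

lemma sobolev_density_local_holder:
  fixes X :: "real \<Rightarrow> real ^ 'd::finite"
  assumes T: "T > 0" and X: "continuous_on {0..T} X" and q: "q > 1" and \<sigma>: "\<sigma> > 0" and \<theta>: "\<theta> > 0"
    and xy: "x \<in> {0..T}" "y \<in> {0..T}" and st: "s \<noteq> t"
    and fin: "energy_max (sobolev_density T X q (\<sigma> * q + 2)) \<theta> (s, t) = ennreal \<Phi>" and \<Phi>: "\<Phi> \<ge> 0"
  shows "\<bar>X x $ i - X y $ i\<bar> \<le> (6 / (1 - (1/2) powr \<sigma>) * \<Phi> powr (1 / q)) * \<bar>x - y\<bar> powr \<sigma>
      * max (max \<bar>x - s\<bar> \<bar>y - s\<bar>) \<bar>t - s\<bar> powr (\<theta> / q)"
proof -
  let ?w = "sobolev_density T X q (\<sigma> * q + 2)"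
  have main: "\<bar>X x $ i - X y $ i\<bar> \<le> (6 / (1 - (1/2) powr \<sigma>) * \<Phi> powr (1 / q)) * \<bar>x - y\<bar> powr \<sigma>
      * max (max \<bar>x - s\<bar> \<bar>y - s\<bar>) \<bar>t - s\<bar> powr (\<theta> / q)" if xy: "x \<in> {0..T}" "y \<in> {0..T}" "x < y" for x y
  proof -
    define R where "R = max (max \<bar>x - s\<bar> \<bar>y - s\<bar>) \<bar>t - s\<bar>"
    have R: "R > 0" using st by (auto simp: R_def less_max_iff_disj)
    let ?m = "\<lambda>z. max (max \<bar>fst z - s\<bar> \<bar>snd z - s\<bar>) \<bar>t - s\<bar>"
    have "(\<integral>\<^sup>+z. indicator ({x..y} \<times> {x..y}) z * ?w z \<partial>lborel)
       \<le> (\<integral>\<^sup>+z. ennreal (R powr \<theta>) * (?w z * ennreal (?m z powr (- \<theta>))) \<partial>lborel)"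
    proof (rule nn_integral_mono)
      fix z :: "real \<times> real"
      show "indicator ({x..y} \<times> {x..y}) z * ?w z \<le> ennreal (R powr \<theta>) * (?w z * ennreal (?m z powr (- \<theta>)))"
      proof (cases "z \<in> {x..y} \<times> {x..y}")
        case True
        have m0: "?m z > 0" using st by (auto simp: less_max_iff_disj)
        have "x \<le> fst z" "fst z \<le> y" "x \<le> snd z" "snd z \<le> y" using True by (auto simp: mem_Times_iff)
        moreover have "\<bar>v - s\<bar> \<le> max \<bar>x - s\<bar> \<bar>y - s\<bar>" if "x \<le> v" "v \<le> y" for v using that by (simp add: le_max_iff_disj) linarith
        ultimately have "?m z \<le> R" by (auto simp: R_def max.coboundedI1)
        then have "?m z powr \<theta> \<le> R powr \<theta>" using m0 \<theta> by (intro powr_mono2) auto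
        then have "1 \<le> R powr \<theta> * ?m z powr (- \<theta>)"
          using m0 by (simp add: powr_minus divide_inverse[symmetric])
        then have "ennreal 1 \<le> ennreal (R powr \<theta> * ?m z powr (- \<theta>))" by (rule ennreal_leI)
        then have "1 * ?w z \<le> ennreal (R powr \<theta> * ?m z powr (- \<theta>)) * ?w z"
          by (intro mult_right_mono) auto
        then show ?thesis using True by (simp add: ennreal_mult mult_ac)
      qed simp
    qed
    also have "\<dots> = ennreal (R powr \<theta>) * energy_max ?w \<theta> (s, t)"
      unfolding energy_max_def
      using borel_measurable_slice(1)[OF borel_measurable_energy_integrand[OF borel_measurable_sobolev_density[OF T X], of q "\<sigma> * q + 2" "- \<theta>"], of "(s, t)"]
      by (intro nn_integral_cmult[THEN trans]) auto
    also have "\<dots> = ennreal (R powr \<theta> * \<Phi>)" using \<Phi> by (simp add: fin ennreal_mult)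
    finally have "\<bar>X x $ i - X y $ i\<bar> \<le> 6 / (1 - (1/2) powr \<sigma>) * (y - x) powr \<sigma> * (R powr \<theta> * \<Phi>) powr (1 / q)"
      using \<Phi> by (intro sobolev_density_holder[OF T X q \<sigma> xy]) auto
    also have "(R powr \<theta> * \<Phi>) powr (1 / q) = R powr (\<theta> / q) * \<Phi> powr (1 / q)"
      using \<Phi> by (simp add: powr_mult powr_powr)
    finally show ?thesis using xy by (simp add: R_def mult_ac)
  qed
  show ?thesis
  proof (cases x y rule: linorder_cases)
    case less
    then show ?thesis using main xy by blast
  next
    case equal
    then show ?thesis by simp
  next
    case greater
    then show ?thesis using main[OF xy(2) xy(1)]
      by (simp only: abs_minus_commute[of "X y $ i"] abs_minus_commute[of y x] max.commute[of "\<bar>y - s\<bar>"])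
  qed
qed

lemma ennreal_powr_less_top_iff: "ennreal_powr x r < \<infinity> \<longleftrightarrow> x < \<infinity>"
  by (auto simp: ennreal_powr_def less_top)

lemma powr_add_le:
  fixes x y q :: real
  assumes "x \<ge> 0" "y \<ge> 0" "q \<ge> 0"
  shows "(x + y) powr q \<le> 2 powr q * (x powr q + y powr q)"
proof -
  have "(x + y) powr q \<le> (2 * max x y) powr q" using assms by (intro powr_mono2) auto
  also have "\<dots> = 2 powr q * max x y powr q" using assms by (simp add: powr_mult)
  also have "\<dots> \<le> 2 powr q * (x powr q + y powr q)"
    by (intro mult_left_mono) (auto simp: max_def)
  finally show ?thesis .
qed

text \<open>Here the global Hoelder constant serves as \<open>k\<close> for all pairs of times, with
  weight exponent 0.\<close>

lemma rough_lift_holder: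
  fixes X :: "real \<Rightarrow> real ^ 'd::finite"
  assumes T: "T > 0" and \<alpha>: "0 < \<alpha>" "\<alpha> < 1 / 2" and X: "X \<in> sobolev_paths \<alpha> \<infinity> T"
  shows "\<exists>Y. Y \<in> sobolev_rough_paths \<alpha> \<infinity> T \<and> rough_path_lift T X Y"
proof -
  have cX: "continuous_on {0..T} X" using X by (simp add: sobolev_paths_def)
  define S where "S = sobolev_seminorm dist \<alpha> \<infinity> T X"
  have S: "S < \<infinity>" using X by (simp add: sobolev_paths_def sobolev_norm_def S_def)
  define L where "L = enn2real S"
  have SL: "S = ennreal L" and L: "L \<ge> 0" using S by (auto simp: L_def less_top)
  have holder: "dist (X x) (X y) \<le> L * \<bar>x - y\<bar> powr \<alpha>" if "x \<in> {0..T}" "y \<in> {0..T}" for x y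
  proof (cases "x = y")
    case False
    have "ennreal (dist (X x) (X y) / \<bar>y - x\<bar> powr \<alpha>) \<le> S"
      unfolding S_def sobolev_seminorm_def using that False by (auto intro!: SUP_upper2[of "(x, y)"])
    then have "dist (X x) (X y) / \<bar>y - x\<bar> powr \<alpha> \<le> L" using L by (simp add: SL)
    then show ?thesis using False by (simp add: field_simps abs_minus_commute)
  qed simp
  have comp: "\<bar>X x $ i - X y $ i\<bar> \<le> L * \<bar>x - y\<bar> powr \<alpha>" if "x \<in> {0..T}" "y \<in> {0..T}" for x y i
    using component_le_norm_cart[of "X x - X y" i] holder[OF that] by (simp add: dist_norm)
  have ab: "2 * (\<alpha> + 0) < 1" using \<alpha> by simp
  show ?thesis
  proof (rule rough_lift_exists[OF T cX \<alpha>(1) L _ \<alpha>(1) order_refl ab])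
    show "\<bar>X x $ i - X y $ i\<bar> \<le> L * \<bar>x - y\<bar> powr \<alpha>" if "x \<in> {0..T}" "y \<in> {0..T}" for x y i
      by (rule comp[OF that])
    fix Y C assume Y: "Y ` {0..T} \<subseteq> G2" "continuous_on {0..T} Y" "rough_path_lift T X Y" and C: "C \<ge> 0"
      and bd: "\<And>s t k. s \<in> {0..T} \<Longrightarrow> t \<in> {0..T} \<Longrightarrow> s \<noteq> t \<Longrightarrow> k \<ge> 0 \<Longrightarrow>
       (\<And>i x y. x \<in> {0..T} \<Longrightarrow> y \<in> {0..T} \<Longrightarrow>
          \<bar>X x $ i - X y $ i\<bar> \<le> k * \<bar>x - y\<bar> powr \<alpha> * max (max \<bar>x - s\<bar> \<bar>y - s\<bar>) \<bar>t - s\<bar> powr 0) \<Longrightarrow>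
       0 \<le> cc_dist (Y s) (Y t) \<and> cc_dist (Y s) (Y t) \<le> C * (dist (X s) (X t) + k * \<bar>t - s\<bar> powr (\<alpha> + 0))"
    have "cc_dist (Y s) (Y t) / \<bar>t - s\<bar> powr \<alpha> \<le> 2 * C * L" if st: "s \<in> {0..T}" "t \<in> {0..T}" "s \<noteq> t" for s t
    proof -
      have "cc_dist (Y s) (Y t) \<le> C * (dist (X s) (X t) + L * \<bar>t - s\<bar> powr (\<alpha> + 0))"
      proof (rule bd[OF st L, THEN conjunct2])
        fix i x y assume xy: "x \<in> {0..T}" "y \<in> {0..T}"
        \<comment> \<open>Positivity matters because \<open>0 powr 0 = 0\<close>.\<close>
        have "max (max \<bar>x - s\<bar> \<bar>y - s\<bar>) \<bar>t - s\<bar> > 0" using st by (auto simp: less_max_iff_disj)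
        then have "max (max \<bar>x - s\<bar> \<bar>y - s\<bar>) \<bar>t - s\<bar> powr 0 = 1" by (metis less_irrefl powr_zero_eq_one)
        then show "\<bar>X x $ i - X y $ i\<bar> \<le> L * \<bar>x - y\<bar> powr \<alpha> * max (max \<bar>x - s\<bar> \<bar>y - s\<bar>) \<bar>t - s\<bar> powr 0"
          using comp[OF xy] by (simp only: mult_1_right)
      qed
      also have "\<dots> \<le> C * (L * \<bar>t - s\<bar> powr \<alpha> + L * \<bar>t - s\<bar> powr \<alpha>)"
        using holder[OF st(1,2)] C by (intro mult_left_mono) (auto simp: abs_minus_commute)
      finally show ?thesis using st by (simp add: pos_divide_le_eq mult_ac)
    qed
    then have "sobolev_seminorm cc_dist \<alpha> \<infinity> T Y \<le> ennreal (2 * C * L)"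
      unfolding sobolev_seminorm_def by (auto intro!: SUP_least ennreal_leI)
    then have "sobolev_seminorm cc_dist \<alpha> \<infinity> T Y < \<infinity>" using le_less_trans by fastforce
    then show ?thesis using Y by (auto simp: sobolev_rough_paths_def)
  qed
qed

lemma rough_lift_sobolev:
  fixes X :: "real \<Rightarrow> real ^ 'd::finite"
  assumes T: "T > 0" and \<alpha>: "1 / q < \<alpha>" "\<alpha> < 1 / 2" and q: "q > 1" and X: "X \<in> sobolev_paths \<alpha> (ereal q) T"
  shows "\<exists>Y. Y \<in> sobolev_rough_paths \<alpha> (ereal q) T \<and> rough_path_lift T X Y"
proof -
  have cX: "continuous_on {0..T} X" using X by (simp add: sobolev_paths_def)
  have \<alpha>q: "\<alpha> * q > 1" using \<alpha> q by (simp add: field_simps)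
  \<comment> \<open>The weaker energy has order (\<alpha> + 1/q) / 2, which is \<alpha> -
    \<open>\<nu> / q\<close>, and \<open>\<sigma>\<close> is that order minus 1/q.
    \<open>\<theta>\<close> is the exponent that \<open>energy_max_integral_le\<close> requires.
    With this \<open>\<mu>\<close> the sewing exponent \<open>\<sigma> + \<theta> / q\<close> equals
    \<alpha> + \<open>\<mu> / q\<close>, the midpoint of \<alpha> and 1/2.\<close>
  define \<nu> where "\<nu> = (\<alpha> * q - 1) / 2"
  define \<sigma> where "\<sigma> = \<nu> / q"
  define \<mu> where "\<mu> = (1 - 2 * \<alpha>) * q / 4"
  define \<theta> where "\<theta> = \<mu> + \<nu> + 1"
  have pos: "\<nu> > 0" "\<sigma> > 0" "\<mu> > 0" "\<theta> > 0"
    using \<alpha>q \<alpha> q by (auto simp: \<nu>_def \<sigma>_def \<mu>_def \<theta>_def intro!: add_pos_pos)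
  have \<sigma>q: "\<sigma> * q = \<nu>" using q by (simp add: \<sigma>_def)
  have sum: "(\<sigma> + \<theta> / q) * q = \<mu> + \<alpha> * q"
  proof -
    have "(\<sigma> + \<theta> / q) * q = \<sigma> * q + \<theta>" using q by (simp add: distrib_right)
    also have "\<dots> = \<nu> + (\<mu> + \<nu> + 1)" by (simp only: \<sigma>q \<theta>_def)
    also have "\<dots> = \<mu> + \<alpha> * q" by (simp add: \<nu>_def)
    finally show ?thesis .
  qed
  have ab: "2 * (\<sigma> + \<theta> / q) < 1"
  proof -
    have "2 * (\<sigma> + \<theta> / q) * q = 2 * (\<mu> + \<alpha> * q)" using sum by (simp only: mult.assoc)
    also have "\<dots> < 1 * q"
    proof -
      have "\<alpha> * q < 1 / 2 * q" using \<alpha> q by (intro mult_strict_right_mono) auto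
      then show ?thesis by (simp add: \<mu>_def field_simps)
    qed
    finally show ?thesis using q by (simp only: mult_less_cancel_right_pos[of q])
  qed
  define w where "w = sobolev_density T X q (\<sigma> * q + 2)"
  define w\<alpha> where "w\<alpha> = sobolev_density T X q (\<alpha> * q + 1)"
  have wm: "w \<in> borel_measurable borel" "w\<alpha> \<in> borel_measurable borel"
    by (auto simp: w_def w\<alpha>_def intro!: borel_measurable_sobolev_density T cX)
  \<comment> \<open>The factor left by the kernel integration restores the original order
    exactly.\<close>
  have ww: "w z * ennreal (\<bar>fst z - snd z\<bar> powr (- \<nu>)) = w\<alpha> z" for z
  proof -
    have "\<sigma> * q + 2 + \<nu> = \<alpha> * q + 1" by (simp add: \<sigma>q) (simp add: \<nu>_def diff_divide_distrib)
    then show ?thesis unfolding w_def w\<alpha>_def sobolev_density_times_powr by (simp only:)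
  qed
  define I where "I = (\<integral>\<^sup>+z. w\<alpha> z \<partial>lborel)"
  have I: "I < \<infinity>"
  proof -
    have "sobolev_seminorm dist \<alpha> (ereal q) T X < \<infinity>"
      using X by (simp add: sobolev_paths_def sobolev_norm_def)
    then show ?thesis
      by (simp add: sobolev_seminorm_def ennreal_powr_less_top_iff[unfolded infinity_ennreal_def] I_def w\<alpha>_def sobolev_density_def mult.commute)
  qed
  \<comment> \<open>On a bounded interval the weaker energy is at most \<open>T powr \<nu>\<close>
    times the original one. Its finiteness yields the global Hoelder bound under which the series of
    \<open>sewing\<close> converges.\<close>
  define E where "E = enn2real (\<integral>\<^sup>+z. w z \<partial>lborel)"
  have E: "(\<integral>\<^sup>+z. w z \<partial>lborel) = ennreal E" "E \<ge> 0"
  proof -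
    have "(\<integral>\<^sup>+z. w z \<partial>lborel) \<le> (\<integral>\<^sup>+z. ennreal (T powr \<nu>) * w\<alpha> z \<partial>lborel)"
    proof (rule nn_integral_mono)
      fix z :: "real \<times> real"
      obtain u v where z: "z = (u, v)" by (cases z)
      show "w z \<le> ennreal (T powr \<nu>) * w\<alpha> z"
      proof (cases "u \<noteq> v \<and> z \<in> {0..T} \<times> {0..T}")
        case True
        then have uv: "0 < \<bar>u - v\<bar>" "\<bar>u - v\<bar> \<le> T" by (auto simp: z)
        have "\<bar>u - v\<bar> powr \<nu> \<le> T powr \<nu>" using uv pos by (intro powr_mono2) auto
        then have "1 \<le> T powr \<nu> * \<bar>u - v\<bar> powr (- \<nu>)"
          using uv by (simp add: powr_minus divide_inverse[symmetric])
        then have "ennreal 1 \<le> ennreal (T powr \<nu> * \<bar>u - v\<bar> powr (- \<nu>))" by (rule ennreal_leI)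
        then have "1 * w z \<le> ennreal (T powr \<nu> * \<bar>u - v\<bar> powr (- \<nu>)) * w z"
          by (intro mult_right_mono) auto
        then show ?thesis by (simp add: ww[symmetric] z ennreal_mult mult_ac)
      next
        case False
        then have "w z = 0" by (auto simp: w_def z sobolev_density_def)
        then show ?thesis by simp
      qed
    qed
    also have "\<dots> = ennreal (T powr \<nu>) * I"
      unfolding I_def using wm by (intro nn_integral_cmult) simp
    also have "\<dots> < \<infinity>" using I by (simp add: ennreal_mult_less_top)
    finally show "(\<integral>\<^sup>+z. w z \<partial>lborel) = ennreal E" "E \<ge> 0" by (auto simp: E_def less_top)
  qed
  define K where "K = 6 / (1 - (1/2) powr \<sigma>)"
  have K: "K > 0" using half_powr_less_1[OF pos(2)] by (simp add: K_def)
  define L where "L = K * E powr (1 / q)"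
  have L: "L \<ge> 0" using K by (simp add: L_def)
  have global: "\<bar>X x $ i - X y $ i\<bar> \<le> L * \<bar>x - y\<bar> powr \<sigma>" if xy: "x \<in> {0..T}" "y \<in> {0..T}" for x y i
  proof -
    have *: "\<bar>X x $ i - X y $ i\<bar> \<le> L * \<bar>x - y\<bar> powr \<sigma>" if xy: "x \<in> {0..T}" "y \<in> {0..T}" "x < y" for x y
    proof -
      have "(\<integral>\<^sup>+z. indicator ({x..y} \<times> {x..y}) z * w z \<partial>lborel) \<le> (\<integral>\<^sup>+z. w z \<partial>lborel)"
        by (intro nn_integral_mono) (auto simp: indicator_def)
      then have "\<bar>X x $ i - X y $ i\<bar> \<le> K * (y - x) powr \<sigma> * E powr (1 / q)"
        unfolding K_def using E by (intro sobolev_density_holder[OF T cX q pos(2) xy]) (auto simp: w_def)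
      then show ?thesis using xy by (simp add: L_def mult_ac)
    qed
    show ?thesis
      using *[of x y] *[of y x] xy by (cases x y rule: linorder_cases) (auto simp: abs_minus_commute)
  qed
  show ?thesis
  proof (rule rough_lift_exists[OF T cX pos(2) L _ pos(2) _ ab])
    show "\<bar>X x $ i - X y $ i\<bar> \<le> L * \<bar>x - y\<bar> powr \<sigma>" if "x \<in> {0..T}" "y \<in> {0..T}" for x y i
      by (rule global[OF that])
    show "0 \<le> \<theta> / q" using pos q by simp
    fix Y C assume Y: "Y ` {0..T} \<subseteq> G2" "continuous_on {0..T} Y" "rough_path_lift T X Y" and C: "C \<ge> 0"
      and bd: "\<And>s t k. s \<in> {0..T} \<Longrightarrow> t \<in> {0..T} \<Longrightarrow> s \<noteq> t \<Longrightarrow> k \<ge> 0 \<Longrightarrow>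
       (\<And>i x y. x \<in> {0..T} \<Longrightarrow> y \<in> {0..T} \<Longrightarrow>
          \<bar>X x $ i - X y $ i\<bar> \<le> k * \<bar>x - y\<bar> powr \<sigma> * max (max \<bar>x - s\<bar> \<bar>y - s\<bar>) \<bar>t - s\<bar> powr (\<theta> / q)) \<Longrightarrow>
       0 \<le> cc_dist (Y s) (Y t) \<and> cc_dist (Y s) (Y t) \<le> C * (dist (X s) (X t) + k * \<bar>t - s\<bar> powr (\<sigma> + \<theta> / q))"
    define M where "M = (C + 1) powr q * 2 powr q * (1 + K powr q)"
    have M: "M > 0"
    proof -
      have "1 + K powr q > 0" by (simp add: add_pos_nonneg)
      then show ?thesis using C by (simp add: M_def)
    qed
    \<comment> \<open>An integrable majorant, up to the factor \<open>M\<close>: the density of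
      \<open>X\<close> for the first level and the weighted energy for the area.\<close>
    define g where "g z = w\<alpha> z + ennreal (\<bar>snd z - fst z\<bar> powr (\<mu> - 1)) * energy_max w \<theta> z" for z
    have pointwise: "ennreal (cc_dist (Y s) (Y t) powr q / \<bar>t - s\<bar> powr (\<alpha> * q + 1)) \<le> ennreal M * g (s, t)"
      if st: "s \<in> {0..T}" "t \<in> {0..T}" for s t
    \<comment> \<open>On the diagonal the left side is 0 by division by 0. Off the diagonal the
      factor in front of an infinite energy is positive, so the right side is infinite.\<close>
    proof (cases "s = t \<or> energy_max w \<theta> (s, t) = \<infinity>")
      case True
      then show ?thesis
      proof (cases "s = t")
        case False
        then have "ennreal (\<bar>t - s\<bar> powr (\<mu> - 1)) * energy_max w \<theta> (s, t) = \<infinity>"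
          using True by (simp add: ennreal_mult_top)
        then have "ennreal M * g (s, t) = \<infinity>" using M by (simp add: g_def ennreal_mult_top)
        then show ?thesis by simp
      qed simp
    next
      case False
      define \<Phi> where "\<Phi> = enn2real (energy_max w \<theta> (s, t))"
      have \<Phi>: "energy_max w \<theta> (s, t) = ennreal \<Phi>" "\<Phi> \<ge> 0"
        using False by (auto simp: \<Phi>_def less_top)
      define \<tau> where "\<tau> = \<bar>t - s\<bar>"
      have \<tau>: "\<tau> > 0" using False by (simp add: \<tau>_def)
      define k where "k = K * \<Phi> powr (1 / q)"
      have k: "k \<ge> 0" using K by (simp add: k_def)
      have cc: "0 \<le> cc_dist (Y s) (Y t) \<and> cc_dist (Y s) (Y t) \<le> C * (dist (X s) (X t) + k * \<tau> powr (\<sigma> + \<theta> / q))"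
        unfolding \<tau>_def
      proof (rule bd[OF st _ k])
        show "s \<noteq> t" using False by simp
        fix i x y assume "x \<in> {0..T}" "y \<in> {0..T}"
        then show "\<bar>X x $ i - X y $ i\<bar> \<le> k * \<bar>x - y\<bar> powr \<sigma> * max (max \<bar>x - s\<bar> \<bar>y - s\<bar>) \<bar>t - s\<bar> powr (\<theta> / q)"
          unfolding k_def K_def using False \<Phi> unfolding w_def
          by (intro sobolev_density_local_holder[OF T cX q pos(2,4)]) auto
      qed
      define d where "d = dist (X s) (X t)"
      have "cc_dist (Y s) (Y t) powr q \<le> ((C + 1) * (d + k * \<tau> powr (\<sigma> + \<theta> / q))) powr q"
      proof (rule powr_mono2)
        have "C * (d + k * \<tau> powr (\<sigma> + \<theta> / q)) \<le> (C + 1) * (d + k * \<tau> powr (\<sigma> + \<theta> / q))"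
          using k by (intro mult_right_mono) (auto simp: d_def)
        then show "cc_dist (Y s) (Y t) \<le> (C + 1) * (d + k * \<tau> powr (\<sigma> + \<theta> / q))"
          using cc unfolding d_def by linarith
      qed (use q cc in auto)
      also have "\<dots> = (C + 1) powr q * (d + k * \<tau> powr (\<sigma> + \<theta> / q)) powr q"
        using C k by (intro powr_mult)
      also have "\<dots> \<le> (C + 1) powr q * (2 powr q * (d powr q + (k * \<tau> powr (\<sigma> + \<theta> / q)) powr q))"
        using k q by (intro mult_left_mono powr_add_le) (auto simp: d_def)
      \<comment> \<open>The q-th power is linear in \<open>\<Phi>\<close>. Dividing by
        \<open>\<tau> powr (\<alpha> * q + 1)\<close> then leaves the weight
        \<open>\<tau> powr (\<mu> - 1)\<close> that \<open>energy_max_integral_le\<close>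
        expects.\<close>
      also have "(k * \<tau> powr (\<sigma> + \<theta> / q)) powr q = K powr q * \<Phi> * \<tau> powr (\<mu> + \<alpha> * q)"
        using K \<Phi> q by (simp add: k_def powr_mult powr_powr sum)
      also have "(C + 1) powr q * (2 powr q * (d powr q + K powr q * \<Phi> * \<tau> powr (\<mu> + \<alpha> * q)))
          \<le> M * (d powr q + \<Phi> * \<tau> powr (\<mu> + \<alpha> * q))"
      proof -
        have "d powr q + K powr q * \<Phi> * \<tau> powr (\<mu> + \<alpha> * q) \<le> (1 + K powr q) * (d powr q + \<Phi> * \<tau> powr (\<mu> + \<alpha> * q))"
          using \<Phi> by (simp add: algebra_simps)
        then have "((C + 1) powr q * 2 powr q) * (d powr q + K powr q * \<Phi> * \<tau> powr (\<mu> + \<alpha> * q))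
          \<le> ((C + 1) powr q * 2 powr q) * ((1 + K powr q) * (d powr q + \<Phi> * \<tau> powr (\<mu> + \<alpha> * q)))"
          by (intro mult_left_mono) auto
        then show ?thesis by (simp only: M_def mult.assoc)
      qed
      finally have "cc_dist (Y s) (Y t) powr q / \<tau> powr (\<alpha> * q + 1)
          \<le> M * (d powr q + \<Phi> * \<tau> powr (\<mu> + \<alpha> * q)) / \<tau> powr (\<alpha> * q + 1)"
        by (intro divide_right_mono) auto
      also have "\<dots> = M * (d powr q / \<tau> powr (\<alpha> * q + 1) + \<tau> powr (\<mu> - 1) * \<Phi>)"
      proof -
        have "\<tau> powr (\<mu> + \<alpha> * q) / \<tau> powr (\<alpha> * q + 1) = \<tau> powr (\<mu> - 1)"
          unfolding powr_diff[symmetric] by simp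
        then show ?thesis by (simp add: add_divide_distrib[symmetric] distrib_left times_divide_eq_right[symmetric] add_divide_distrib mult.commute del: times_divide_eq_right)
      qed
      finally have "ennreal (cc_dist (Y s) (Y t) powr q / \<tau> powr (\<alpha> * q + 1))
          \<le> ennreal (M * (d powr q / \<tau> powr (\<alpha> * q + 1) + \<tau> powr (\<mu> - 1) * \<Phi>))"
        by (rule ennreal_leI)
      also have "\<dots> = ennreal M * (ennreal (d powr q / \<tau> powr (\<alpha> * q + 1)) + ennreal (\<tau> powr (\<mu> - 1)) * ennreal \<Phi>)"
        using M \<Phi> by (simp add: ennreal_mult)
      also have "\<dots> = ennreal M * g (s, t)"
        using st by (simp add: g_def w\<alpha>_def sobolev_density_def d_def \<tau>_def \<Phi>)
      finally show ?thesis by (simp add: \<tau>_def)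
    qed
    have gm: "(\<lambda>z. ennreal (\<bar>snd z - fst z\<bar> powr (\<mu> - 1)) * energy_max w \<theta> z) \<in> borel_measurable borel"
      by (intro borel_measurable_times_ennreal borel_measurable_energy_max wm measurable_compose[OF _ measurable_ennreal]
          powr_real_measurable borel_measurable_continuous_onI continuous_intros)
    have "(\<integral>\<^sup>+z\<in>{0..T} \<times> {0..T}. ennreal (cc_dist (Y (fst z)) (Y (snd z)) powr q / \<bar>snd z - fst z\<bar> powr (\<alpha> * q + 1)) \<partial>lborel)
       \<le> (\<integral>\<^sup>+z. ennreal M * g z \<partial>lborel)"
      using pointwise by (intro nn_integral_mono) (auto simp: indicator_def)
    also have "\<dots> = ennreal M * (\<integral>\<^sup>+z. g z \<partial>lborel)"
      unfolding g_def using wm gm by (intro nn_integral_cmult) simp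
    also have "(\<integral>\<^sup>+z. g z \<partial>lborel) = I + (\<integral>\<^sup>+z. ennreal (\<bar>snd z - fst z\<bar> powr (\<mu> - 1)) * energy_max w \<theta> z \<partial>lborel)"
      unfolding g_def I_def using wm gm by (intro nn_integral_add) auto
    also have "ennreal M * \<dots> < \<infinity>"
    proof -
      have "(\<integral>\<^sup>+z. ennreal (\<bar>snd z - fst z\<bar> powr (\<mu> - 1)) * energy_max w \<theta> z \<partial>lborel)
        \<le> ennreal (4 * (1 / \<mu> + 1 / (\<nu> + 1)) * (1 + 1 / \<nu>) * 2 powr \<nu>) * I"
        unfolding \<theta>_def I_def ww[symmetric]
        by (rule energy_max_integral_le[OF pos(3,1) wm(1)]) (simp add: w_def)
      also have "\<dots> < \<infinity>" using I by (simp add: ennreal_mult_less_top)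
      finally show ?thesis using I by (simp add: ennreal_mult_less_top)
    qed
    finally have "sobolev_seminorm cc_dist \<alpha> (ereal q) T Y < \<infinity>"
      by (simp add: sobolev_seminorm_def ennreal_powr_less_top_iff[unfolded infinity_ennreal_def])
    then show ?thesis using Y by (auto simp: sobolev_rough_paths_def)
  qed
qed

theorem theorem3p8:
  fixes T \<alpha> :: real and p :: ereal and X :: "real \<Rightarrow> real ^ 'd::finite"
  assumes "T > 0"
    and "1 / 3 < \<alpha>" and "\<alpha> < 1 / 2"
    and "1 < p"
    and "ereal \<alpha> > 1 / p"
    and "X \<in> sobolev_paths \<alpha> p T"
  shows "\<exists>Y. Y \<in> sobolev_rough_paths \<alpha> p T \<and> rough_path_lift T X Y"
proof (cases p)
  case (real q)
  have "q > 1" using assms(4) real by simp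
  moreover have "1 / q < \<alpha>" using assms(5) \<open>q > 1\<close> by (simp add: real one_ereal_def)
  ultimately show ?thesis using rough_lift_sobolev[of T q \<alpha> X] assms real by simp
next
  case PInf
  then show ?thesis using rough_lift_holder[of T \<alpha> X] assms by simp
next
  case MInf
  then show ?thesis using assms(4) by simp
qed

end
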